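(* Let $\beta,L>0$, $d\ge1$ and $\varepsilon>0$. The Carathéodory coreset estimator $\hat g_S(y)$ built using the kernel $k_s$ with bandwidth $h=n^{-\frac{1}{2\beta+d}}$ and cutoff frequency $T=c_{d,\beta,\varepsilon}\,n^{\frac{\varepsilon}{d}+\frac{1}{2\beta+d}}$ satisfies $$\sup_{f\in\mathcal{P}_{\mathcal{H}}(\beta,L)}\mathbb{E}_f\|\hat g_S-f\|_2\le c_{\beta,d,L}\,n^{-\frac{\beta}{2\beta+d}}.$$ The corresponding coreset has cardinality at most $m=c_{d,\beta,\varepsilon}\,n^{\frac{d}{2\beta+d}+\varepsilon}$.
   Context: Constants $c$ with subscripts are positive constants depending only on the subscripts (and on the fixed kernel); they may differ from occurrence to occurrence and their existence is part of the assertion. Hölder densities: for $\beta>0$ let $\lfloor\beta\rfloor$ be the largest integer strictly less than $\beta$. $\mathcal{H}(\beta,L)$ is the set of $f:\mathbb{R}^d\to\mathbb{R}$ supported on $[-1/2,1/2]^d$, $\lfloor\beta\rfloor$ times differentiable, with $|D^sf(x)-D^sf(y)|\le L|x-y|_2^{\beta-\lfloor\beta\rfloor}$ for all $x,y\in\mathbb{R}^d$ and all multi-indices $s$ with $|s|_1=\lfloor\beta\rfloor$. $\mathcal{P}_{\mathcal{H}}(\beta,L)$ is the set of probability densities in $\mathcal{H}(\beta,L)$. $\mathbb{E}_f$ is expectation for $X_1,\dots,X_n$ i.i.d. with density $f$. $\|\cdot\|_2$ is the $L_2$ norm. Kernel $k_s$: fix an even function $\psi:\mathbb{R}\to[0,1]$,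 $\psi\in\mathcal{C}^\infty$, $\psi\equiv1$ on $[-1,1]$, $\psi$ supported on $[-2,2]$. Let $\kappa_s=\mathcal{F}[\psi]$, the Fourier transform normalized so that $\psi(\omega)=\int\kappa_s(x)e^{-ix\omega}\,dx$ (in particular $\int\kappa_s=1$), and $k_s(x)=\prod_{i=1}^d\kappa_s(x_i)$. Carathéodory coreset estimator: for a kernel $k$ and $h>0$ write $k_h(x)=h^{-d}k(x/h)$. Given $X_1,\dots,X_n\in\mathbb{R}^d$ and $T>0$, let $A=\{\omega\in\frac{\pi}{2}\mathbb{Z}^d:|\omega|_\infty\le T\}$. By Carathéodory's theorem there are $S\subset[n]$ with $|S|\le 2(1+\frac{4T}{\pi})^d+1$ and weights $\lambda_j\ge0$ ($j\in S$), $\sum_{j\in S}\lambda_j=1$, with $\frac1n\sum_{j=1}^ne^{i\langle X_j,\omega\rangle}=\sum_{j\in S}\lambda_je^{i\langle X_j,\omega\rangle}$ for all $\omega\in A$ (chosen as measurable functions of the data). The estimator is $\hat g_S(y)=\sum_{j\in S}\lambda_jk_h(X_j-y)$. *)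

theory Defs
  imports "HOL-Probability.Probability"
begin

section \<open>Hoelder densities\<close>

text \<open>The largest integer strictly less than \<open>\<beta>\<close>; thus \<open>strict_floor 1 = 0\<close>.\<close>

definition strict_floor :: "real \<Rightarrow> nat" where
  "strict_floor \<beta> = nat (\<lceil>\<beta>\<rceil> - 1)"

lemma strict_floor_greatest:
  assumes "0 < \<beta>"
  shows "real (strict_floor \<beta>) < \<beta>"
    and "\<And>m::int. of_int m < \<beta> \<Longrightarrow> m \<le> int (strict_floor \<beta>)"
  using assms unfolding strict_floor_def by linarith+

definition partial_deriv :: "'d \<Rightarrow> (real^'d \<Rightarrow> real) \<Rightarrow> real^'d \<Rightarrow> real" where
  "partial_deriv i f x = deriv (\<lambda>t. f (x + t *\<^sub>R axis i 1)) 0"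

text \<open>\<open>k\<close>-fold (Frechet) differentiability: a map into the reals is \<open>Suc k\<close> times differentiable
  iff it is differentiable and all components of its derivative are \<open>k\<close> times differentiable.\<close>

fun times_differentiable :: "nat \<Rightarrow> (real^'d \<Rightarrow> real) \<Rightarrow> bool" where
  "times_differentiable 0 f \<longleftrightarrow> True"
| "times_differentiable (Suc k) f \<longleftrightarrow>
     (\<forall>x. f differentiable (at x)) \<and> (\<forall>i. times_differentiable k (partial_deriv i f))"

text \<open>A multi-index is a function \<open>s :: 'd \<Rightarrow> nat\<close> with \<open>|s|\<^sub>1 = sum s UNIV\<close>. A finite index type
  carries no order, so one enumeration of the coordinates is fixed; for functions that are
  \<open>|s|\<^sub>1\<close> times differentiable the order of differentiation is immaterial.\<close>

definition coords :: "'d::finite list" where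
  "coords = (SOME is. distinct is \<and> set is = UNIV)"

definition multi_deriv :: "('d \<Rightarrow> nat) \<Rightarrow> (real^'d \<Rightarrow> real) \<Rightarrow> real^'d \<Rightarrow> real" where
  "multi_deriv s f = foldr (\<lambda>i. partial_deriv i ^^ s i) coords f"

definition holder_class :: "real \<Rightarrow> real \<Rightarrow> (real^'d \<Rightarrow> real) set" where
  "holder_class \<beta> L = {f.
     (\<forall>x. x \<notin> cbox (\<chi> i. - 1/2) (\<chi> i. 1/2) \<longrightarrow> f x = 0) \<and>
     times_differentiable (strict_floor \<beta>) f \<and>
     (\<forall>s. sum s UNIV = strict_floor \<beta> \<longrightarrow>
       (\<forall>x y. \<bar>multi_deriv s f x - multi_deriv s f y\<bar>
                \<le> L * norm (x - y) powr (\<beta> - real (strict_floor \<beta>))))}"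

definition holder_densities :: "real \<Rightarrow> real \<Rightarrow> (real^'d \<Rightarrow> real) set" where
  "holder_densities \<beta> L = {f \<in> holder_class \<beta> L.
     f \<in> borel_measurable borel \<and> (\<forall>x. 0 \<le> f x) \<and> (\<integral>\<^sup>+x. ennreal (f x) \<partial>lborel) = 1}"


section \<open>The kernel\<close>

definition cutoff_function :: "(real \<Rightarrow> real) \<Rightarrow> bool" where
  "cutoff_function \<psi> \<longleftrightarrow>
     (\<forall>t. \<psi> t \<in> {0..1}) \<and> (\<forall>t. \<psi> (- t) = \<psi> t) \<and>
     (\<forall>k t. (deriv ^^ k) \<psi> differentiable (at t)) \<and>
     (\<forall>t\<in>{-1..1}. \<psi> t = 1) \<and> (\<forall>t. t \<notin> {-2..2} \<longrightarrow> \<psi> t = 0)"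

text \<open>The normalisation \<open>\<psi>(\<omega>) = \<integral> \<kappa>(x) exp(-i x \<omega>) dx\<close> means
  \<open>\<kappa>(x) = (2 \<pi>)\<^sup>-\<^sup>1 \<integral> \<psi>(\<omega>) exp(i x \<omega>) d\<omega>\<close>. This value is real because \<open>\<psi>\<close> is real and even;
  \<open>Re\<close> only changes the type.\<close>

definition kernel1 :: "(real \<Rightarrow> real) \<Rightarrow> real \<Rightarrow> real" where
  "kernel1 \<psi> x = Re (1 / (2 * pi) * (\<integral>w. of_real (\<psi> w) * exp (\<i> * of_real (x * w)) \<partial>lborel))"

definition product_kernel :: "(real \<Rightarrow> real) \<Rightarrow> real^'d \<Rightarrow> real" where
  "product_kernel \<psi> x = (\<Prod>i\<in>UNIV. kernel1 \<psi> (x $ i))"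

definition scaled_kernel :: "(real^'d \<Rightarrow> real) \<Rightarrow> real \<Rightarrow> real^'d \<Rightarrow> real" where
  "scaled_kernel k h x = k ((1 / h) *\<^sub>R x) / h ^ CARD('d)"


section \<open>The Caratheodory coreset estimator\<close>

definition frequencies :: "real \<Rightarrow> (real^'d) set" where
  "frequencies T = {w. (\<forall>i. \<exists>m::int. w $ i = pi / 2 * of_int m) \<and> infnorm w \<le> T}"

text \<open>Data sets of size \<open>n\<close> are elements \<open>X\<close> of the product space over the index set \<open>{1..n}\<close>.\<close>

abbreviation data_space :: "nat \<Rightarrow> (nat \<Rightarrow> real^'d) measure" where
  "data_space n \<equiv> PiM {1..n} (\<lambda>_. borel)"

definition caratheodory_coreset ::
  "nat \<Rightarrow> real \<Rightarrow> (nat \<Rightarrow> real^'d) \<Rightarrow> nat set \<Rightarrow> (nat \<Rightarrow> real) \<Rightarrow> bool" where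
  "caratheodory_coreset n T X S lam \<longleftrightarrow>
     S \<subseteq> {1..n} \<and> real (card S) \<le> 2 * (1 + 4 * T / pi) ^ CARD('d) + 1 \<and>
     (\<forall>j\<in>S. 0 \<le> lam j) \<and> (\<Sum>j\<in>S. lam j) = 1 \<and>
     (\<forall>w\<in>frequencies T.
        1 / of_nat n * (\<Sum>j=1..n. exp (\<i> * of_real (X j \<bullet> w))) =
        (\<Sum>j\<in>S. of_real (lam j) * exp (\<i> * of_real (X j \<bullet> w))))"

text \<open>A measurable choice, for every data set, of a coreset and of its weights. The values
  \<open>lam X j\<close> with \<open>j \<notin> S X\<close> are irrelevant, hence the conditional in the last clause.\<close>

definition caratheodory_selection ::
  "nat \<Rightarrow> real \<Rightarrow> ((nat \<Rightarrow> real^'d) \<Rightarrow> nat set) \<Rightarrow> ((nat \<Rightarrow> real^'d) \<Rightarrow> nat \<Rightarrow> real) \<Rightarrow> bool" where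
  "caratheodory_selection n T S lam \<longleftrightarrow>
     (\<forall>X\<in>space (data_space n). caratheodory_coreset n T X (S X) (lam X)) \<and>
     S \<in> measurable (data_space n) (count_space (Pow {1..n})) \<and>
     (\<forall>j\<in>{1..n}. (\<lambda>X. if j \<in> S X then lam X j else 0) \<in> borel_measurable (data_space n))"

definition coreset_estimator ::
  "(real^'d \<Rightarrow> real) \<Rightarrow> real \<Rightarrow> ((nat \<Rightarrow> real^'d) \<Rightarrow> nat set) \<Rightarrow> ((nat \<Rightarrow> real^'d) \<Rightarrow> nat \<Rightarrow> real)
     \<Rightarrow> (nat \<Rightarrow> real^'d) \<Rightarrow> real^'d \<Rightarrow> real" where
  "coreset_estimator k h S lam X y = (\<Sum>j\<in>S X. lam X j * scaled_kernel k h (X j - y))"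


section \<open>Risk\<close>

text \<open>Both the \<open>L\<^sub>2\<close> norm and the expectation take values in \<open>ennreal\<close>, so that a bound on them
  includes finiteness (a Bochner integral would silently be 0 on non-integrable functions).\<close>

definition L2_norm :: "(real^'d \<Rightarrow> real) \<Rightarrow> ennreal" where
  "L2_norm g = (let I = (\<integral>\<^sup>+y. ennreal ((g y)\<^sup>2) \<partial>lborel)
                in if I = \<top> then \<top> else ennreal (sqrt (enn2real I)))"

definition risk ::
  "nat \<Rightarrow> ((nat \<Rightarrow> real^'d) \<Rightarrow> real^'d \<Rightarrow> real) \<Rightarrow> (real^'d \<Rightarrow> real) \<Rightarrow> ennreal" where
  "risk n g f = (\<integral>\<^sup>+X. L2_norm (\<lambda>y. g X y - f y)
                   \<partial>PiM {1..n} (\<lambda>_. density lborel (\<lambda>x. ennreal (f x))))"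

end

theory Submission
  imports Defs
begin

text \<open>
  The kernel $\kappa$ is the limit of the lattice sums
  $P_\delta(s) = \frac{\delta}{2\pi}\sum_k \psi(k\delta) e^{i k \delta s}$. Halving the step gives the
  exact identity $P_\delta(s) = P_{\delta/2}(s) + P_{\delta/2}(s + 2\pi/\delta)$, and repeated summation by parts
  makes the second term $O(\delta^N)$ for $|s| \le \pi/\delta$. Telescoping yields
  $|P_\delta - \kappa| = O(\delta^N)$ on that range, as well as the rapid decay and the vanishing moments of $\kappa$,
  without Poisson summation or Fourier inversion.

  With $\delta = h\pi/2$ the function $h^{-1} P_\delta(\cdot/h)$ is a trigonometric polynomial with frequencies in
  $\frac{\pi}{2}\mathbb{Z} \cap [-2/h, 2/h]$. Once $T \ge 2/h$ its coreset average and its full sample average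
  coincide, so the coreset estimator and the kernel density estimator differ only by the error of
  replacing $\kappa_h$ by that polynomial on $[-2,2]^d$, and by the tails of $\kappa_h$ elsewhere. The constant
  in $T$ can thus be taken to be 2.

  The smoothing bias is treated one coordinate at a time: Taylor expansion in a single coordinate only
  needs pure derivatives, and the moments of $\kappa$ remove the Taylor polynomial. All errors are
  bounded pointwise by a multiple of $h^\beta \prod_i (1 + y_i^2)^{-1}$, which is in $L_2$.
\<close>

section \<open>Lattice sums of the cutoff function\<close>

text \<open>The coreset agrees with the sample only on trigonometric polynomials of period 4 in
  every coordinate, whereas the kernel has a continuous spectrum. Period 4 suffices because the
  density lives in a cube of side 1: if all |y_i| are at most 3/2, every difference X_j - y stays in
  one period [-2,2]^d; otherwise some coordinate of X_j - y exceeds 1 in modulus, where the rescaled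
  kernel is already negligible. The 2 in T is the radius of the support of \<psi>.

  The vanishing moments come from \<psi> = 1 near 0: the j-th moment is the limit of a j-th finite
  difference of \<psi> at 0.

  The coreset error and the bias have deterministic bounds valid for almost every sample, so
  randomness enters only through a sample mean. Its variance is integrated over y by Tonelli. The
  step from the squared norm to the norm uses the arithmetic-geometric mean inequality with the
  target rate as parameter, since that bound is linear in the squared norm.\<close>

lemma higher_deriv_backward_difference:
  fixes g :: "real \<Rightarrow> real"
  assumes "\<And>k t. (deriv ^^ k) g differentiable (at t)"
  shows "(deriv ^^ k) (\<lambda>w. g (w - a) - g w) = (\<lambda>w. (deriv ^^ k) g (w - a) - (deriv ^^ k) g w)"
proof (induction k)
  case (Suc k)
  have D: "((deriv ^^ k) g has_real_derivative (deriv ^^ Suc k) g t) (at t)" for t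
    using assms[of k t] by (simp add: DERIV_deriv_iff_real_differentiable)
  have "((\<lambda>w. (deriv ^^ k) g (w - a) - (deriv ^^ k) g w) has_real_derivative
      (deriv ^^ Suc k) g (w - a) - (deriv ^^ Suc k) g w) (at w)" for w
    by (auto intro!: derivative_eq_intros DERIV_chain2[OF D] D)
  then show ?case
    using Suc.IH by (auto dest: DERIV_imp_deriv)
qed simp

text \<open>Shifting the window trades the leftmost term for one beyond the right end. Here both
  will be zero, so summation by parts has no boundary terms.\<close>

lemma sum_int_shift:
  fixes f :: "int \<Rightarrow> 'a::ab_group_add"
  assumes "0 \<le> K" "f (K + 1) = f (- K)"
  shows "(\<Sum>k=-K..K. f (k + 1)) = (\<Sum>k=-K..K. f k)"
proof -
  have "(\<Sum>k=-K..K. f (k + 1)) = (\<Sum>k=-K+1..K+1. f k)"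
    by (rule sum.reindex_bij_witness[of _ "\<lambda>k. k - 1" "\<lambda>k. k + 1"]) auto
  also have "{-K+1..K+1} = insert (K + 1) {-K+1..K}"
    using assms by auto
  also have "(\<Sum>k\<in>insert (K + 1) {-K+1..K}. f k) = (\<Sum>k\<in>insert (- K) {-K+1..K}. f k)"
    using assms by simp
  also have "insert (- K) {-K+1..K} = {-K..K}"
    using assms by auto
  finally show ?thesis .
qed

text \<open>Multiplying the sum by \<open>cis \<theta> - 1\<close> replaces \<open>g\<close> by its
  backward difference, whose derivatives are smaller by a factor \<delta> at the price of one more
  derivative of \<open>g\<close>. Each round also widens the support by one cell; the support
  hypothesis reserves \<open>N\<close> cells for this.\<close>

lemma norm_lattice_sum_by_parts:
  fixes g :: "real \<Rightarrow> real" and K :: int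
  assumes "0 < \<delta>" "0 \<le> K"
    and "\<And>k t. (deriv ^^ k) g differentiable (at t)"
    and "\<And>t. \<bar>(deriv ^^ N) g t\<bar> \<le> B"
    and "\<And>w. \<bar>w\<bar> \<ge> (of_int K - of_nat N) * \<delta> \<Longrightarrow> g w = 0"
  shows "norm (cis \<theta> - 1) ^ N * norm (\<Sum>k=-K..K. of_real (g (of_int k * \<delta>)) * cis (of_int k * \<theta>))
           \<le> (2 * of_int K + 1) * B * \<delta> ^ N"
  using assms(3-5)
proof (induction N arbitrary: g B)
  case 0
  have "norm (\<Sum>k=-K..K. of_real (g (of_int k * \<delta>)) * cis (of_int k * \<theta>)) \<le> (\<Sum>k=-K..K. B)"
    by (rule sum_norm_le) (use "0.prems"(2) in \<open>auto simp: norm_mult\<close>)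
  also have "\<dots> = (2 * of_int K + 1) * B"
    using assms(2) by (simp add: algebra_simps of_nat_nat)
  finally show ?case by simp
next
  case (Suc N)
  define g1 where "g1 = (\<lambda>w. g (w - \<delta>) - g w)"
  have d1: "(deriv ^^ k) g1 = (\<lambda>w. (deriv ^^ k) g (w - \<delta>) - (deriv ^^ k) g w)" for k
    unfolding g1_def using higher_deriv_backward_difference[OF Suc.prems(1)] .
  have D: "((deriv ^^ k) g has_real_derivative (deriv ^^ Suc k) g t) (at t)" for k t
    using Suc.prems(1)[of k t] by (simp add: DERIV_deriv_iff_real_differentiable)
  have diff1: "(deriv ^^ k) g1 differentiable (at t)" for k t
  proof -
    have "((deriv ^^ k) g1 has_real_derivative (deriv ^^ Suc k) g (t - \<delta>) - (deriv ^^ Suc k) g t) (at t)"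
      unfolding d1 by (auto intro!: derivative_eq_intros DERIV_chain2[OF D] D)
    then show ?thesis by (auto simp: real_differentiable_def)
  qed
  have bound1: "\<bar>(deriv ^^ N) g1 t\<bar> \<le> B * \<delta>" for t
  proof -
    have "norm ((deriv ^^ N) g (t - \<delta>) - (deriv ^^ N) g t) \<le> B * norm (t - \<delta> - t)"
      by (rule field_differentiable_bound[where S = UNIV and f' = "(deriv ^^ Suc N) g"])
         (use D Suc.prems(2) in auto)
    then show ?thesis
      using assms(1) by (simp add: d1)
  qed
  have supp1: "g1 w = 0" if "\<bar>w\<bar> \<ge> (of_int K - of_nat N) * \<delta>" for w
  proof -
    have "\<bar>w - \<delta>\<bar> \<ge> (of_int K - of_nat (Suc N)) * \<delta>" "\<bar>w\<bar> \<ge> (of_int K - of_nat (Suc N)) * \<delta>"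
      using that assms(1) by (auto simp: algebra_simps)
    then show ?thesis
      using Suc.prems(3) by (simp add: g1_def)
  qed
  \<comment> \<open>The index is chosen so that \<open>f (k + 1)\<close> is
    \<open>cis \<theta>\<close> times the k-th term; its values at both ends of the window lie in
    the reserved cells and vanish.\<close>
  define f where "f = (\<lambda>k::int. complex_of_real (g (of_int (k - 1) * \<delta>)) * cis (of_int k * \<theta>))"
  have gz: "g (of_int K * \<delta>) = 0" "g (of_int (- K - 1) * \<delta>) = 0"
  proof -
    have "\<bar>of_int K * \<delta>\<bar> = of_int K * \<delta>" "\<bar>of_int (- K - 1) * \<delta>\<bar> = (of_int K + 1) * \<delta>"
      using assms(1,2) by (simp_all add: abs_mult)
    then show "g (of_int K * \<delta>) = 0" "g (of_int (- K - 1) * \<delta>) = 0"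
      using assms(1) by (auto intro!: Suc.prems(3) mult_right_mono)
  qed
  have fz: "f (K + 1) = f (- K)"
    using gz by (simp add: f_def)
  have mult: "cis \<theta> * (of_real (g (of_int k * \<delta>)) * cis (of_int k * \<theta>)) = f (k + 1)" for k
    by (simp add: f_def cis_mult distrib_right add.commute mult.left_commute)
  have "(cis \<theta> - 1) * (\<Sum>k=-K..K. of_real (g (of_int k * \<delta>)) * cis (of_int k * \<theta>))
      = (\<Sum>k=-K..K. f (k + 1)) - (\<Sum>k=-K..K. of_real (g (of_int k * \<delta>)) * cis (of_int k * \<theta>))"
    by (simp only: left_diff_distrib sum_distrib_left mult mult_1 sum_subtractf)
  also have "(\<Sum>k=-K..K. f (k + 1)) = (\<Sum>k=-K..K. f k)"
    using sum_int_shift[of K f] assms(2) fz by simp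
  also have "\<dots> - (\<Sum>k=-K..K. of_real (g (of_int k * \<delta>)) * cis (of_int k * \<theta>))
      = (\<Sum>k=-K..K. of_real (g1 (of_int k * \<delta>)) * cis (of_int k * \<theta>))"
    unfolding sum_subtractf[symmetric] by (simp add: f_def g1_def algebra_simps)
  finally have "norm (cis \<theta> - 1) ^ Suc N * norm (\<Sum>k=-K..K. of_real (g (of_int k * \<delta>)) * cis (of_int k * \<theta>))
      = norm (cis \<theta> - 1) ^ N * norm (\<Sum>k=-K..K. of_real (g1 (of_int k * \<delta>)) * cis (of_int k * \<theta>))"
    by (metis (no_types, lifting) mult.assoc norm_mult power_Suc2)
  also have "\<dots> \<le> (2 * of_int K + 1) * (B * \<delta>) * \<delta> ^ N"
    by (rule Suc.IH[OF diff1 bound1 supp1])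
  finally show ?case by (simp add: mult_ac)
qed

section \<open>Elementary properties of the cutoff\<close>

lemma cutoff_functionD:
  assumes "cutoff_function \<psi>"
  shows cutoff_nonneg: "0 \<le> \<psi> t" and cutoff_le_one: "\<psi> t \<le> 1" and cutoff_even: "\<psi> (- t) = \<psi> t"
    and cutoff_smooth: "(deriv ^^ k) \<psi> differentiable (at t)"
    and cutoff_eq_one: "\<bar>t\<bar> \<le> 1 \<Longrightarrow> \<psi> t = 1" and cutoff_eq_zero: "\<bar>t\<bar> \<ge> 2 \<Longrightarrow> \<psi> t = 0"
proof -
  have smooth: "(deriv ^^ k) \<psi> differentiable (at t)" for k t
    using assms by (simp add: cutoff_function_def)
  show "0 \<le> \<psi> t" "\<psi> t \<le> 1" "\<psi> (- t) = \<psi> t" "(deriv ^^ k) \<psi> differentiable (at t)"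
    using assms by (auto simp: cutoff_function_def)
  show "\<bar>t\<bar> \<le> 1 \<Longrightarrow> \<psi> t = 1"
    using assms by (auto simp: cutoff_function_def abs_le_iff)
  have zero: "\<psi> t = 0" if "\<bar>t\<bar> > 2" for t
    using assms that by (auto simp: cutoff_function_def abs_if split: if_splits)
  have "isCont \<psi> 2"
    using smooth[of 0 2] differentiable_imp_continuous_within by fastforce
  then have "(\<psi> \<longlongrightarrow> \<psi> 2) (at_right 2)"
    by (simp add: isCont_def filterlim_at_split)
  moreover have "(\<psi> \<longlongrightarrow> 0) (at_right 2)"
    by (rule tendsto_eventually) (use zero in \<open>auto simp: eventually_at intro!: exI[of _ 1]\<close>)
  ultimately have two: "\<psi> 2 = 0"
    using tendsto_unique trivial_limit_at_right_real by blast
  have "\<psi> (- 2) = \<psi> 2"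
    using assms unfolding cutoff_function_def by blast
  moreover have "\<bar>t\<bar> > 2 \<or> t = 2 \<or> t = - 2" if "\<bar>t\<bar> \<ge> 2"
    using that by linarith
  ultimately show "\<bar>t\<bar> \<ge> 2 \<Longrightarrow> \<psi> t = 0"
    using zero two by auto
qed

lemma cutoff_continuous: "cutoff_function \<psi> \<Longrightarrow> continuous_on UNIV \<psi>"
  using cutoff_smooth[of \<psi> 0]
  by (auto intro!: differentiable_imp_continuous_on simp: differentiable_on_def differentiable_at_withinI)

lemma cutoff_deriv_bounded:
  assumes "cutoff_function \<psi>"
  obtains B where "0 < B" "\<And>t. \<bar>(deriv ^^ N) \<psi> t\<bar> \<le> B"
proof -
  have zero: "(deriv ^^ N) \<psi> t = 0" if "\<bar>t\<bar> > 2" for t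
    using that
  proof (induction N arbitrary: t)
    case 0
    then show ?case using cutoff_eq_zero[OF assms] by simp
  next
    case (Suc N)
    have op: "open {t::real. \<bar>t\<bar> > 2}"
      by (intro open_Collect_less continuous_intros)
    have "((deriv ^^ N) \<psi> has_real_derivative 0) (at t) \<longleftrightarrow> ((\<lambda>_. 0) has_real_derivative 0) (at t)"
      by (rule DERIV_cong_ev) (use Suc op in \<open>auto simp: eventually_nhds\<close>)
    then show ?case by (simp add: DERIV_imp_deriv)
  qed
  have "continuous_on {-2..2} ((deriv ^^ N) \<psi>)"
    using cutoff_smooth[OF assms, of N]
    by (auto intro!: differentiable_imp_continuous_on simp: differentiable_on_def differentiable_at_withinI)
  then have "bounded ((deriv ^^ N) \<psi> ` {-2..2})"
    using compact_continuous_image compact_imp_bounded compact_Icc by blast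
  then obtain B where B: "\<And>t. t \<in> {-2..2} \<Longrightarrow> \<bar>(deriv ^^ N) \<psi> t\<bar> \<le> B"
    unfolding bounded_iff by (metis imageI real_norm_def)
  show ?thesis
  proof (rule that[of "max B 1"])
    fix t show "\<bar>(deriv ^^ N) \<psi> t\<bar> \<le> max B 1"
      by (cases "\<bar>t\<bar> > 2") (use B[of t] zero[of t] in \<open>auto simp: abs_if split: if_splits\<close>)
  qed auto
qed

section \<open>Lattice sums: independence of the window and decay\<close>

definition lattice_kernel :: "(real \<Rightarrow> real) \<Rightarrow> real \<Rightarrow> real \<Rightarrow> complex" where
  "lattice_kernel \<psi> \<delta> s = of_real (\<delta> / (2 * pi)) *
     (\<Sum>k=-\<lceil>2/\<delta>\<rceil>..\<lceil>2/\<delta>\<rceil>. of_real (\<psi> (of_int k * \<delta>)) * cis (of_int k * (\<delta> * s)))"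

text \<open>A larger window only adds zeros of \<psi>. The freedom is used for the spare cells of
  summation by parts, for the even window in the halving step, and to contain a prescribed Fourier
  index.\<close>

lemma lattice_kernel_window:
  assumes "cutoff_function \<psi>" "0 < \<delta>" "2 \<le> of_int K * \<delta>"
  shows "lattice_kernel \<psi> \<delta> s = of_real (\<delta> / (2 * pi)) *
     (\<Sum>k=-K..K. of_real (\<psi> (of_int k * \<delta>)) * cis (of_int k * (\<delta> * s)))"
proof -
  have zero: "\<psi> (of_int k * \<delta>) = 0" if "\<bar>k\<bar> > \<lceil>2/\<delta>\<rceil> \<or> \<bar>k\<bar> > K" for k :: int
  proof -
    have "2 / \<delta> \<le> of_int \<bar>k\<bar> \<or> of_int K \<le> (of_int \<bar>k\<bar> :: real)"
      using that by linarith
    then have "2 \<le> of_int \<bar>k\<bar> * \<delta>"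
    proof
      assume "of_int K \<le> (of_int \<bar>k\<bar> :: real)"
      then have "of_int K * \<delta> \<le> of_int \<bar>k\<bar> * \<delta>"
        using assms(2) by (intro mult_right_mono) auto
      then show ?thesis using assms(3) by linarith
    qed (use assms(2) in \<open>simp add: field_simps\<close>)
    then show ?thesis
      using assms(2) by (intro cutoff_eq_zero[OF assms(1)]) (simp add: abs_mult)
  qed
  let ?f = "\<lambda>k. of_real (\<psi> (of_int k * \<delta>)) * cis (of_int k * (\<delta> * s))"
  have "(\<Sum>k=-\<lceil>2/\<delta>\<rceil>..\<lceil>2/\<delta>\<rceil>. ?f k) = (\<Sum>k\<in>{-\<lceil>2/\<delta>\<rceil>..\<lceil>2/\<delta>\<rceil>} \<inter> {-K..K}. ?f k)"
    by (rule sum.mono_neutral_right) (auto intro!: zero)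
  also have "\<dots> = (\<Sum>k=-K..K. ?f k)"
    by (rule sum.mono_neutral_left) (auto intro!: zero)
  finally show ?thesis by (simp add: lattice_kernel_def)
qed

text \<open>The constant is uniform in \<delta> because the number of terms, of order 1/\<delta>, is
  compensated by the prefactor \<delta>.\<close>

lemma lattice_kernel_decay:
  assumes "cutoff_function \<psi>"
  obtains C where "0 < C"
    "\<And>\<delta> s. 0 < \<delta> \<Longrightarrow> \<delta> \<le> 2 \<Longrightarrow> norm (cis (\<delta> * s) - 1) ^ N * norm (lattice_kernel \<psi> \<delta> s) \<le> C * \<delta> ^ N"
proof -
  obtain B where B: "0 < B" "\<And>t. \<bar>(deriv ^^ N) \<psi> t\<bar> \<le> B"
    using cutoff_deriv_bounded[OF assms] by metis
  show ?thesis
  proof (rule that[of "(4 * real N + 10) * B"])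
    fix \<delta> s :: real assume \<delta>: "0 < \<delta>" "\<delta> \<le> 2"
    \<comment> \<open>The \<open>N\<close> extra cells are those used up by \<open>N\<close>
      summations by parts. With \<delta> <= 2 this gives 2 K \<delta> + \<delta> <= 4 N + 10, the
      source of the constant.\<close>
    define K where "K = \<lceil>2/\<delta>\<rceil> + int N"
    have c: "0 \<le> \<lceil>2/\<delta>\<rceil>" "2 / \<delta> \<le> of_int \<lceil>2/\<delta>\<rceil>" "of_int \<lceil>2/\<delta>\<rceil> \<le> 2 / \<delta> + 1"
      using \<delta> by (auto simp: le_divide_eq intro: less_le_trans[of "-1::real" 0])
    have K0: "0 \<le> K" using c by (simp add: K_def)
    have "2 \<le> of_int \<lceil>2/\<delta>\<rceil> * \<delta>"
      using mult_right_mono[OF c(2), of \<delta>] \<delta>(1) by simp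
    then have K2: "2 \<le> (of_int K - of_nat N) * \<delta>" "2 \<le> of_int K * \<delta>"
      using \<delta>(1) by (simp_all add: K_def distrib_right add_increasing2)
    have Ku: "of_int K * \<delta> \<le> 2 + \<delta> + N * \<delta>"
      using mult_right_mono[OF c(3), of \<delta>] \<delta>(1) by (simp add: K_def distrib_right)
    have supp: "\<psi> w = 0" if "(of_int K - of_nat N) * \<delta> \<le> \<bar>w\<bar>" for w
      using that K2(1) by (intro cutoff_eq_zero[OF assms]) linarith
    have "norm (cis (\<delta> * s) - 1) ^ N *
        norm (\<Sum>k=-K..K. of_real (\<psi> (of_int k * \<delta>)) * cis (of_int k * (\<delta> * s))) \<le> (2 * of_int K + 1) * B * \<delta> ^ N"
      by (rule norm_lattice_sum_by_parts[OF \<delta>(1) K0 cutoff_smooth[OF assms] B(2) supp])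
    then have "\<delta> / (2 * pi) * (norm (cis (\<delta> * s) - 1) ^ N *
        norm (\<Sum>k=-K..K. of_real (\<psi> (of_int k * \<delta>)) * cis (of_int k * (\<delta> * s))))
        \<le> \<delta> / (2 * pi) * ((2 * of_int K + 1) * B * \<delta> ^ N)"
      using \<delta>(1) by (intro mult_left_mono) auto
    then have "norm (cis (\<delta> * s) - 1) ^ N * norm (lattice_kernel \<psi> \<delta> s)
        \<le> (2 * (of_int K * \<delta>) + \<delta>) / (2 * pi) * B * \<delta> ^ N"
      unfolding lattice_kernel_window[OF assms \<delta>(1) K2(2)] norm_mult
      using \<delta>(1) by (simp add: field_simps norm_divide norm_mult)
    also have "\<dots> \<le> (4 * real N + 10) * B * \<delta> ^ N"
    proof (intro mult_right_mono)
      have "real N * \<delta> \<le> real N * 2" using \<delta> by (intro mult_left_mono) auto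
      then have "2 * (of_int K * \<delta>) + \<delta> \<le> 4 * real N + 10"
        using Ku \<delta> by linarith
      also have "\<dots> \<le> (4 * real N + 10) * (2 * pi)"
        using pi_gt3 mult_left_mono[of 1 "2 * pi" "4 * real N + 10"] by simp
      finally show "(2 * (of_int K * \<delta>) + \<delta>) / (2 * pi) \<le> 4 * real N + 10"
        by (simp add: divide_le_eq)
    qed (use B \<delta> in auto)
    finally show "norm (cis (\<delta> * s) - 1) ^ N * norm (lattice_kernel \<psi> \<delta> s) \<le> (4 * real N + 10) * B * \<delta> ^ N" .
  qed (use B in auto)
qed

text \<open>The kernel before \<open>Re\<close> is applied, so that limits and moments can be
  computed with complex exponentials; it is shown to be real in
  \<open>fourier_kernel_real\<close>.\<close>

definition fourier_kernel :: "(real \<Rightarrow> real) \<Rightarrow> real \<Rightarrow> complex" where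
  "fourier_kernel \<psi> x = 1 / (2 * pi) * (\<integral>w. of_real (\<psi> w) * exp (\<i> * of_real (x * w)) \<partial>lborel)"

lemma kernel1_eq: "kernel1 \<psi> x = Re (fourier_kernel \<psi> x)"
  by (simp add: kernel1_def fourier_kernel_def)

text \<open>Rounding the frequency down to the lattice turns the integrand into a step function with
  cells of length \<delta>. In this form the limit of the Riemann sums becomes a case of dominated
  convergence.\<close>

lemma lattice_kernel_eq_integral:
  assumes "cutoff_function \<psi>" "0 < \<delta>"
  shows "lattice_kernel \<psi> \<delta> s = 1 / (2 * pi) *
    (\<integral>w. of_real (\<psi> (of_int \<lfloor>w / \<delta>\<rfloor> * \<delta>)) * cis (of_int \<lfloor>w / \<delta>\<rfloor> * (\<delta> * s)) \<partial>lborel)"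
proof -
  define K where "K = \<lceil>2/\<delta>\<rceil>"
  define G where "G k = complex_of_real (\<psi> (of_int k * \<delta>)) * cis (of_int k * (\<delta> * s))" for k :: int
  have G0: "G k = 0" if "k \<notin> {-K..K}" for k
  proof -
    have "2 / \<delta> \<le> of_int \<bar>k\<bar>"
      using that unfolding K_def by (auto simp: not_le) linarith+
    then have "2 \<le> \<bar>of_int k * \<delta>\<bar>"
      using assms(2) by (simp add: divide_le_eq abs_mult)
    then show ?thesis by (simp add: G_def cutoff_eq_zero[OF assms(1)])
  qed
  have ind: "w \<in> {of_int k * \<delta>..<(of_int k + 1) * \<delta>} \<longleftrightarrow> k = \<lfloor>w / \<delta>\<rfloor>" for w k
    using assms(2) by (auto simp: pos_le_divide_eq pos_divide_less_eq eq_commute[of _ "\<lfloor>_\<rfloor>"] floor_eq_iff)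
  have eq: "G \<lfloor>w / \<delta>\<rfloor> = (\<Sum>k=-K..K. indicator {of_int k * \<delta>..<(of_int k + 1) * \<delta>} w *\<^sub>R G k)" for w
  proof -
    have "(\<Sum>k=-K..K. indicator {of_int k * \<delta>..<(of_int k + 1) * \<delta>} w *\<^sub>R G k)
        = (\<Sum>k=-K..K. if k = \<lfloor>w / \<delta>\<rfloor> then G k else 0)"
      by (intro sum.cong refl) (simp only: indicator_def ind, simp)
    then show ?thesis using G0[of "\<lfloor>w / \<delta>\<rfloor>"] by (simp add: sum.delta)
  qed
  have int: "integrable lborel (\<lambda>w. indicator {of_int k * \<delta>..<(of_int k + 1) * \<delta>} w *\<^sub>R G k)" for k
    by (intro integrable_scaleR_left integrable_real_indicator) (use assms(2) in \<open>auto simp: distrib_right\<close>)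
  have m: "measure lborel {of_int k * \<delta>..<(of_int k + 1) * \<delta>} = \<delta>" for k :: int
    using assms(2) by (simp add: distrib_right)
  have "(\<integral>w. G \<lfloor>w / \<delta>\<rfloor> \<partial>lborel) = (\<Sum>k=-K..K. \<delta> *\<^sub>R G k)"
    unfolding eq by (subst Bochner_Integration.integral_sum[OF int], intro sum.cong refl,
        subst integral_scaleR_left) (use m assms(2) in \<open>auto simp: distrib_right\<close>)
  then show ?thesis
    by (simp add: lattice_kernel_def G_def K_def[symmetric] scaleR_conv_of_real sum_distrib_left sum_divide_distrib)
qed

lemma lattice_kernel_tendsto:
  assumes "cutoff_function \<psi>" "\<And>n. 0 < \<delta> n" "\<And>n. \<delta> n \<le> 1" "\<delta> \<longlonglongrightarrow> 0"
  shows "(\<lambda>n. lattice_kernel \<psi> (\<delta> n) s) \<longlonglongrightarrow> fourier_kernel \<psi> s"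
proof -
  define r where "r n w = of_int \<lfloor>w / \<delta> n\<rfloor> * \<delta> n" for n and w :: real
  have rw: "\<bar>r n w - w\<bar> \<le> \<delta> n" for n w
  proof -
    have "of_int \<lfloor>w / \<delta> n\<rfloor> \<le> w / \<delta> n" "w / \<delta> n \<le> of_int \<lfloor>w / \<delta> n\<rfloor> + 1"
      by linarith+
    then have "r n w \<le> w" "w \<le> r n w + \<delta> n"
      using assms(2)[of n] mult_right_mono[of "of_int \<lfloor>w / \<delta> n\<rfloor>" "w / \<delta> n" "\<delta> n"]
        mult_right_mono[of "w / \<delta> n" "of_int \<lfloor>w / \<delta> n\<rfloor> + 1" "\<delta> n"]
      by (auto simp: r_def distrib_right)
    then show ?thesis using assms(2)[of n] by auto
  qed
  have lim: "(\<lambda>n. r n w) \<longlonglongrightarrow> w" for w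
  proof (rule LIM_zero_cancel, rule tendsto_rabs_zero_cancel, rule tendsto_sandwich[OF _ _ tendsto_const assms(4)])
    show "\<forall>\<^sub>F n in sequentially. 0 \<le> \<bar>r n w - w\<bar>" "\<forall>\<^sub>F n in sequentially. \<bar>r n w - w\<bar> \<le> \<delta> n"
      using rw by auto
  qed
  have c: "isCont \<psi> w" for w
    using cutoff_continuous[OF assms(1)] by (simp add: continuous_on_eq_continuous_at)
  have meas: "\<psi> \<in> borel_measurable borel"
    using cutoff_continuous[OF assms(1)] by (rule borel_measurable_continuous_onI)
  have ccis: "continuous_on UNIV (\<lambda>w. cis (w * s))"
    by (intro continuous_intros)
  then have mcis: "(\<lambda>w. cis (w * s)) \<in> borel_measurable borel"
    by (rule borel_measurable_continuous_onI)
  have mr [measurable]: "r n \<in> borel_measurable borel" for n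
    unfolding r_def by measurable
  have "(\<lambda>n. \<integral>w. of_real (\<psi> (r n w)) * cis (r n w * s) \<partial>lborel)
      \<longlonglongrightarrow> (\<integral>w. of_real (\<psi> w) * cis (w * s) \<partial>lborel)"
  \<comment> \<open>Rounding moves a frequency by at most \<delta> <= 1, so the rounded integrand
    vanishes outside [-3,3].\<close>
  proof (rule integral_dominated_convergence[where w = "indicator {-3..3}"])
    show "(\<lambda>w. of_real (\<psi> w) * cis (w * s)) \<in> borel_measurable lborel"
      using meas mcis by simp
    show "(\<lambda>w. of_real (\<psi> (r n w)) * cis (r n w * s)) \<in> borel_measurable lborel" for n
      using measurable_compose[OF mr meas, of n] measurable_compose[OF mr mcis, of n] by simp
    show "integrable lborel (indicator {-3..3::real} :: real \<Rightarrow> real)"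
      by (rule integrable_real_indicator) auto
    show "AE w in lborel. (\<lambda>n. of_real (\<psi> (r n w)) * cis (r n w * s)) \<longlonglongrightarrow> of_real (\<psi> w) * cis (w * s)"
      using isCont_tendsto_compose[OF c lim] isCont_tendsto_compose[OF _ lim, of _ "\<lambda>w. cis (w * s)"] ccis
      by (intro AE_I2 tendsto_mult tendsto_of_real) (auto simp: continuous_on_eq_continuous_at)
    show "AE w in lborel. norm (of_real (\<psi> (r n w)) * cis (r n w * s)) \<le> indicator {-3..3} w" for n
    proof (rule AE_I2)
      fix w
      show "norm (of_real (\<psi> (r n w)) * cis (r n w * s)) \<le> indicator {-3..3} w"
      proof (cases "\<bar>w\<bar> \<le> 3")
        case True
        then show ?thesis
          using cutoff_nonneg[OF assms(1)] cutoff_le_one[OF assms(1)] by (simp add: norm_mult abs_le_iff)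
      next
        case False
        then have "\<bar>r n w\<bar> \<ge> 2"
          using rw[of n w] assms(3)[of n] by linarith
        then show ?thesis by (simp add: cutoff_eq_zero[OF assms(1)])
      qed
    qed
  qed
  then have "(\<lambda>n. 1 / (2 * pi) * (\<integral>w. of_real (\<psi> (r n w)) * cis (r n w * s) \<partial>lborel))
      \<longlonglongrightarrow> 1 / (2 * pi) * (\<integral>w. of_real (\<psi> w) * cis (w * s) \<partial>lborel)"
    by (rule tendsto_mult_left)
  then show ?thesis
    by (simp add: lattice_kernel_eq_integral[OF assms(1,2)] fourier_kernel_def r_def cis_conv_exp mult_ac)
qed

section \<open>Halving the step and the approximation error\<close>

lemma sum_int_even:
  fixes f :: "int \<Rightarrow> 'a::comm_monoid_add"
  shows "(\<Sum>k=-2*K..2*K. if even k then f (k div 2) else 0) = (\<Sum>k=-K..K. f k)"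
proof -
  have "(\<Sum>k=-2*K..2*K. if even k then f (k div 2) else 0) = (\<Sum>k\<in>{k\<in>{-2*K..2*K}. even k}. f (k div 2))"
    by (rule sum.inter_filter[symmetric]) auto
  also have "\<dots> = (\<Sum>k=-K..K. f k)"
    by (rule sum.reindex_bij_witness[of _ "\<lambda>k. 2 * k" "\<lambda>k. k div 2"]) auto
  finally show ?thesis .
qed

text \<open>For step \<delta>/2 the shift by 2 pi/\<delta> multiplies the k-th term by (-1)^k. Odd
  terms cancel, even terms double, and the doubling makes up for the halved prefactor.\<close>

lemma lattice_kernel_halve:
  assumes "cutoff_function \<psi>" "0 < \<delta>"
  shows "lattice_kernel \<psi> \<delta> s = lattice_kernel \<psi> (\<delta> / 2) s + lattice_kernel \<psi> (\<delta> / 2) (s + 2 * pi / \<delta>)"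
proof -
  define K where "K = \<lceil>2/\<delta>\<rceil>"
  have K: "2 \<le> of_int K * \<delta>" "2 \<le> of_int (2 * K) * (\<delta> / 2)"
    using mult_right_mono[OF le_of_int_ceiling[of "2/\<delta>"], of \<delta>] assms(2) by (simp_all add: K_def)
  define f where "f k = complex_of_real (\<psi> (of_int k * \<delta>)) * cis (of_int k * (\<delta> * s))" for k :: int
  have cis1: "cis (of_int k * pi) = (if even k then 1 else -1)" for k :: int
  proof -
    have even: "cis (2 * (pi * of_int b)) = 1" for b :: int
      using cos_int_2pin[of b] sin_int_2pin[of b] by (simp add: complex_eq_iff mult.assoc)
    show ?thesis
    proof (cases "even k")
      case True
      then show ?thesis using even by (auto elim!: evenE simp: mult.commute mult.left_commute)
    next
      case False
      then obtain b where "k = 2 * b + 1" by (elim oddE)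
      then have "of_int k * pi = 2 * (pi * of_int b) + pi"
        by (simp add: algebra_simps)
      then show ?thesis
        using False by (simp only: cis_mult[symmetric] even) (simp add: complex_eq_iff)
    qed
  qed
  have term_eq: "of_real (\<psi> (of_int k * (\<delta> / 2))) * cis (of_int k * (\<delta> / 2 * s))
        + of_real (\<psi> (of_int k * (\<delta> / 2))) * cis (of_int k * (\<delta> / 2 * (s + 2 * pi / \<delta>)))
      = 2 * (if even k then f (k div 2) else 0)" for k :: int
  proof -
    have "of_int k * (\<delta> / 2 * (s + 2 * pi / \<delta>)) = of_int k * (\<delta> / 2 * s) + of_int k * pi"
      using assms(2) by (simp add: field_simps)
    then have "cis (of_int k * (\<delta> / 2 * (s + 2 * pi / \<delta>))) = cis (of_int k * (\<delta> / 2 * s)) * (if even k then 1 else -1)"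
      by (simp only: cis_mult[symmetric] cis1)
    then show ?thesis
      by (auto simp: f_def elim!: evenE)
  qed
  have "lattice_kernel \<psi> (\<delta> / 2) s + lattice_kernel \<psi> (\<delta> / 2) (s + 2 * pi / \<delta>)
      = of_real (\<delta> / 2 / (2 * pi)) * (\<Sum>k=-(2*K)..2*K. 2 * (if even k then f (k div 2) else 0))"
    unfolding lattice_kernel_window[OF assms(1) half_gt_zero[OF assms(2)] K(2)]
    by (simp only: term_eq[symmetric] sum.distrib distrib_left)
  also have "\<dots> = of_real (\<delta> / 2 / (2 * pi)) * (2 * (\<Sum>k=-K..K. f k))"
    by (simp only: sum_distrib_left[symmetric] sum_int_even minus_mult_left)
  also have "\<dots> = lattice_kernel \<psi> \<delta> s"
    unfolding lattice_kernel_window[OF assms(1,2) K(1)] f_def by simp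
  finally show ?thesis by simp
qed

text \<open>One halving changes the value by a lattice kernel at the shifted point, which decay
  makes of order (\<delta>/2)^N. The admissible range pi/\<delta> grows when \<delta> is halved, so
  the step can be iterated, and the lattice kernels converge to the Fourier integral.\<close>

lemma lattice_kernel_approx:
  assumes "cutoff_function \<psi>" "0 < N"
  obtains C where "0 < C"
    "\<And>\<delta> s. 0 < \<delta> \<Longrightarrow> \<delta> \<le> 2 \<Longrightarrow> \<bar>s\<bar> \<le> pi / \<delta> \<Longrightarrow> norm (lattice_kernel \<psi> \<delta> s - fourier_kernel \<psi> s) \<le> C * \<delta> ^ N"
proof -
  obtain C where C: "0 < C" "\<And>\<delta> s. 0 < \<delta> \<Longrightarrow> \<delta> \<le> 2 \<Longrightarrow>
      norm (cis (\<delta> * s) - 1) ^ N * norm (lattice_kernel \<psi> \<delta> s) \<le> C * \<delta> ^ N"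
    using lattice_kernel_decay[OF assms(1)] by metis
  have step: "norm (lattice_kernel \<psi> \<delta> s - lattice_kernel \<psi> (\<delta> / 2) s) \<le> C * (\<delta> / 2) ^ N"
    if "0 < \<delta>" "\<delta> \<le> 2" "\<bar>s\<bar> \<le> pi / \<delta>" for \<delta> s
  proof -
    let ?L = "lattice_kernel \<psi> (\<delta> / 2) (s + 2 * pi / \<delta>)"
    have e: "\<delta> / 2 * (s + 2 * pi / \<delta>) = \<delta> * s / 2 + pi"
      using that by (simp add: field_simps)
    \<comment> \<open>The angle at the shifted point is \<delta> s/2 + pi. For |\<delta> s| <= pi
      its cosine is nonpositive, so the factor \<open>cis - 1\<close> in the decay bound has norm at
      least 1.\<close>
    have "\<bar>\<delta> * s\<bar> \<le> pi"
      using that by (simp add: abs_mult pos_le_divide_eq mult.commute)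
    then have "0 \<le> cos (\<delta> * s / 2)"
      by (intro cos_ge_zero) (auto simp: abs_le_iff)
    then have "1 \<le> \<bar>Re (cis (\<delta> / 2 * (s + 2 * pi / \<delta>)) - 1)\<bar>"
      unfolding e by simp
    then have "1 \<le> norm (cis (\<delta> / 2 * (s + 2 * pi / \<delta>)) - 1)"
      using abs_Re_le_cmod order_trans by blast
    then have "1 * norm ?L \<le> norm (cis (\<delta> / 2 * (s + 2 * pi / \<delta>)) - 1) ^ N * norm ?L"
      by (intro mult_right_mono one_le_power) auto
    also have "\<dots> \<le> C * (\<delta> / 2) ^ N"
      using that by (intro C(2)) auto
    finally show ?thesis
      using lattice_kernel_halve[OF assms(1) that(1), of s] by simp
  qed
  show ?thesis
  proof (rule that[OF C(1)])
    fix \<delta> s :: real assume \<delta>: "0 < \<delta>" "\<delta> \<le> 2" "\<bar>s\<bar> \<le> pi / \<delta>"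
    \<comment> \<open>Step n costs at most C \<delta>^N 2^(-n-1), where N >= 1 is used; 1 - 2^(-n)
      is the partial sum of these costs.\<close>
    have tele: "norm (lattice_kernel \<psi> \<delta> s - lattice_kernel \<psi> (\<delta> / 2 ^ n) s) \<le> C * \<delta> ^ N * (1 - 1 / 2 ^ n)" for n
    proof (induction n)
      case (Suc n)
      have p: "0 < \<delta> / 2 ^ n" "\<delta> / 2 ^ n \<le> \<delta>"
        using \<delta> by (auto simp: divide_le_eq mult_le_cancel_left1)
      have "norm (lattice_kernel \<psi> (\<delta> / 2 ^ n) s - lattice_kernel \<psi> (\<delta> / 2 ^ n / 2) s) \<le> C * (\<delta> / 2 ^ n / 2) ^ N"
      proof (rule step)
        have "pi / \<delta> \<le> pi / (\<delta> / 2 ^ n)"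
          by (intro divide_left_mono) (use p \<delta> in auto)
        then show "\<bar>s\<bar> \<le> pi / (\<delta> / 2 ^ n)"
          using \<delta>(3) by linarith
      qed (use p \<delta> in auto)
      also have "\<dots> = C * \<delta> ^ N * (1 / 2 ^ Suc n) ^ N"
        by (simp add: power_divide power_mult_distrib)
      also have "\<dots> \<le> C * \<delta> ^ N * (1 / 2 ^ Suc n) ^ 1"
        using C(1) \<delta>(1) assms(2) one_le_power[of "2::real" "Suc n"]
        by (intro mult_left_mono power_decreasing) (auto simp: divide_le_eq)
      finally have "norm (lattice_kernel \<psi> (\<delta> / 2 ^ n) s - lattice_kernel \<psi> (\<delta> / 2 ^ Suc n) s) \<le> C * \<delta> ^ N * (1 / 2 ^ Suc n)"
        by (simp add: mult.commute)
      then have "norm (lattice_kernel \<psi> \<delta> s - lattice_kernel \<psi> (\<delta> / 2 ^ Suc n) s)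
          \<le> C * \<delta> ^ N * (1 - 1 / 2 ^ n) + C * \<delta> ^ N * (1 / 2 ^ Suc n)"
        using Suc.IH norm_diff_triangle_le by blast
      then show ?case by (simp add: algebra_simps)
    qed simp
    \<comment> \<open>Starting one halving later makes every step at most 1, as the convergence
      lemma requires, although \<delta> may be as large as 2.\<close>
    define \<delta>' where "\<delta>' = (\<lambda>n. \<delta> / 2 ^ Suc n)"
    have "\<delta>' \<longlonglongrightarrow> 0"
      unfolding \<delta>'_def using LIMSEQ_divide_realpow_zero[of 2 \<delta>] LIMSEQ_Suc by fastforce
    moreover have "\<delta>' n \<le> 1" for n
    proof -
      have "(2::real) \<le> 2 ^ Suc n" by simp
      then show ?thesis unfolding \<delta>'_def using \<delta>(2) by (simp only: divide_le_eq_1) linarith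
    qed
    ultimately have "(\<lambda>n. lattice_kernel \<psi> (\<delta>' n) s) \<longlonglongrightarrow> fourier_kernel \<psi> s"
      using \<delta> by (intro lattice_kernel_tendsto[OF assms(1)]) (auto simp: \<delta>'_def)
    then have "(\<lambda>n. norm (lattice_kernel \<psi> \<delta> s - lattice_kernel \<psi> (\<delta>' n) s))
        \<longlonglongrightarrow> norm (lattice_kernel \<psi> \<delta> s - fourier_kernel \<psi> s)"
      by (intro tendsto_intros)
    moreover have "norm (lattice_kernel \<psi> \<delta> s - lattice_kernel \<psi> (\<delta>' n) s) \<le> C * \<delta> ^ N" for n
    proof -
      have "C * \<delta> ^ N * (1 - 1 / 2 ^ Suc n) \<le> C * \<delta> ^ N * 1"
        using C(1) \<delta>(1) by (intro mult_left_mono) auto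
      then show ?thesis
        using tele[of "Suc n"] unfolding \<delta>'_def by linarith
    qed
    ultimately show "norm (lattice_kernel \<psi> \<delta> s - fourier_kernel \<psi> s) \<le> C * \<delta> ^ N"
      by (intro LIMSEQ_le_const2) auto
  qed
qed

section \<open>Rapid decay of the kernel\<close>

lemma cis_difference_quotient_tendsto:
  assumes "\<And>n. 0 < \<delta> n" "\<delta> \<longlonglongrightarrow> 0"
  shows "(\<lambda>n. (cis (\<delta> n * s) - 1) / of_real (\<delta> n)) \<longlonglongrightarrow> \<i> * of_real s"
proof -
  have "((\<lambda>z. exp (z * (\<i> * of_real s))) has_field_derivative \<i> * of_real s) (at 0)"
    by (auto intro!: derivative_eq_intros)
  then have "(\<lambda>h. (exp (h * (\<i> * of_real s)) - 1) / h) \<midarrow>0\<rightarrow> \<i> * of_real s"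
    by (simp add: DERIV_def)
  moreover have "filterlim (\<lambda>n. complex_of_real (\<delta> n)) (at 0) sequentially"
    using assms(1) tendsto_of_real[OF assms(2), where 'a = complex]
    by (auto simp: filterlim_at less_imp_neq[THEN not_sym])
  ultimately have "(\<lambda>n. (exp (of_real (\<delta> n) * (\<i> * of_real s)) - 1) / of_real (\<delta> n)) \<longlonglongrightarrow> \<i> * of_real s"
    by (rule filterlim_compose)
  then show ?thesis
    by (simp add: cis_conv_exp mult_ac)
qed

lemma half_power_seq: "(\<lambda>n. (1/2::real) ^ n) \<longlonglongrightarrow> 0"
  by (rule LIMSEQ_power_zero) simp

text \<open>Divide the lattice decay bound by \<delta>^N and let \<delta> tend to 0: the quotient
  (\<open>cis (\<delta> * s)\<close> - 1)/\<delta> tends to i s. This takes the place of integrating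
  by parts in the Fourier integral.\<close>

lemma fourier_kernel_times_power_bounded:
  assumes "cutoff_function \<psi>"
  obtains C where "0 < C" "\<And>s. \<bar>s\<bar> ^ N * norm (fourier_kernel \<psi> s) \<le> C"
proof -
  obtain C where C: "0 < C" "\<And>\<delta> s. 0 < \<delta> \<Longrightarrow> \<delta> \<le> 2 \<Longrightarrow>
      norm (cis (\<delta> * s) - 1) ^ N * norm (lattice_kernel \<psi> \<delta> s) \<le> C * \<delta> ^ N"
    using lattice_kernel_decay[OF assms] by metis
  define \<delta> where "\<delta> = (\<lambda>n. (1/2::real) ^ n)"
  have \<delta>: "0 < \<delta> n" "\<delta> n \<le> 1" "\<delta> \<longlonglongrightarrow> 0" for n
    using half_power_seq by (auto simp: \<delta>_def power_le_one)
  have "\<bar>s\<bar> ^ N * norm (fourier_kernel \<psi> s) \<le> C" for s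
  proof (rule LIMSEQ_le_const2)
    show "(\<lambda>n. norm ((cis (\<delta> n * s) - 1) / of_real (\<delta> n)) ^ N * norm (lattice_kernel \<psi> (\<delta> n) s))
        \<longlonglongrightarrow> \<bar>s\<bar> ^ N * norm (fourier_kernel \<psi> s)"
      using tendsto_norm[OF cis_difference_quotient_tendsto[OF \<delta>(1,3)]] lattice_kernel_tendsto[OF assms \<delta>]
      by (auto intro!: tendsto_intros simp: norm_mult)
    have "norm ((cis (\<delta> n * s) - 1) / of_real (\<delta> n)) ^ N * norm (lattice_kernel \<psi> (\<delta> n) s) \<le> C" for n
      using C(2)[of "\<delta> n" s] \<delta>(1,2)[of n]
      by (simp add: norm_divide power_divide divide_le_eq)
    then show "\<exists>k. \<forall>n\<ge>k. norm ((cis (\<delta> n * s) - 1) / of_real (\<delta> n)) ^ N * norm (lattice_kernel \<psi> (\<delta> n) s) \<le> C"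
      by blast
  qed
  then show ?thesis using that C(1) by blast
qed

text \<open>Combines the power bounds of orders 0 and 2M through (1 + s^2)^M <= 2^M (1 + |s|^(2M)).
  The form without singularity at 0 allows products over coordinates.\<close>

lemma fourier_kernel_rapid_decay:
  assumes "cutoff_function \<psi>"
  obtains C where "0 < C" "\<And>s. norm (fourier_kernel \<psi> s) \<le> C / (1 + s\<^sup>2) ^ M"
proof -
  obtain A where A: "0 < A" "\<And>s. \<bar>s\<bar> ^ 0 * norm (fourier_kernel \<psi> s) \<le> A"
    using fourier_kernel_times_power_bounded[OF assms] by metis
  obtain B where B: "0 < B" "\<And>s. \<bar>s\<bar> ^ (2 * M) * norm (fourier_kernel \<psi> s) \<le> B"
    using fourier_kernel_times_power_bounded[OF assms] by metis
  have "norm (fourier_kernel \<psi> s) \<le> 2 ^ M * (A + B) / (1 + s\<^sup>2) ^ M" for s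
  proof -
    have "(1 + s\<^sup>2) ^ M \<le> (2 * max 1 (s\<^sup>2)) ^ M"
      by (intro power_mono) (auto simp: max_def)
    also have "\<dots> = 2 ^ M * max 1 (s\<^sup>2) ^ M"
      by (simp add: power_mult_distrib)
    also have "max 1 (s\<^sup>2) ^ M \<le> 1 + \<bar>s\<bar> ^ (2 * M)"
      by (cases "s\<^sup>2 \<le> 1") (auto simp: max_def power_mult)
    finally have "(1 + s\<^sup>2) ^ M * norm (fourier_kernel \<psi> s) \<le> 2 ^ M * (1 + \<bar>s\<bar> ^ (2 * M)) * norm (fourier_kernel \<psi> s)"
      by (intro mult_right_mono) auto
    also have "\<dots> = 2 ^ M * (norm (fourier_kernel \<psi> s) + \<bar>s\<bar> ^ (2 * M) * norm (fourier_kernel \<psi> s))"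
      by (simp add: algebra_simps)
    also have "\<dots> \<le> 2 ^ M * (A + B)"
      using A(2)[of s] B(2)[of s] by (intro mult_left_mono add_mono) auto
    finally show ?thesis
      by (simp add: pos_le_divide_eq add_pos_nonneg mult.commute)
  qed
  then show ?thesis using that[of "2 ^ M * (A + B)"] A(1) B(1) by simp
qed

section \<open>Moments of the kernel\<close>

lemma integrable_inverse_1_plus_square:
  "integrable lborel (\<lambda>x::real. 1 / (1 + x\<^sup>2))"
proof -
  have "set_integrable lborel {0<..} (\<lambda>x::real. inverse (1 + x\<^sup>2))"
    using integrable_I0i_1_div_plus_square by (simp add: zero_ereal_def interval_integrable_to_infinity_eq inverse_eq_divide)
  then have A: "integrable lborel (\<lambda>x::real. indicator {0<..} x *\<^sub>R inverse (1 + x\<^sup>2))"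
    by (simp add: set_integrable_def)
  have B: "integrable lborel (\<lambda>x::real. indicator {0<..} (- x) *\<^sub>R inverse (1 + (- x)\<^sup>2))"
    using A lborel_integrable_real_affine[of "\<lambda>x. indicator {0<..} x *\<^sub>R inverse (1 + x\<^sup>2)" "-1" 0] by simp
  have "integrable lborel (\<lambda>x::real. indicator {0<..} x *\<^sub>R inverse (1 + x\<^sup>2)
      + indicator {0<..} (- x) *\<^sub>R inverse (1 + (- x)\<^sup>2))"
    using A B by (rule Bochner_Integration.integrable_add)
  then show ?thesis
  proof (rule integrable_cong_AE_imp)
    show "AE x in lborel. indicator {0<..} x *\<^sub>R inverse (1 + x\<^sup>2)
      + indicator {0<..} (- x) *\<^sub>R inverse (1 + (- x)\<^sup>2) = 1 / (1 + (x::real)\<^sup>2)"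
      \<comment> \<open>The two open half-lines miss only the origin.\<close>
      using AE_lborel_singleton[of "0::real"]
      by eventually_elim (auto simp: indicator_def divide_inverse)
  qed measurable
qed

section \<open>Fourier coefficients and the passage to moments\<close>

lemma lattice_kernel_continuous: "continuous_on UNIV (lattice_kernel \<psi> \<delta>)"
  unfolding lattice_kernel_def[abs_def] by (intro continuous_intros)

lemma fourier_kernel_measurable [measurable]:
  assumes "cutoff_function \<psi>"
  shows "fourier_kernel \<psi> \<in> borel_measurable borel"
proof (rule borel_measurable_LIMSEQ_metric)
  show "(\<lambda>n. lattice_kernel \<psi> ((1/2) ^ n) s) \<longlonglongrightarrow> fourier_kernel \<psi> s" for s
    by (rule lattice_kernel_tendsto[OF assms _ _ half_power_seq]) (auto simp: power_le_one)
qed (rule borel_measurable_continuous_onI[OF lattice_kernel_continuous])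

lemma norm_cis_minus_one_le: "norm (cis x - 1) \<le> \<bar>x\<bar>"
  using iexp_approx1[of x 0] by (simp add: cis_conv_exp)

lemma integral_cis_period:
  assumes "0 < \<delta>"
  shows "(\<integral>s. indicator {-pi/\<delta>..pi/\<delta>} s *\<^sub>R cis (of_int k * (\<delta> * s)) \<partial>lborel)
    = (if k = 0 then of_real (2 * pi / \<delta>) else 0)"
proof (cases "k = 0")
  case True
  have "(\<integral>s. indicator {-pi/\<delta>..pi/\<delta>} s *\<^sub>R (1::complex) \<partial>lborel) = of_real (2 * pi / \<delta>)"
    using assms by (subst integral_scaleR_left) (auto simp: scaleR_conv_of_real)
  then show ?thesis using True by simp
next
  case False
  define c where "c = of_int k * \<delta>"
  have c: "c \<noteq> 0" using False assms by (simp add: c_def)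
  have "((\<lambda>x. cis (c * x) / (\<i> * of_real c)) has_vector_derivative cis (c * x)) (at x within {-pi/\<delta>..pi/\<delta>})" for x
  proof -
    have "((\<lambda>z. exp (\<i> * of_real c * z) / (\<i> * of_real c)) has_field_derivative exp (\<i> * of_real c * of_real x)) (at (of_real x))"
      using c by (auto intro!: derivative_eq_intros)
    from has_vector_derivative_real_field[OF this] show ?thesis
      by (auto simp: cis_conv_exp mult_ac intro: has_vector_derivative_at_within)
  qed
  then have "(\<integral>s. indicator {-pi/\<delta>..pi/\<delta>} s *\<^sub>R cis (c * s) \<partial>lborel)
      = cis (c * (pi/\<delta>)) / (\<i> * of_real c) - cis (c * (-pi/\<delta>)) / (\<i> * of_real c)"
    using assms by (intro integral_FTC_Icc) (auto intro!: continuous_intros)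
  also have "\<dots> = cis (of_int k * pi) / (\<i> * of_real c) - cis (- (of_int k * pi)) / (\<i> * of_real c)"
    using assms by (simp add: c_def)
  also have "cis (of_int k * pi) - cis (- (of_int k * pi)) = 0"
    by (auto simp: complex_eq_iff sin_zero_iff_int2)
  then have "cis (of_int k * pi) / (\<i> * of_real c) - cis (- (of_int k * pi)) / (\<i> * of_real c) = 0"
    by (simp add: diff_divide_distrib[symmetric])
  finally show ?thesis using False by (simp add: c_def mult_ac)
qed

text \<open>Orthogonality of the characters over one period recovers the coefficients of the
  trigonometric polynomial. This is the exact discrete substitute for Fourier inversion.\<close>

lemma lattice_kernel_coefficient:
  assumes "cutoff_function \<psi>" "0 < \<delta>"
  shows "integrable lborel (\<lambda>s. indicator {-pi/\<delta>..pi/\<delta>} s *\<^sub>R (lattice_kernel \<psi> \<delta> s * cis (- (of_int l * (\<delta> * s)))))"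
    and "(\<integral>s. indicator {-pi/\<delta>..pi/\<delta>} s *\<^sub>R (lattice_kernel \<psi> \<delta> s * cis (- (of_int l * (\<delta> * s)))) \<partial>lborel)
       = of_real (\<psi> (of_int l * \<delta>))"
proof -
  define K where "K = max \<lceil>2/\<delta>\<rceil> \<bar>l\<bar>"
  have "of_int \<lceil>2/\<delta>\<rceil> \<le> (of_int K :: real)"
    by (simp add: K_def)
  then have "2 / \<delta> \<le> of_int K" by linarith
  then have K: "2 \<le> of_int K * \<delta>"
    using assms(2) mult_right_mono[of "2/\<delta>" "of_int K" \<delta>] by simp
  have lK: "l \<in> {-K..K}" by (auto simp: K_def)
  show "integrable lborel (\<lambda>s. indicator {-pi/\<delta>..pi/\<delta>} s *\<^sub>R (lattice_kernel \<psi> \<delta> s * cis (- (of_int l * (\<delta> * s)))))"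
    by (intro borel_integrable_compact compact_Icc continuous_intros
        continuous_on_subset[OF lattice_kernel_continuous]) auto
  have eq: "indicator {-pi/\<delta>..pi/\<delta>} s *\<^sub>R (lattice_kernel \<psi> \<delta> s * cis (- (of_int l * (\<delta> * s))))
      = (\<Sum>k=-K..K. of_real (\<delta> / (2 * pi) * \<psi> (of_int k * \<delta>)) *
          (indicator {-pi/\<delta>..pi/\<delta>} s *\<^sub>R cis (of_int (k - l) * (\<delta> * s))))" for s
  proof -
    have "cis (of_int k * (\<delta> * s)) * cis (- (of_int l * (\<delta> * s))) = cis (of_int (k - l) * (\<delta> * s))" for k
      by (simp add: cis_mult left_diff_distrib)
    then show ?thesis
      unfolding lattice_kernel_window[OF assms K]
      by (simp add: sum_distrib_left sum_distrib_right scaleR_conv_of_real mult_ac sum_divide_distrib)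
  qed
  have int: "integrable lborel (\<lambda>s. of_real (\<delta> / (2 * pi) * \<psi> (of_int k * \<delta>)) *
          (indicator {-pi/\<delta>..pi/\<delta>} s *\<^sub>R cis (of_int (k - l) * (\<delta> * s))))" for k
    by (intro integrable_mult_right borel_integrable_compact compact_Icc continuous_intros)
  have "(\<integral>s. indicator {-pi/\<delta>..pi/\<delta>} s *\<^sub>R (lattice_kernel \<psi> \<delta> s * cis (- (of_int l * (\<delta> * s)))) \<partial>lborel)
      = (\<Sum>k=-K..K. of_real (\<delta> / (2 * pi) * \<psi> (of_int k * \<delta>)) * (if k - l = 0 then of_real (2 * pi / \<delta>) else 0))"
    unfolding eq by (subst Bochner_Integration.integral_sum[OF int])
      (simp only: integral_mult_right_zero integral_cis_period[OF assms(2)])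
  also have "\<dots> = (\<Sum>k=-K..K. if k = l then of_real (\<psi> (of_int k * \<delta>)) else 0)"
    using assms(2) by (intro sum.cong refl) (auto simp: field_simps)
  also have "\<dots> = of_real (\<psi> (of_int l * \<delta>))"
    using lK by (simp add: sum.delta)
  finally show "(\<integral>s. indicator {-pi/\<delta>..pi/\<delta>} s *\<^sub>R (lattice_kernel \<psi> \<delta> s * cis (- (of_int l * (\<delta> * s)))) \<partial>lborel)
       = of_real (\<psi> (of_int l * \<delta>))" .
qed

text \<open>Supplies a dominating function independent of \<delta>. On |s| <= pi/\<delta> the
  product \<delta>^2 (1 + s^2) is at most 4 + pi^2, so an approximation error of order
  \<delta>^(2M+2) is itself of order (1 + s^2)^(-M).\<close>

lemma lattice_kernel_rapid_decay:
  assumes "cutoff_function \<psi>"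
  obtains C where "0 < C" "\<And>\<delta> s. 0 < \<delta> \<Longrightarrow> \<delta> \<le> 2 \<Longrightarrow> \<bar>s\<bar> \<le> pi / \<delta> \<Longrightarrow> norm (lattice_kernel \<psi> \<delta> s) \<le> C / (1 + s\<^sup>2) ^ M"
proof -
  obtain A where A: "0 < A" "\<And>s. norm (fourier_kernel \<psi> s) \<le> A / (1 + s\<^sup>2) ^ M"
    using fourier_kernel_rapid_decay[OF assms] by metis
  obtain B where B: "0 < B" "\<And>\<delta> s. 0 < \<delta> \<Longrightarrow> \<delta> \<le> 2 \<Longrightarrow> \<bar>s\<bar> \<le> pi / \<delta> \<Longrightarrow>
      norm (lattice_kernel \<psi> \<delta> s - fourier_kernel \<psi> s) \<le> B * \<delta> ^ (2 * Suc M)"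
    using lattice_kernel_approx[OF assms, of "2 * Suc M"] by auto
  have "norm (lattice_kernel \<psi> \<delta> s) \<le> (A + B * 4 * (4 + pi\<^sup>2) ^ M) / (1 + s\<^sup>2) ^ M"
    if d: "0 < \<delta>" "\<delta> \<le> 2" "\<bar>s\<bar> \<le> pi / \<delta>" for \<delta> s
  proof -
    have pos: "0 < (1 + s\<^sup>2) ^ M"
      by (intro zero_less_power add_pos_nonneg) auto
    have "\<bar>\<delta> * s\<bar> \<le> pi"
      using d by (simp add: abs_mult pos_le_divide_eq mult.commute)
    then have "(\<delta> * s)\<^sup>2 \<le> pi\<^sup>2"
      using abs_le_square_iff[of "\<delta> * s" pi] by simp
    moreover have d4: "\<delta>\<^sup>2 \<le> 4"
      using power_mono[of \<delta> 2 2] d by simp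
    ultimately have "\<delta>\<^sup>2 * (1 + s\<^sup>2) \<le> 4 + pi\<^sup>2"
      by (simp add: algebra_simps power_mult_distrib)
    then have "(\<delta>\<^sup>2 * (1 + s\<^sup>2)) ^ M \<le> (4 + pi\<^sup>2) ^ M"
      by (intro power_mono) auto
    then have "\<delta> ^ (2 * M) * (1 + s\<^sup>2) ^ M \<le> (4 + pi\<^sup>2) ^ M"
      by (simp add: power_mult_distrib power_mult)
    then have "\<delta>\<^sup>2 * (\<delta> ^ (2 * M) * (1 + s\<^sup>2) ^ M) \<le> 4 * (4 + pi\<^sup>2) ^ M"
      using d4 d(1) by (intro mult_mono) auto
    then have "\<delta> ^ (2 * Suc M) \<le> 4 * (4 + pi\<^sup>2) ^ M / (1 + s\<^sup>2) ^ M"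
      using pos by (simp add: pos_le_divide_eq power_add power2_eq_square mult_ac)
    then have "B * \<delta> ^ (2 * Suc M) \<le> B * (4 * (4 + pi\<^sup>2) ^ M / (1 + s\<^sup>2) ^ M)"
      using B(1) by (intro mult_left_mono) auto
    then have "norm (lattice_kernel \<psi> \<delta> s) \<le> A / (1 + s\<^sup>2) ^ M + B * (4 * (4 + pi\<^sup>2) ^ M / (1 + s\<^sup>2) ^ M)"
      using B(2)[OF d] A(2)[of s] norm_triangle_sub[of "lattice_kernel \<psi> \<delta> s" "fourier_kernel \<psi> s"] by linarith
    then show ?thesis by (simp add: add_divide_distrib mult.assoc)
  qed
  moreover have "0 < A + B * 4 * (4 + pi\<^sup>2) ^ M"
    using A B by (intro add_pos_nonneg) auto
  ultimately show ?thesis using that by blast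
qed

text \<open>Replace s^j by the j-th power of a difference quotient of characters and integrate the
  lattice kernel over one period. The binomial expansion yields a j-th finite difference of \<psi>
  at the nodes l \<delta> with l <= j. Once j \<delta> <= 1 all these values are 1, and the result
  is (1 - 1)^j / \<delta>^j.\<close>

lemma fourier_kernel_moments:
  assumes "cutoff_function \<psi>"
  shows "integrable lborel (\<lambda>s. fourier_kernel \<psi> s * of_real s ^ j)"
    and "(\<integral>s. fourier_kernel \<psi> s * of_real s ^ j \<partial>lborel) = (if j = 0 then 1 else 0)"
proof -
  \<comment> \<open>Of the j + 1 powers, j absorb |s|^j and the last one leaves the integrable 1/(1
    + s^2).\<close>
  obtain A where A: "0 < A" "\<And>s. norm (fourier_kernel \<psi> s) \<le> A / (1 + s\<^sup>2) ^ Suc j"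
    using fourier_kernel_rapid_decay[OF assms] by metis
  obtain B where B: "0 < B" "\<And>\<delta> s. 0 < \<delta> \<Longrightarrow> \<delta> \<le> 2 \<Longrightarrow> \<bar>s\<bar> \<le> pi / \<delta> \<Longrightarrow>
      norm (lattice_kernel \<psi> \<delta> s) \<le> B / (1 + s\<^sup>2) ^ Suc j"
    using lattice_kernel_rapid_decay[OF assms] by metis
  have pow: "C / (1 + s\<^sup>2) ^ Suc j * \<bar>s\<bar> ^ j \<le> C * (1 / (1 + s\<^sup>2))" if "0 < C" for C s :: real
  proof -
    have "\<bar>s\<bar> \<le> 1 + s\<^sup>2"
      using zero_le_power2[of "\<bar>s\<bar> - 1"] by (simp add: power2_eq_square algebra_simps)
    then have "\<bar>s\<bar> ^ j \<le> (1 + s\<^sup>2) ^ j"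
      by (intro power_mono) auto
    moreover have pos: "0 < 1 + s\<^sup>2" by (intro add_pos_nonneg) auto
    ultimately have "\<bar>s\<bar> ^ j / (1 + s\<^sup>2) ^ j \<le> 1"
      by (simp add: divide_le_eq_1)
    then have "C * (1 / (1 + s\<^sup>2)) * (\<bar>s\<bar> ^ j / (1 + s\<^sup>2) ^ j) \<le> C * (1 / (1 + s\<^sup>2)) * 1"
      using that pos by (intro mult_left_mono) auto
    then show ?thesis by simp
  qed
  have dom: "integrable lborel (\<lambda>s::real. C * (1 / (1 + s\<^sup>2)))" for C :: real
    by (intro integrable_mult_right integrable_inverse_1_plus_square)
  show "integrable lborel (\<lambda>s. fourier_kernel \<psi> s * of_real s ^ j)"
  proof (rule Bochner_Integration.integrable_bound[OF dom[of A]])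
    show "AE s in lborel. norm (fourier_kernel \<psi> s * of_real s ^ j) \<le> norm (A * (1 / (1 + s\<^sup>2)))"
    proof (rule AE_I2)
      fix s :: real
      have "norm (fourier_kernel \<psi> s * of_real s ^ j) = norm (fourier_kernel \<psi> s) * \<bar>s\<bar> ^ j"
        by (simp add: norm_mult norm_power)
      also have "\<dots> \<le> A / (1 + s\<^sup>2) ^ Suc j * \<bar>s\<bar> ^ j"
        by (intro mult_right_mono A) auto
      also note pow[OF A(1)]
      finally show "norm (fourier_kernel \<psi> s * of_real s ^ j) \<le> norm (A * (1 / (1 + s\<^sup>2)))"
        by (simp add: abs_of_pos[OF A(1)])
    qed
  qed (use assms in measurable)
  define \<delta> where "\<delta> = (\<lambda>n. (1/2::real) ^ n)"
  have \<delta>: "0 < \<delta> n" "\<delta> n \<le> 1" "\<delta> \<longlonglongrightarrow> 0" for n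
    using half_power_seq by (auto simp: \<delta>_def power_le_one)
  \<comment> \<open>The minus sign makes the powers of \<open>q\<close> combinations of exactly the
    characters that extract Fourier coefficients; the limit is then -i s, and the factor (-i)^j is
    removed at the end.\<close>
  define q where "q n s = (cis (- (\<delta> n * s)) - 1) / of_real (\<delta> n)" for n s
  define F where "F n s = indicator {-pi/\<delta> n..pi/\<delta> n} s *\<^sub>R (lattice_kernel \<psi> (\<delta> n) s * q n s ^ j)" for n s
  have qn: "norm (q n s) \<le> \<bar>s\<bar>" for n s
    using norm_cis_minus_one_le[of "- (\<delta> n * s)"] \<delta>(1)[of n]
    by (simp add: q_def norm_divide abs_mult divide_le_eq mult.commute)
  have lim: "(\<lambda>n. \<integral>s. F n s \<partial>lborel) \<longlonglongrightarrow> (\<integral>s. fourier_kernel \<psi> s * (- \<i> * of_real s) ^ j \<partial>lborel)"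
  proof (rule integral_dominated_convergence[OF _ _ dom[of B]])
    show "(\<lambda>s. fourier_kernel \<psi> s * (- \<i> * of_real s) ^ j) \<in> borel_measurable lborel"
      using assms by measurable
    have [measurable]: "lattice_kernel \<psi> (\<delta> n) \<in> borel_measurable borel" for n
      by (rule borel_measurable_continuous_onI[OF lattice_kernel_continuous])
    have "continuous_on UNIV (q n)" for n
      unfolding q_def[abs_def] using \<delta>(1)[of n] by (intro continuous_intros) auto
    then have [measurable]: "q n \<in> borel_measurable borel" for n
      by (rule borel_measurable_continuous_onI)
    show "F n \<in> borel_measurable lborel" for n
      unfolding F_def[abs_def] by measurable
    show "AE s in lborel. norm (F n s) \<le> B * (1 / (1 + s\<^sup>2))" for n
    proof (rule AE_I2)
      fix s :: real
      show "norm (F n s) \<le> B * (1 / (1 + s\<^sup>2))"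
      proof (cases "\<bar>s\<bar> \<le> pi / \<delta> n")
        case True
        have "norm (F n s) \<le> norm (lattice_kernel \<psi> (\<delta> n) s) * norm (q n s) ^ j"
          by (simp add: F_def norm_mult norm_power mult_left_le_one_le indicator_def)
        also have "\<dots> \<le> B / (1 + s\<^sup>2) ^ Suc j * \<bar>s\<bar> ^ j"
          using \<delta>(1,2)[of n] True B(1) by (intro mult_mono power_mono qn B(2)) auto
        also note pow[OF B(1)]
        finally show ?thesis .
      next
        case False
        then have "s \<notin> {-pi/\<delta> n..pi/\<delta> n}" by auto
        then show ?thesis using B(1) by (simp add: F_def)
      qed
    qed
    show "AE s in lborel. (\<lambda>n. F n s) \<longlonglongrightarrow> fourier_kernel \<psi> s * (- \<i> * of_real s) ^ j"
    proof (rule AE_I2)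
      fix s :: real
      have "(\<lambda>n. q n s) \<longlonglongrightarrow> - \<i> * of_real s"
        using cis_difference_quotient_tendsto[OF \<delta>(1,3), of "- s"] by (simp add: q_def)
      then have "(\<lambda>n. lattice_kernel \<psi> (\<delta> n) s * q n s ^ j) \<longlonglongrightarrow> fourier_kernel \<psi> s * (- \<i> * of_real s) ^ j"
        by (intro tendsto_intros lattice_kernel_tendsto[OF assms \<delta>])
      \<comment> \<open>The period grows as the step shrinks, so each fixed s eventually lies inside
        the integration interval and the indicator equals 1.\<close>
      moreover have "\<forall>\<^sub>F n in sequentially. \<delta> n < pi / (\<bar>s\<bar> + 1)"
        using \<delta>(3) by (rule order_tendstoD) (auto intro!: divide_pos_pos add_nonneg_pos)
      then have "\<forall>\<^sub>F n in sequentially. lattice_kernel \<psi> (\<delta> n) s * q n s ^ j = F n s"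
      proof eventually_elim
        case (elim n)
        then have "\<delta> n * (\<bar>s\<bar> + 1) < pi"
          by (simp add: pos_less_divide_eq add_nonneg_pos)
        then have "\<bar>s\<bar> * \<delta> n \<le> pi"
          using \<delta>(1)[of n] by (simp add: algebra_simps)
        then have "\<bar>s\<bar> \<le> pi / \<delta> n"
          using \<delta>(1)[of n] by (simp add: pos_le_divide_eq)
        then show ?case by (auto simp: F_def indicator_def abs_le_iff)
      qed
      ultimately show "(\<lambda>n. F n s) \<longlonglongrightarrow> fourier_kernel \<psi> s * (- \<i> * of_real s) ^ j"
        by (rule Lim_transform_eventually)
    qed
  qed
  have val: "(\<integral>s. F n s \<partial>lborel) = (if j = 0 then 1 else 0)" if n: "\<delta> n * j \<le> 1" for n
  proof -
    define c where "c l = of_nat (j choose l) * (-1) ^ (j - l) / complex_of_real (\<delta> n) ^ j" for l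
    have F: "F n s = (\<Sum>l\<le>j. c l *
        (indicator {-pi/\<delta> n..pi/\<delta> n} s *\<^sub>R (lattice_kernel \<psi> (\<delta> n) s * cis (- (of_int (int l) * (\<delta> n * s))))))" for s
    proof -
      have "q n s ^ j = (cis (- (\<delta> n * s)) + (-1)) ^ j / of_real (\<delta> n) ^ j"
        by (simp add: q_def power_divide)
      also have "\<dots> = (\<Sum>l\<le>j. c l * cis (- (of_int (int l) * (\<delta> n * s))))"
        unfolding binomial_ring sum_divide_distrib
        by (intro sum.cong refl) (simp add: c_def Complex.DeMoivre mult_ac)
      finally show ?thesis
        by (simp add: F_def sum_distrib_left scaleR_conv_of_real mult_ac)
    qed
    have "(\<integral>s. F n s \<partial>lborel) = (\<Sum>l\<le>j. c l * of_real (\<psi> (of_int (int l) * \<delta> n)))"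
      unfolding F
      by (subst Bochner_Integration.integral_sum, intro integrable_mult_right lattice_kernel_coefficient(1)[OF assms \<delta>(1)])
         (simp only: integral_mult_right_zero lattice_kernel_coefficient(2)[OF assms \<delta>(1)])
    also have "\<dots> = (\<Sum>l\<le>j. c l)"
    proof (intro sum.cong refl)
      fix l assume "l \<in> {..j}"
      then have "real l * \<delta> n \<le> real j * \<delta> n"
        using \<delta>(1)[of n] by (intro mult_right_mono) auto
      also have "\<dots> \<le> 1"
        using n by (simp add: mult.commute)
      finally have "\<psi> (of_int (int l) * \<delta> n) = 1"
        using \<delta>(1)[of n] by (intro cutoff_eq_one[OF assms]) auto
      then show "c l * of_real (\<psi> (of_int (int l) * \<delta> n)) = c l" by simp
    qed
    also have "\<dots> = (1 + (-1)) ^ j / complex_of_real (\<delta> n) ^ j"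
      unfolding binomial_ring sum_divide_distrib by (simp add: c_def)
    finally show ?thesis using \<delta>(1)[of n] by (simp add: power_0_left)
  qed
  have "\<forall>\<^sub>F n in sequentially. \<delta> n < 1 / (j + 1)"
    using \<delta>(3) by (rule order_tendstoD) auto
  then have "\<forall>\<^sub>F n in sequentially. (\<integral>s. F n s \<partial>lborel) = (if j = 0 then 1 else 0)"
  proof eventually_elim
    case (elim n)
    then have "\<delta> n * (j + 1) < 1" by (simp add: field_simps)
    then show ?case using \<delta>(1)[of n] by (intro val) (simp add: algebra_simps)
  qed
  then have "(\<lambda>n. \<integral>s. F n s \<partial>lborel) \<longlonglongrightarrow> (if j = 0 then 1 else 0)"
    by (rule tendsto_eventually)
  with lim have eq: "(\<integral>s. fourier_kernel \<psi> s * (- \<i> * of_real s) ^ j \<partial>lborel) = (if j = 0 then 1 else 0)"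
    using LIMSEQ_unique by blast
  have "(\<integral>s. fourier_kernel \<psi> s * (- \<i> * of_real s) ^ j \<partial>lborel)
      = (- \<i>) ^ j * (\<integral>s. fourier_kernel \<psi> s * of_real s ^ j \<partial>lborel)"
    by (subst integral_mult_right_zero[symmetric]) (simp only: power_mult_distrib mult_ac)
  with eq show "(\<integral>s. fourier_kernel \<psi> s * of_real s ^ j \<partial>lborel) = (if j = 0 then 1 else 0)"
    by (auto split: if_splits)
qed

section \<open>Smoothing bias of product kernels\<close>

text \<open>A product of Cauchy profiles: light enough to lie in L2, heavy enough that a translation
  costs only a polynomial factor, which the moments of the kernel can pay for.\<close>

definition poly_weight :: "'a::euclidean_space \<Rightarrow> real" where
  "poly_weight x = (\<Prod>b\<in>Basis. 1 / (1 + (x \<bullet> b)\<^sup>2))"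

abbreviation unit_cube :: "'a::euclidean_space set" where
  "unit_cube \<equiv> {x. \<forall>b\<in>Basis. \<bar>x \<bullet> b\<bar> \<le> 1/2}"

lemma one_plus_square_pos: "0 < 1 + (x::real)\<^sup>2"
  by (intro add_pos_nonneg) auto

lemma poly_weight_pos: "0 < poly_weight x"
  unfolding poly_weight_def by (intro prod_pos) (auto simp: one_plus_square_pos)

lemma poly_weight_measurable [measurable]: "poly_weight \<in> borel_measurable borel"
  unfolding poly_weight_def[abs_def] by measurable

text \<open>An instance of Peetre's inequality, from s^2 <= 2 (s + t)^2 + 2 t^2.\<close>

lemma inverse_one_plus_square_shift:
  "1 / (1 + (s + t)\<^sup>2) \<le> 2 * (1 + t\<^sup>2) * (1 / (1 + (s::real)\<^sup>2))"
proof -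
  have "1 + s\<^sup>2 \<le> 2 * (1 + t\<^sup>2) * (1 + (s + t)\<^sup>2)"
  proof -
    have "s\<^sup>2 \<le> 2 * (s + t)\<^sup>2 + 2 * t\<^sup>2"
      using sum_squares_ge_zero[of "s + 2 * t" 0] by (simp add: power2_eq_square algebra_simps)
    moreover have "0 \<le> t\<^sup>2 * (s + t)\<^sup>2" by simp
    ultimately show ?thesis
      using zero_le_power2[of s] by (simp only: distrib_left distrib_right)
  qed
  then show ?thesis
    using one_plus_square_pos[of s] one_plus_square_pos[of "s + t"] by (simp add: field_simps)
qed

lemma poly_weight_sum_shift:
  fixes y :: "'a::euclidean_space"
  assumes "I \<subseteq> Basis"
  shows "poly_weight (y + (\<Sum>b\<in>I. x b *\<^sub>R b)) \<le> (\<Prod>b\<in>I. 2 * (1 + (x b)\<^sup>2)) * poly_weight y"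
proof -
  have fin: "finite I" using assms finite_Basis finite_subset by blast
  have inner: "(\<Sum>b\<in>I. x b *\<^sub>R b) \<bullet> c = (if c \<in> I then x c else 0)" if "c \<in> Basis" for c
  proof -
    have "(\<Sum>b\<in>I. x b *\<^sub>R b) \<bullet> c = (\<Sum>b\<in>I. if b = c then x b else 0)"
      unfolding inner_sum_left using assms that by (intro sum.cong refl) (auto simp: inner_Basis)
    then show ?thesis using fin by (simp add: sum.delta)
  qed
  have "poly_weight (y + (\<Sum>b\<in>I. x b *\<^sub>R b))
      \<le> (\<Prod>b\<in>Basis. (if b \<in> I then 2 * (1 + (x b)\<^sup>2) else 1) * (1 / (1 + (y \<bullet> b)\<^sup>2)))"
    unfolding poly_weight_def
    by (rule prod_mono)
       (use one_plus_square_pos inverse_one_plus_square_shift in \<open>auto simp: inner_left_distrib inner less_imp_le\<close>)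
  also have "\<dots> = (\<Prod>b\<in>Basis. if b \<in> I then 2 * (1 + (x b)\<^sup>2) else 1) * poly_weight y"
    unfolding poly_weight_def by (rule prod.distrib)
  also have "(\<Prod>b\<in>Basis. if b \<in> I then 2 * (1 + (x b)\<^sup>2) else 1) = (\<Prod>b\<in>I. 2 * (1 + (x b)\<^sup>2))"
    using assms by (simp add: prod.If_cases Int_absorb1 Int_def[symmetric])
  finally show ?thesis .
qed

lemma poly_weight_axis_shift:
  assumes "b \<in> Basis"
  shows "poly_weight (y + t *\<^sub>R b) \<le> 2 * (1 + t\<^sup>2) * poly_weight y"
  using poly_weight_sum_shift[of "{b}" y "\<lambda>_. t"] assms by simp

lemma poly_weight_unit_cube:
  fixes x :: "'a::euclidean_space"
  assumes "x \<in> unit_cube"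
  shows "1 \<le> 2 ^ DIM('a) * poly_weight x"
proof -
  have "(\<Prod>b\<in>(Basis::'a set). 1 :: real) \<le> (\<Prod>b\<in>(Basis::'a set). 2 * (1 / (1 + (x \<bullet> b)\<^sup>2)))"
  proof (rule prod_mono, intro conjI)
    fix b :: 'a assume "b \<in> Basis"
    then have "\<bar>x \<bullet> b\<bar> \<le> 1" using assms by fastforce
    then have "(x \<bullet> b)\<^sup>2 \<le> 1" by (simp add: abs_square_le_1)
    then show "1 \<le> 2 * (1 / (1 + (x \<bullet> b)\<^sup>2))"
      using one_plus_square_pos[of "x \<bullet> b"] by (simp add: field_simps)
  qed simp
  then show ?thesis
    unfolding poly_weight_def by (simp only: prod.distrib prod_constant power_one)
qed

lemma abs_integral_le:
  fixes f g :: "'b \<Rightarrow> real"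
  assumes "integrable M g" "\<And>x. \<bar>f x\<bar> \<le> g x"
  shows "\<bar>\<integral>x. f x \<partial>M\<bar> \<le> (\<integral>x. g x \<partial>M)"
proof -
  have "0 \<le> g x" for x using assms(2)[of x] by linarith
  then have "(\<integral>x. \<bar>f x\<bar> \<partial>M) \<le> (\<integral>x. g x \<partial>M)"
    by (intro integral_mono' assms)
  then show ?thesis using integral_abs_bound[of M f] by linarith
qed

text \<open>\<open>D j\<close> plays the role of the \<open>j\<close>-th pure derivative of \<open>f\<close> in the direction \<open>b\<close>. Only pure
  derivatives occur because the product kernel is applied one coordinate at a time.\<close>

definition axis_smooth :: "real \<Rightarrow> real \<Rightarrow> nat \<Rightarrow> 'a \<Rightarrow> (nat \<Rightarrow> 'a \<Rightarrow> real) \<Rightarrow> ('a::euclidean_space \<Rightarrow> real) \<Rightarrow> bool" where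
  "axis_smooth \<beta> L m b D f \<longleftrightarrow> D 0 = f \<and>
     (\<forall>x. x \<notin> unit_cube \<longrightarrow> f x = 0) \<and>
     (\<forall>j<m. \<forall>x. ((\<lambda>t. D j (x + t *\<^sub>R b)) has_real_derivative D (Suc j) x) (at 0)) \<and>
     (\<forall>x y. \<bar>D m x - D m y\<bar> \<le> L * norm (x - y) powr (\<beta> - real m))"

lemma closed_unit_cube: "closed (unit_cube :: 'a::euclidean_space set)"
proof -
  have "(unit_cube :: 'a set) = (\<Inter>b\<in>Basis. {x. \<bar>x \<bullet> b\<bar> \<le> 1/2})" by auto
  then show ?thesis
    by (auto intro!: closed_INT closed_Collect_le continuous_intros)
qed

text \<open>The complement of the closed cube is open, so a derivative at an outside point sees only
  zeros. Hence the whole Taylor polynomial vanishes at base points outside the cube.\<close>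

lemma axis_smooth_zero:
  assumes "axis_smooth \<beta> L m b D f" "j \<le> m" "x \<notin> unit_cube"
  shows "D j x = 0"
  using assms(2,3)
proof (induction j arbitrary: x)
  case 0
  then show ?case using assms(1) by (auto simp: axis_smooth_def)
next
  case (Suc j)
  have "open (- unit_cube :: 'a set)"
    by (rule open_Compl[OF closed_unit_cube])
  moreover have "((\<lambda>t. x + t *\<^sub>R b) \<longlongrightarrow> x) (nhds (0::real))"
    using tendsto_add[OF tendsto_const[of x] tendsto_scaleR[OF filterlim_ident tendsto_const[of b]], of "0::real"] by simp
  ultimately have "\<forall>\<^sub>F t in nhds (0::real). x + t *\<^sub>R b \<in> - unit_cube"
    using Suc.prems(2) by (intro topological_tendstoD) auto
  then have "\<forall>\<^sub>F t in nhds (0::real). D j (x + t *\<^sub>R b) = 0"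
    by eventually_elim (use Suc in auto)
  then have "((\<lambda>t. D j (x + t *\<^sub>R b)) has_real_derivative 0) (at 0) \<longleftrightarrow> ((\<lambda>t. 0) has_real_derivative 0) (at (0::real))"
    by (intro DERIV_cong_ev) auto
  then have "((\<lambda>t. D j (x + t *\<^sub>R b)) has_real_derivative 0) (at 0)" by simp
  moreover have "((\<lambda>t. D j (x + t *\<^sub>R b)) has_real_derivative D (Suc j) x) (at 0)"
    using assms(1) Suc.prems(1) by (auto simp: axis_smooth_def)
  ultimately show ?case using DERIV_unique by blast
qed

definition taylor_remainder :: "nat \<Rightarrow> 'a::euclidean_space \<Rightarrow> (nat \<Rightarrow> 'a \<Rightarrow> real) \<Rightarrow> 'a \<Rightarrow> real \<Rightarrow> real" where
  "taylor_remainder m b D x t = D 0 (x + t *\<^sub>R b) - (\<Sum>j\<le>m. D j x / fact j * t ^ j)"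

text \<open>The polynomial includes order m. With the Lagrange form one order lower, the remainder
  becomes a difference of two values of the m-th derivative at distance at most |t|, to which the
  Hoelder condition applies.\<close>

lemma taylor_remainder_le:
  assumes "axis_smooth \<beta> L m b D f" "b \<in> Basis" "0 \<le> L" "real m < \<beta>"
  shows "\<bar>taylor_remainder m b D x t\<bar> \<le> L * \<bar>t\<bar> powr \<beta>"
proof -
  have nb: "norm b = 1" using assms(2) by simp
  define F where "F j s = D j (x + s *\<^sub>R b)" for j s
  have "(F j has_real_derivative F (Suc j) s) (at s)" if "j < m" for j s
  proof -
    have "((\<lambda>t. D j ((x + s *\<^sub>R b) + t *\<^sub>R b)) has_real_derivative D (Suc j) (x + s *\<^sub>R b)) (at 0)"
      using assms(1) that by (simp add: axis_smooth_def)
    moreover have "D j ((x + s *\<^sub>R b) + t *\<^sub>R b) = F j (t + s)" for t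
      by (simp add: F_def scaleR_left_distrib add_ac)
    ultimately have "((\<lambda>t. F j (t + s)) has_real_derivative F (Suc j) s) (at 0)"
      by (simp only: F_def[of "Suc j"])
    then show ?thesis
      using DERIV_shift[of "F j" "F (Suc j) s" 0 s] by (simp only: add_0)
  qed
  then obtain s where s: "\<bar>s\<bar> \<le> \<bar>t\<bar>" "F 0 t = (\<Sum>j<m. F j 0 / fact j * t ^ j) + F m s / fact m * t ^ m"
    using Maclaurin_bi_le[of F "F 0" m t] by blast
  have "taylor_remainder m b D x t = (F m s - F m 0) / fact m * t ^ m"
    using s(2) by (simp add: taylor_remainder_def F_def lessThan_Suc_atMost[symmetric] diff_divide_distrib left_diff_distrib)
  then have "\<bar>taylor_remainder m b D x t\<bar> = \<bar>F m s - F m 0\<bar> * (\<bar>t\<bar> ^ m / fact m)"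
    by (simp add: abs_mult power_abs)
  also have "\<dots> \<le> (L * \<bar>t\<bar> powr (\<beta> - real m)) * \<bar>t\<bar> ^ m"
  proof (rule mult_mono)
    have "\<bar>F m s - F m 0\<bar> \<le> L * norm (s *\<^sub>R b) powr (\<beta> - real m)"
    proof -
      have "\<bar>D m (x + s *\<^sub>R b) - D m x\<bar> \<le> L * norm ((x + s *\<^sub>R b) - x) powr (\<beta> - real m)"
        using assms(1) unfolding axis_smooth_def by blast
      then show ?thesis by (simp add: F_def)
    qed
    also have "\<dots> \<le> L * \<bar>t\<bar> powr (\<beta> - real m)"
      using s(1) nb assms(3,4) by (intro mult_left_mono powr_mono2) auto
    finally show "\<bar>F m s - F m 0\<bar> \<le> L * \<bar>t\<bar> powr (\<beta> - real m)" .
    show "\<bar>t\<bar> ^ m / fact m \<le> \<bar>t\<bar> ^ m"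
      using fact_ge_1[of m, where 'a = real] mult_left_mono[of 1 "fact m" "\<bar>t\<bar> ^ m"] by (simp add: divide_le_eq)
  qed (use assms(3) in auto)
  also have "\<dots> = L * \<bar>t\<bar> powr \<beta>"
  proof (cases "t = 0")
    case False
    then have "\<bar>t\<bar> ^ m = \<bar>t\<bar> powr real m" by (simp add: powr_realpow)
    then have "\<bar>t\<bar> powr (\<beta> - real m) * \<bar>t\<bar> ^ m = \<bar>t\<bar> powr \<beta>"
      by (simp add: powr_add[symmetric])
    then show ?thesis by (simp only: mult.assoc)
  qed (use assms(4) in auto)
  finally show ?thesis .
qed

text \<open>Expand around a base point two units back along \<open>b\<close>. It lies outside the
  cube, so its Taylor polynomial is zero and the remainder is the function value itself.\<close>

lemma axis_smooth_bounded:
  assumes "axis_smooth \<beta> L m b D f" "b \<in> Basis" "0 \<le> L" "real m < \<beta>"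
  shows "\<bar>f x\<bar> \<le> L * 2 powr \<beta>"
proof (cases "x \<in> unit_cube")
  case True
  define x' where "x' = x - 2 *\<^sub>R b"
  have "\<bar>x \<bullet> b\<bar> \<le> 1/2" using True assms(2) by auto
  then have "\<not> \<bar>x' \<bullet> b\<bar> \<le> 1/2"
    using assms(2) by (simp add: x'_def inner_diff_left)
  then have "x' \<notin> unit_cube" using assms(2) by blast
  then have "taylor_remainder m b D x' 2 = f x"
    using axis_smooth_zero[OF assms(1)] assms(1) by (simp add: taylor_remainder_def x'_def axis_smooth_def)
  then show ?thesis using taylor_remainder_le[OF assms, of x' 2] by simp
next
  case False
  then show ?thesis using assms by (simp add: axis_smooth_def)
qed

text \<open>The remainder vanishes unless \<open>x\<close> or \<open>x + t b\<close> lies in the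
  cube. In both cases the weight at \<open>x\<close> is bounded below, up to a factor 1 + t^2, which
  yields decay in \<open>x\<close>.\<close>

lemma taylor_remainder_weighted:
  fixes x :: "'a::euclidean_space"
  assumes "axis_smooth \<beta> L m b D f" "b \<in> Basis" "0 \<le> L" "real m < \<beta>"
  shows "\<bar>taylor_remainder m b D x t\<bar> \<le> L * \<bar>t\<bar> powr \<beta> * (2 * 2 ^ DIM('a) * (1 + t\<^sup>2) * poly_weight x)"
proof (cases "x \<in> unit_cube \<or> x + t *\<^sub>R b \<in> unit_cube")
  case True
  then have "1 \<le> 2 ^ DIM('a) * (2 * (1 + t\<^sup>2) * poly_weight x)"
  proof
    assume "x \<in> unit_cube"
    then have "1 \<le> 2 ^ DIM('a) * poly_weight x" by (rule poly_weight_unit_cube)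
    also have "\<dots> \<le> 2 ^ DIM('a) * (2 * (1 + t\<^sup>2) * poly_weight x)"
      using poly_weight_pos[of x] by (intro mult_left_mono) auto
    finally show ?thesis .
  next
    assume "x + t *\<^sub>R b \<in> unit_cube"
    then have "1 \<le> 2 ^ DIM('a) * poly_weight (x + t *\<^sub>R b)" by (rule poly_weight_unit_cube)
    also have "\<dots> \<le> 2 ^ DIM('a) * (2 * (1 + t\<^sup>2) * poly_weight x)"
      by (intro mult_left_mono poly_weight_axis_shift assms) auto
    finally show ?thesis .
  qed
  then have "L * \<bar>t\<bar> powr \<beta> * 1 \<le> L * \<bar>t\<bar> powr \<beta> * (2 ^ DIM('a) * (2 * (1 + t\<^sup>2) * poly_weight x))"
    using assms(3) by (intro mult_left_mono) auto
  then show ?thesis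
    using taylor_remainder_le[OF assms, of x t] by (simp add: algebra_simps)
next
  case False
  then have "taylor_remainder m b D x t = 0"
    using axis_smooth_zero[OF assms(1)] assms(1) by (simp add: taylor_remainder_def axis_smooth_def)
  moreover have "0 \<le> L * \<bar>t\<bar> powr \<beta> * (2 * 2 ^ DIM('a) * (1 + t\<^sup>2) * poly_weight x)"
    using assms(3) poly_weight_pos[of x] by (intro mult_nonneg_nonneg) auto
  ultimately show ?thesis by simp
qed

text \<open>\<open>q\<close> stands for the rescaled one-dimensional kernel. The factors 1 + t^2 pay
  for translating the weight. \<open>M\<close> will be independent of the bandwidth and
  \<open>A\<close> a multiple of h^\<beta>.\<close>

locale moment_kernel =
  fixes q :: "real \<Rightarrow> real" and m :: nat and \<beta> M A :: real
  assumes measurable_q [measurable]: "q \<in> borel_measurable borel"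
    and moments: "j \<le> m \<Longrightarrow> (\<integral>t. q t * t ^ j \<partial>lborel) = (if j = 0 then 1 else 0)"
    and integrable_moments: "j \<le> m \<Longrightarrow> integrable lborel (\<lambda>t. q t * t ^ j)"
    and mass: "integrable lborel (\<lambda>t. \<bar>q t\<bar> * (1 + t\<^sup>2))" "(\<integral>t. \<bar>q t\<bar> * (1 + t\<^sup>2) \<partial>lborel) \<le> M" "1 \<le> M"
    and holder_moment: "integrable lborel (\<lambda>t. \<bar>q t\<bar> * \<bar>t\<bar> powr \<beta> * (1 + t\<^sup>2))"
      "(\<integral>t. \<bar>q t\<bar> * \<bar>t\<bar> powr \<beta> * (1 + t\<^sup>2) \<partial>lborel) \<le> A"
begin

lemma integrable_q: "integrable lborel q"
  using integrable_moments[of 0] by simp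

lemma integrable_q_bounded:
  assumes [measurable]: "g \<in> borel_measurable borel" and "\<And>t. \<bar>g t\<bar> \<le> F"
  shows "integrable lborel (\<lambda>t. q t * g t)"
proof (rule Bochner_Integration.integrable_bound)
  show "integrable lborel (\<lambda>t. F * \<bar>q t\<bar>)"
    using integrable_q by (intro integrable_mult_right) auto
  have "0 \<le> F" using assms(2)[of 0] by linarith
  then show "AE t in lborel. norm (q t * g t) \<le> norm (F * \<bar>q t\<bar>)"
    using assms(2) by (auto simp: abs_mult mult.commute intro!: AE_I2 mult_right_mono)
qed measurable

text \<open>The moments reduce the integrated Taylor polynomial to its constant term
  \<open>f x\<close>; what is left is the integrated remainder.\<close>

lemma axis_bias:
  fixes f :: "'a::euclidean_space \<Rightarrow> real"
  assumes "axis_smooth \<beta> L m b D f" "b \<in> Basis" "0 \<le> L" "real m < \<beta>"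
    and [measurable]: "f \<in> borel_measurable borel"
  shows "\<bar>(\<integral>t. q t * f (x + t *\<^sub>R b) \<partial>lborel) - f x\<bar> \<le> 2 * 2 ^ DIM('a) * L * A * poly_weight x"
proof -
  let ?R = "taylor_remainder m b D x"
  have D0: "D 0 = f" using assms(1) by (simp add: axis_smooth_def)
  have int1: "integrable lborel (\<lambda>t. q t * f (x + t *\<^sub>R b))"
    by (rule integrable_q_bounded[OF _ axis_smooth_bounded[OF assms(1-4)]]) measurable
  have int2: "integrable lborel (\<lambda>t. D j x / fact j * (q t * t ^ j))" if "j \<le> m" for j
    using integrable_moments[OF that] by (rule integrable_mult_right)
  have R: "q t * ?R t = q t * f (x + t *\<^sub>R b) - (\<Sum>j\<le>m. D j x / fact j * (q t * t ^ j))" for t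
    by (simp add: taylor_remainder_def D0 right_diff_distrib sum_distrib_left mult_ac)
  have "(\<integral>t. q t * ?R t \<partial>lborel)
      = (\<integral>t. q t * f (x + t *\<^sub>R b) \<partial>lborel) - (\<integral>t. (\<Sum>j\<le>m. D j x / fact j * (q t * t ^ j)) \<partial>lborel)"
    unfolding R by (intro Bochner_Integration.integral_diff int1 Bochner_Integration.integrable_sum int2) auto
  also have "(\<integral>t. (\<Sum>j\<le>m. D j x / fact j * (q t * t ^ j)) \<partial>lborel) = (\<Sum>j\<le>m. D j x / fact j * (if j = 0 then 1 else 0))"
    using int2 moments by (subst Bochner_Integration.integral_sum) auto
  also have "\<dots> = (\<Sum>j\<le>m. if j = 0 then f x else 0)"
    using D0 by (intro sum.cong) auto
  also have "\<dots> = f x"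
    by simp
  finally have eq: "(\<integral>t. q t * f (x + t *\<^sub>R b) \<partial>lborel) - f x = (\<integral>t. q t * ?R t \<partial>lborel)" by simp
  have intR: "integrable lborel (\<lambda>t. q t * ?R t)"
    unfolding R by (intro Bochner_Integration.integrable_diff int1 Bochner_Integration.integrable_sum int2) auto
  let ?c = "2 * 2 ^ DIM('a) * L * poly_weight x"
  have "\<bar>\<integral>t. q t * ?R t \<partial>lborel\<bar> \<le> (\<integral>t. \<bar>q t * ?R t\<bar> \<partial>lborel)"
    by (rule integral_abs_bound)
  also have "\<dots> \<le> (\<integral>t. ?c * (\<bar>q t\<bar> * \<bar>t\<bar> powr \<beta> * (1 + t\<^sup>2)) \<partial>lborel)"
  proof (rule integral_mono)
    show "integrable lborel (\<lambda>t. \<bar>q t * ?R t\<bar>)" using intR by simp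
    show "integrable lborel (\<lambda>t. ?c * (\<bar>q t\<bar> * \<bar>t\<bar> powr \<beta> * (1 + t\<^sup>2)))"
      using holder_moment(1) by (rule integrable_mult_right)
    show "\<bar>q t * ?R t\<bar> \<le> ?c * (\<bar>q t\<bar> * \<bar>t\<bar> powr \<beta> * (1 + t\<^sup>2))" for t
      using mult_left_mono[OF taylor_remainder_weighted[OF assms(1-4), of x t], of "\<bar>q t\<bar>"]
      by (simp add: abs_mult mult_ac)
  qed
  also have "\<dots> = ?c * (\<integral>t. \<bar>q t\<bar> * \<bar>t\<bar> powr \<beta> * (1 + t\<^sup>2) \<partial>lborel)"
    by simp
  also have "\<dots> \<le> ?c * A"
    using assms(3) poly_weight_pos[of x] by (intro mult_left_mono holder_moment) auto
  finally show ?thesis unfolding eq by (simp add: mult_ac)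
qed

text \<open>Smoothing in the directions of \<open>I\<close> only: it interpolates between
  \<open>f\<close> (empty \<open>I\<close>) and the full convolution
  (\<open>I = Basis\<close>).\<close>

definition partial_smooth :: "('a::euclidean_space \<Rightarrow> real) \<Rightarrow> 'a set \<Rightarrow> 'a \<Rightarrow> real" where
  "partial_smooth f I y = (\<integral>x. (\<Prod>b\<in>I. q (x b)) * f (y + (\<Sum>b\<in>I. x b *\<^sub>R b)) \<partial>PiM I (\<lambda>_. lborel))"

lemma integrable_prod_q:
  assumes "finite I" and [measurable]: "g \<in> borel_measurable borel" and "\<And>x::'a::euclidean_space. \<bar>g x\<bar> \<le> F"
  shows "integrable (PiM I (\<lambda>_. lborel)) (\<lambda>x. (\<Prod>b\<in>I. q (x b)) * g (y + (\<Sum>b\<in>I. x b *\<^sub>R b)))"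
proof (rule Bochner_Integration.integrable_bound)
  interpret product_sigma_finite "\<lambda>_::'a. lborel :: real measure"
    by standard
  show "integrable (PiM I (\<lambda>_. lborel)) (\<lambda>x. F * \<bar>\<Prod>b\<in>I. q (x b)\<bar>)"
    using product_integrable_prod[OF assms(1), of "\<lambda>_. q"] integrable_q by (intro integrable_mult_right integrable_abs) auto
  have "0 \<le> F" using assms(3)[of 0] by linarith
  then show "AE x in PiM I (\<lambda>_. lborel). norm ((\<Prod>b\<in>I. q (x b)) * g (y + (\<Sum>b\<in>I. x b *\<^sub>R b))) \<le> norm (F * \<bar>\<Prod>b\<in>I. q (x b)\<bar>)"
    using assms(3) by (intro AE_I2) (simp add: abs_mult mult.commute[of F] mult_left_mono)
qed (use assms(1) in measurable)

text \<open>Each shift by x_b costs a factor 2 (1 + x_b^2), whose integral against |q| is at most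
  2M. Averaging therefore preserves the profile of the weight.\<close>

lemma weighted_average_le:
  fixes y :: "'a::euclidean_space"
  assumes "I \<subseteq> Basis" and [measurable]: "g \<in> borel_measurable borel"
    and "\<And>x::'a. \<bar>g x\<bar> \<le> a * poly_weight x" "0 \<le> a"
  shows "\<bar>\<integral>x. (\<Prod>b\<in>I. q (x b)) * g (y + (\<Sum>b\<in>I. x b *\<^sub>R b)) \<partial>PiM I (\<lambda>_. lborel)\<bar>
    \<le> (2 * M) ^ card I * (a * poly_weight y)"
proof -
  interpret product_sigma_finite "\<lambda>_::'a. lborel :: real measure"
    by standard
  have fin: "finite I" using assms finite_Basis finite_subset by blast
  define p where "p t = 2 * (\<bar>q t\<bar> * (1 + t\<^sup>2))" for t
  have p_int: "integrable lborel p"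
    unfolding p_def[abs_def] using mass(1) by (intro integrable_mult_right)
  have p0: "0 \<le> p t" for t by (simp add: p_def)
  have pM: "0 \<le> integral\<^sup>L lborel p" "integral\<^sup>L lborel p \<le> 2 * M"
    using p0 mass(2) by (auto simp: p_def[abs_def])
  have bnd: "\<bar>(\<Prod>b\<in>I. q (x b)) * g (y + (\<Sum>b\<in>I. x b *\<^sub>R b))\<bar> \<le> (\<Prod>b\<in>I. p (x b)) * (a * poly_weight y)" for x
  proof -
    have "\<bar>g (y + (\<Sum>b\<in>I. x b *\<^sub>R b))\<bar> \<le> a * ((\<Prod>b\<in>I. 2 * (1 + (x b)\<^sup>2)) * poly_weight y)"
      using assms(3)[of "y + (\<Sum>b\<in>I. x b *\<^sub>R b)"] mult_left_mono[OF poly_weight_sum_shift[OF assms(1), of y x] assms(4)]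
      by linarith
    then have "(\<Prod>b\<in>I. \<bar>q (x b)\<bar>) * \<bar>g (y + (\<Sum>b\<in>I. x b *\<^sub>R b))\<bar>
        \<le> (\<Prod>b\<in>I. \<bar>q (x b)\<bar>) * (a * ((\<Prod>b\<in>I. 2 * (1 + (x b)\<^sup>2)) * poly_weight y))"
      by (intro mult_left_mono prod_nonneg) auto
    also have "\<dots> = (\<Prod>b\<in>I. p (x b)) * (a * poly_weight y)"
    proof -
      have "(\<Prod>b\<in>I. p (x b)) = (\<Prod>b\<in>I. \<bar>q (x b)\<bar> * (2 * (1 + (x b)\<^sup>2)))"
        by (intro prod.cong refl) (simp add: p_def)
      then show ?thesis by (simp only: prod.distrib mult_ac)
    qed
    finally show ?thesis by (simp add: abs_mult abs_prod)
  qed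
  have int: "integrable (PiM I (\<lambda>_. lborel)) (\<lambda>x. (\<Prod>b\<in>I. p (x b)) * (a * poly_weight y))"
    using product_integrable_prod[OF fin, of "\<lambda>_. p"] p_int by (intro integrable_mult_left) auto
  have "\<bar>\<integral>x. (\<Prod>b\<in>I. q (x b)) * g (y + (\<Sum>b\<in>I. x b *\<^sub>R b)) \<partial>PiM I (\<lambda>_. lborel)\<bar>
      \<le> (\<integral>x. (\<Prod>b\<in>I. p (x b)) * (a * poly_weight y) \<partial>PiM I (\<lambda>_. lborel))"
    by (rule abs_integral_le[OF int bnd])
  also have "\<dots> = (integral\<^sup>L lborel p) ^ card I * (a * poly_weight y)"
    using product_integral_prod[OF fin, of "\<lambda>_. p"] p_int by simp
  also have "\<dots> \<le> (2 * M) ^ card I * (a * poly_weight y)"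
    using pM assms(4) poly_weight_pos[of y] by (intro mult_right_mono power_mono) auto
  finally show ?thesis .
qed

text \<open>Telescoping over directions. Adding \<open>b\<close> to \<open>I\<close> changes the
  value by the \<open>I\<close>-average of \<open>G - f\<close>, where \<open>G\<close> smooths
  \<open>f\<close> itself in direction \<open>b\<close> alone. Thus \<open>axis_bias\<close> is only
  ever applied to \<open>f\<close>, never to a partially smoothed function, and the outer average is
  controlled by \<open>weighted_average_le\<close>.\<close>

lemma partial_smooth_bias:
  fixes f :: "'a::euclidean_space \<Rightarrow> real"
  assumes smooth: "\<And>b. b \<in> Basis \<Longrightarrow> axis_smooth \<beta> L m b (D b) f"
    and "0 \<le> L" "0 \<le> A" "real m < \<beta>" and [measurable]: "f \<in> borel_measurable borel" and "I \<subseteq> Basis"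
  shows "\<bar>partial_smooth f I y - f y\<bar> \<le> card I * (2 * M) ^ card I * (2 * 2 ^ DIM('a) * L * A * poly_weight y)"
proof -
  have "finite I" using assms(6) finite_Basis finite_subset by blast
  then show ?thesis using assms(6)
  proof (induction I)
    case empty
    have "partial_smooth f {} y = f y"
      by (simp add: partial_smooth_def PiM_empty)
    then show ?case by simp
  next
    case (insert b I)
    interpret product_sigma_finite "\<lambda>_::'a. lborel :: real measure"
      by standard
    have b: "b \<in> Basis" and I: "I \<subseteq> Basis" using insert.prems by auto
    define F where "F = L * 2 powr \<beta>"
    have fF: "\<bar>f x\<bar> \<le> F" for x
      unfolding F_def using axis_smooth_bounded[OF smooth[OF b] b assms(2,4)] .
    define G where "G z = (\<integral>t. q t * f (z + t *\<^sub>R b) \<partial>lborel)" for z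
    have [measurable]: "G \<in> borel_measurable borel"
      unfolding G_def[abs_def] by measurable
    define a where "a = 2 * 2 ^ DIM('a) * L * A"
    have a0: "0 \<le> a" using assms(2,3) by (simp add: a_def)
    have Gf: "\<bar>G z - f z\<bar> \<le> a * poly_weight z" for z
      unfolding G_def a_def by (rule axis_bias[OF smooth[OF b] b assms(2,4,5)])
    have GF: "\<bar>G z\<bar> \<le> F * (\<integral>t. \<bar>q t\<bar> \<partial>lborel)" for z
    proof -
      have "\<bar>G z\<bar> \<le> (\<integral>t. F * \<bar>q t\<bar> \<partial>lborel)"
        unfolding G_def
        by (rule abs_integral_le) (use integrable_q fF in \<open>auto simp: abs_mult mult.commute[of F] mult_left_mono\<close>)
      then show ?thesis by simp
    qed
    let ?S = "\<lambda>x. y + (\<Sum>c\<in>I. x c *\<^sub>R c)"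
    have upd: "(\<Prod>c\<in>insert b I. q ((x(b := t)) c)) * f (y + (\<Sum>c\<in>insert b I. (x(b := t)) c *\<^sub>R c))
        = (\<Prod>c\<in>I. q (x c)) * (q t * f (?S x + t *\<^sub>R b))" for x t
    proof -
      have "(\<Prod>c\<in>I. q (if c = b then t else x c)) = (\<Prod>c\<in>I. q (x c))"
        using insert.hyps by (intro prod.cong) auto
      moreover have "(\<Sum>c\<in>I. (if c = b then t else x c) *\<^sub>R c) = (\<Sum>c\<in>I. x c *\<^sub>R c)"
        using insert.hyps by (intro sum.cong) auto
      ultimately show ?thesis
        using insert.hyps by (simp add: fun_upd_def algebra_simps)
    qed
    have "partial_smooth f (insert b I) y = (\<integral>x. (\<integral>t. (\<Prod>c\<in>I. q (x c)) * (q t * f (?S x + t *\<^sub>R b)) \<partial>lborel) \<partial>PiM I (\<lambda>_. lborel))"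
      unfolding partial_smooth_def using insert.hyps
      by (subst product_integral_insert[OF insert.hyps integrable_prod_q[OF _ assms(5) fF]]) (simp_all only: upd finite.insertI)
    also have "\<dots> = (\<integral>x. (\<Prod>c\<in>I. q (x c)) * G (?S x) \<partial>PiM I (\<lambda>_. lborel))"
      by (simp add: G_def)
    finally have "partial_smooth f (insert b I) y - partial_smooth f I y
        = (\<integral>x. (\<Prod>c\<in>I. q (x c)) * G (?S x) - (\<Prod>c\<in>I. q (x c)) * f (?S x) \<partial>PiM I (\<lambda>_. lborel))"
      unfolding partial_smooth_def
      by (subst Bochner_Integration.integral_diff) (auto intro!: integrable_prod_q[OF insert.hyps(1)] fF GF)
    also have "\<dots> = (\<integral>x. (\<Prod>c\<in>I. q (x c)) * (\<lambda>z. G z - f z) (?S x) \<partial>PiM I (\<lambda>_. lborel))"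
      by (simp add: right_diff_distrib)
    finally have "\<bar>partial_smooth f (insert b I) y - partial_smooth f I y\<bar> \<le> (2 * M) ^ card I * (a * poly_weight y)"
      using weighted_average_le[OF I _ Gf a0, of y] by simp
    moreover have "\<bar>partial_smooth f I y - f y\<bar> \<le> card I * (2 * M) ^ card I * (a * poly_weight y)"
      using insert.IH[OF I] by (simp add: a_def mult_ac)
    ultimately have "\<bar>partial_smooth f (insert b I) y - f y\<bar> \<le> (1 + card I) * ((2 * M) ^ card I * (a * poly_weight y))"
      by (simp add: algebra_simps)
    \<comment> \<open>\<open>1 \<le> M\<close> allows the exponent to be raised, so that all
      telescoping terms share one bound.\<close>
    also have "\<dots> \<le> (1 + card I) * ((2 * M) ^ Suc (card I) * (a * poly_weight y))"
      using mass(3) a0 poly_weight_pos[of y] by (intro mult_left_mono mult_right_mono power_increasing) auto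
    finally show ?case using insert.hyps by (simp add: a_def mult_ac)
  qed
qed

text \<open>Translation by \<open>y\<close>, followed by the description of Lebesgue measure as
  image of the product measure under the coordinate map, identifies the convolution with
  \<open>partial_smooth f Basis y\<close>.\<close>

lemma product_kernel_bias:
  fixes f :: "'a::euclidean_space \<Rightarrow> real"
  assumes smooth: "\<And>b. b \<in> Basis \<Longrightarrow> axis_smooth \<beta> L m b (D b) f"
    and "0 \<le> L" "0 \<le> A" "real m < \<beta>" and [measurable]: "f \<in> borel_measurable borel"
  shows "\<bar>(\<integral>x. (\<Prod>b\<in>Basis. q ((x - y) \<bullet> b)) * f x \<partial>lborel) - f y\<bar>
    \<le> DIM('a) * (2 * M) ^ DIM('a) * (2 * 2 ^ DIM('a) * L * A * poly_weight y)"
proof -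
  let ?P = "PiM (Basis::'a set) (\<lambda>_. lborel :: real measure)"
  have "(\<integral>x. (\<Prod>b\<in>Basis. q ((x - y) \<bullet> b)) * f x \<partial>lborel)
      = (\<integral>x. (\<Prod>b\<in>Basis. q ((x - y) \<bullet> b)) * f x \<partial>distr lborel borel ((+) y))"
    by (simp add: lborel_distr_plus)
  also have "\<dots> = (\<integral>z. (\<Prod>b\<in>Basis. q (z \<bullet> b)) * f (y + z) \<partial>lborel)"
    by (subst integral_distr) auto
  also have "\<dots> = (\<integral>z. (\<Prod>b\<in>Basis. q (z \<bullet> b)) * f (y + z) \<partial>distr ?P borel (\<lambda>x. \<Sum>b\<in>Basis. x b *\<^sub>R b))"
    unfolding lborel_eq[symmetric] ..
  also have "\<dots> = (\<integral>x. (\<Prod>b\<in>Basis. q ((\<Sum>c\<in>Basis. x c *\<^sub>R c) \<bullet> b)) * f (y + (\<Sum>b\<in>Basis. x b *\<^sub>R b)) \<partial>?P)"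
    by (subst integral_distr) auto
  also have "\<dots> = partial_smooth f Basis y"
    unfolding partial_smooth_def by (intro Bochner_Integration.integral_cong refl) simp
  finally show ?thesis
    using partial_smooth_bias[OF smooth assms(2-5) order_refl, of y] by simp
qed

end

section \<open>Bias on the Hoelder class\<close>

lemma real_vec_Basis: "(Basis :: (real^'d) set) = range (\<lambda>i. axis i 1)"
  by (auto simp: Basis_vec_def)

lemma prod_Basis_vec: "(\<Prod>b\<in>Basis. g ((x :: real^'d) \<bullet> b)) = (\<Prod>i\<in>UNIV. g (x $ i))"
proof -
  have "inj (\<lambda>i. axis i (1::real) :: real^'d)"
    by (auto simp: inj_on_def axis_eq_axis)
  then show ?thesis
    unfolding real_vec_Basis by (subst prod.reindex) (auto simp: inner_axis)
qed

lemma cube_eq_unit_cube: "cbox (\<chi> i. - 1/2) (\<chi> i. 1/2) = (unit_cube :: (real^'d) set)"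
proof -
  have "(- 1/2 \<le> t \<and> t \<le> 1/2) \<longleftrightarrow> \<bar>t\<bar> \<le> 1/2" for t :: real by auto
  then show ?thesis
    by (simp only: set_eq_iff mem_box_cart vec_lambda_beta mem_Collect_eq real_vec_Basis) (simp add: inner_axis)
qed

lemma coords_enumerates: "distinct (coords :: 'd::finite list)" "set (coords :: 'd list) = UNIV"
proof -
  have "\<exists>xs::'d list. distinct xs \<and> set xs = UNIV"
    using finite_distinct_list[of "UNIV :: 'd set"] by auto
  then have "distinct (coords :: 'd list) \<and> set (coords :: 'd list) = UNIV"
    unfolding coords_def by (rule someI_ex)
  then show "distinct (coords :: 'd list)" "set (coords :: 'd list) = UNIV" by auto
qed

text \<open>For a multi-index concentrated at one coordinate the enumeration \<open>coords\<close>
  contributes exactly one nontrivial factor, so its unspecified order does not matter.\<close>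

lemma multi_deriv_single:
  fixes f :: "real^'d \<Rightarrow> real"
  shows "multi_deriv (\<lambda>k. if k = i then m else 0) f = (partial_deriv i ^^ m) f"
proof -
  have "foldr (\<lambda>k. partial_deriv k ^^ (if k = i then m else 0)) xs f
      = (if i \<in> set xs then (partial_deriv i ^^ m) f else f)" if "distinct xs" for xs :: "'d list"
    using that by (induction xs) auto
  from this[OF coords_enumerates(1)] show ?thesis
    by (simp add: multi_deriv_def coords_enumerates(2))
qed

lemma times_differentiable_partial:
  "times_differentiable m f \<Longrightarrow> j < m \<Longrightarrow> (partial_deriv i ^^ j) f differentiable (at x)"
proof (induction m arbitrary: f j)
  case (Suc m)
  then show ?case
    by (cases j) (auto simp: funpow_swap1 simp del: funpow.simps(2) intro: simp: funpow_Suc_right)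
qed simp

lemma holder_class_axis_smooth:
  fixes f :: "real^'d \<Rightarrow> real"
  assumes "f \<in> holder_class \<beta> L"
  shows "axis_smooth \<beta> L (strict_floor \<beta>) (axis i 1) (\<lambda>j. (partial_deriv i ^^ j) f) f"
proof -
  let ?m = "strict_floor \<beta>"
  let ?s = "\<lambda>k. if k = i then ?m else 0"
  have sum: "sum ?s UNIV = ?m"
    by (simp add: sum.delta)
  have holder: "\<forall>s. sum s UNIV = ?m \<longrightarrow> (\<forall>x y. \<bar>multi_deriv s f x - multi_deriv s f y\<bar>
      \<le> L * norm (x - y) powr (\<beta> - real ?m))"
    using assms by (simp add: holder_class_def)
  have "((\<lambda>t. (partial_deriv i ^^ j) f (x + t *\<^sub>R axis i 1)) has_real_derivative (partial_deriv i ^^ Suc j) f x) (at 0)"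
    if "j < ?m" for j x
  proof -
    let ?g = "(partial_deriv i ^^ j) f"
    have "?g differentiable (at (x + 0 *\<^sub>R axis i 1))"
      using assms that by (intro times_differentiable_partial) (auto simp: holder_class_def)
    moreover have "(\<lambda>t::real. x + t *\<^sub>R axis i 1) differentiable (at 0)"
      by (intro derivative_intros)
    ultimately have "(?g \<circ> (\<lambda>t::real. x + t *\<^sub>R axis i 1)) differentiable (at 0)"
      by (intro differentiable_chain_at) auto
    then have "((\<lambda>t. ?g (x + t *\<^sub>R axis i 1)) has_real_derivative deriv (\<lambda>t. ?g (x + t *\<^sub>R axis i 1)) 0) (at 0)"
      unfolding DERIV_deriv_iff_real_differentiable by (simp add: comp_def)
    then show ?thesis by (simp add: partial_deriv_def)
  qed
  moreover have "\<forall>x. x \<notin> unit_cube \<longrightarrow> f x = 0"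
    using assms unfolding holder_class_def cube_eq_unit_cube by blast
  ultimately show ?thesis
    using holder[THEN spec, of ?s] sum unfolding axis_smooth_def multi_deriv_single by simp
qed

section \<open>Moments of the rescaled kernel and the resulting bias\<close>

lemma kernel1_measurable [measurable]:
  assumes "cutoff_function \<psi>"
  shows "kernel1 \<psi> \<in> borel_measurable borel"
  unfolding kernel1_eq[abs_def] using assms by measurable

lemma kernel1_rapid_decay:
  assumes "cutoff_function \<psi>"
  obtains C where "0 < C" "\<And>s. \<bar>kernel1 \<psi> s\<bar> \<le> C / (1 + s\<^sup>2) ^ M"
  using fourier_kernel_rapid_decay[OF assms, of M]
  by (metis kernel1_eq abs_Re_le_cmod order_trans)

lemma kernel1_moments:
  assumes "cutoff_function \<psi>"
  shows "has_bochner_integral lborel (\<lambda>s. kernel1 \<psi> s * s ^ j) (if j = 0 then 1 else 0)"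
proof -
  have "has_bochner_integral lborel (\<lambda>s. Re (fourier_kernel \<psi> s * of_real s ^ j)) (Re (if j = 0 then 1 else 0))"
    using fourier_kernel_moments[OF assms, of j] by (intro has_bochner_integral_Re) (simp add: has_bochner_integral_iff)
  then show ?thesis
    by (simp add: kernel1_eq of_real_power[symmetric] if_distrib cong: if_cong del: of_real_power)
qed

lemma scaled_has_integral:
  fixes k \<phi> :: "real \<Rightarrow> real"
  assumes "0 < h" "has_bochner_integral lborel (\<lambda>u. k u * \<phi> (h * u)) I"
  shows "has_bochner_integral lborel (\<lambda>t. k (t / h) / h * \<phi> t) I"
proof -
  have "has_bochner_integral lborel (\<lambda>u. k (h * u / h) / h * \<phi> (h * u)) (I / h)"
    using has_bochner_integral_divide_zero[OF assms(2), of h] assms(1) by simp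
  then show ?thesis
    using assms(1) lborel_has_bochner_integral_real_affine_iff[of h "\<lambda>t. k (t / h) / h * \<phi> t" I 0]
    by (simp add: divide_inverse mult.commute)
qed

text \<open>After substituting t = h u, the bound 1 + (h u)^2 <= 1 + u^2 for h <= 1 makes
  \<open>M\<close> independent of h, and |h u|^\<beta> produces the factor h^\<beta>.\<close>

lemma scaled_moment_kernel:
  assumes \<psi>: "cutoff_function \<psi>" and \<beta>: "0 < \<beta>"
  obtains M A where "0 \<le> A" "\<And>h. 0 < h \<Longrightarrow> h \<le> 1 \<Longrightarrow>
    moment_kernel (\<lambda>t. kernel1 \<psi> (t / h) / h) m \<beta> M (A * h powr \<beta>)"
proof -
  let ?k = "kernel1 \<psi>"
  define p where "p = nat \<lceil>\<beta>\<rceil>"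
  have p: "\<beta> \<le> real p" using \<beta> by (simp add: p_def le_of_int_ceiling)
  \<comment> \<open>Of the p + 2 powers, p absorb |u|^\<beta>, one absorbs the weight 1 + u^2, and
    one is left for integrability.\<close>
  obtain C where C: "0 < C" "\<And>s. \<bar>?k s\<bar> \<le> C / (1 + s\<^sup>2) ^ (p + 2)"
    using kernel1_rapid_decay[OF \<psi>] by metis
  have pw: "\<bar>u\<bar> powr \<beta> \<le> (1 + u\<^sup>2) ^ p" for u :: real
  proof -
    have "\<bar>u\<bar> \<le> 1 + u\<^sup>2"
      using zero_le_power2[of "\<bar>u\<bar> - 1"] by (simp add: power2_eq_square algebra_simps)
    then have "\<bar>u\<bar> powr \<beta> \<le> (1 + u\<^sup>2) powr \<beta>"
      using \<beta> by (intro powr_mono2) auto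
    also have "\<dots> \<le> (1 + u\<^sup>2) powr real p"
      using p by (intro powr_mono) auto
    also have "\<dots> = (1 + u\<^sup>2) ^ p"
      by (rule powr_realpow[OF one_plus_square_pos])
    finally show ?thesis .
  qed
  have bnd: "\<bar>?k u\<bar> * (1 + u\<^sup>2) ^ Suc q \<le> C * (1 / (1 + u\<^sup>2))" if "q \<le> p" for q u
  proof -
    have one: "1 \<le> 1 + u\<^sup>2" by simp
    have "\<bar>?k u\<bar> * (1 + u\<^sup>2) ^ Suc q \<le> C / (1 + u\<^sup>2) ^ (p + 2) * (1 + u\<^sup>2) ^ Suc p"
      using that one C(1) by (intro mult_mono C(2) power_increasing) auto
    also have "\<dots> = C * (1 / (1 + u\<^sup>2))"
    proof -
      have "C / X ^ (p + 2) * X ^ Suc p = C * (1 / X)" if "0 < X" for X :: real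
        using that by (simp add: field_simps)
      then show ?thesis using one_plus_square_pos by blast
    qed
    finally show ?thesis .
  qed
  have int: "integrable lborel g" if "g \<in> borel_measurable borel" "\<And>u. \<bar>g u\<bar> \<le> C * (1 / (1 + u\<^sup>2))" for g :: "real \<Rightarrow> real"
  proof (rule Bochner_Integration.integrable_bound)
    show "integrable lborel (\<lambda>u::real. C * (1 / (1 + u\<^sup>2)))"
      by (intro integrable_mult_right integrable_inverse_1_plus_square)
    show "AE u in lborel. norm (g u) \<le> norm (C * (1 / (1 + u\<^sup>2)))"
      by (rule AE_I2) (metis that(2) abs_ge_self order_trans real_norm_def)
  qed (use that in simp)
  note [measurable] = kernel1_measurable[OF \<psi>]
  have i1: "integrable lborel (\<lambda>u. \<bar>?k u\<bar> * (1 + u\<^sup>2))"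
    using bnd[of 0] by (intro int) (auto simp: abs_mult)
  have w: "\<bar>?k u\<bar> * \<bar>u\<bar> powr \<beta> * (1 + u\<^sup>2) \<le> C * (1 / (1 + u\<^sup>2))" for u
  proof -
    have "\<bar>?k u\<bar> * \<bar>u\<bar> powr \<beta> * (1 + u\<^sup>2) \<le> \<bar>?k u\<bar> * (1 + u\<^sup>2) ^ p * (1 + u\<^sup>2)"
      by (intro mult_right_mono mult_left_mono pw) auto
    then show ?thesis using bnd[of p u] by (simp add: mult_ac)
  qed
  have i2: "integrable lborel (\<lambda>u. \<bar>?k u\<bar> * \<bar>u\<bar> powr \<beta> * (1 + u\<^sup>2))"
    using w by (intro int) (auto simp: abs_mult)
  define M where "M = max 1 (\<integral>u. \<bar>?k u\<bar> * (1 + u\<^sup>2) \<partial>lborel)"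
  define A where "A = (\<integral>u. \<bar>?k u\<bar> * \<bar>u\<bar> powr \<beta> * (1 + u\<^sup>2) \<partial>lborel)"
  have A0: "0 \<le> A" unfolding A_def by (intro integral_nonneg_AE AE_I2) auto
  show ?thesis
  proof (rule that[OF A0])
    fix h :: real assume h: "0 < h" "h \<le> 1"
    have hu: "(h * u)\<^sup>2 \<le> u\<^sup>2" for u
      using h by (simp add: power_mult_distrib mult_left_le_one_le power_le_one)
    have mom: "has_bochner_integral lborel (\<lambda>t. ?k (t / h) / h * t ^ j) (if j = 0 then 1 else 0)" for j
    proof (rule scaled_has_integral[OF h(1)])
      show "has_bochner_integral lborel (\<lambda>u. ?k u * (h * u) ^ j) (if j = 0 then 1 else 0)"
        using has_bochner_integral_mult_right[OF kernel1_moments[OF \<psi>, of j], of "h ^ j"]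
        by (cases "j = 0") (auto simp: power_mult_distrib mult_ac)
    qed
    have u1: "integrable lborel (\<lambda>u. \<bar>?k u\<bar> * (1 + (h * u)\<^sup>2))"
      by (rule Bochner_Integration.integrable_bound[OF i1]) (auto intro!: AE_I2 mult_left_mono hu)
    have u2: "integrable lborel (\<lambda>u. \<bar>?k u\<bar> * (\<bar>h * u\<bar> powr \<beta> * (1 + (h * u)\<^sup>2)))"
      and u3: "(\<integral>u. \<bar>?k u\<bar> * (\<bar>h * u\<bar> powr \<beta> * (1 + (h * u)\<^sup>2)) \<partial>lborel) \<le> A * h powr \<beta>"
    proof -
      have le: "\<bar>?k u\<bar> * (\<bar>h * u\<bar> powr \<beta> * (1 + (h * u)\<^sup>2)) \<le> h powr \<beta> * (\<bar>?k u\<bar> * \<bar>u\<bar> powr \<beta> * (1 + u\<^sup>2))" for u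
      proof -
        have "\<bar>?k u\<bar> * (\<bar>h * u\<bar> powr \<beta> * (1 + (h * u)\<^sup>2)) \<le> \<bar>?k u\<bar> * (\<bar>h * u\<bar> powr \<beta> * (1 + u\<^sup>2))"
          by (intro mult_left_mono add_left_mono hu) auto
        also have "\<dots> = h powr \<beta> * (\<bar>?k u\<bar> * \<bar>u\<bar> powr \<beta> * (1 + u\<^sup>2))"
          using h by (simp add: abs_mult powr_mult mult_ac)
        finally show ?thesis .
      qed
      have i2': "integrable lborel (\<lambda>u. h powr \<beta> * (\<bar>?k u\<bar> * \<bar>u\<bar> powr \<beta> * (1 + u\<^sup>2)))"
        using i2 by (rule integrable_mult_right)
      show 2: "integrable lborel (\<lambda>u. \<bar>?k u\<bar> * (\<bar>h * u\<bar> powr \<beta> * (1 + (h * u)\<^sup>2)))"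
      proof (rule Bochner_Integration.integrable_bound[OF i2'])
        show "AE u in lborel. norm (\<bar>?k u\<bar> * (\<bar>h * u\<bar> powr \<beta> * (1 + (h * u)\<^sup>2)))
            \<le> norm (h powr \<beta> * (\<bar>?k u\<bar> * \<bar>u\<bar> powr \<beta> * (1 + u\<^sup>2)))"
          using le by (intro AE_I2) (simp add: abs_mult)
      qed measurable
      show "(\<integral>u. \<bar>?k u\<bar> * (\<bar>h * u\<bar> powr \<beta> * (1 + (h * u)\<^sup>2)) \<partial>lborel) \<le> A * h powr \<beta>"
        using integral_mono[OF 2 i2' le] by (simp add: A_def mult.commute)
    qed
    have a: "\<bar>?k (t / h) / h\<bar> = \<bar>?k (t / h)\<bar> / h" for t
      using h by simp
    have m1: "has_bochner_integral lborel (\<lambda>t. \<bar>?k (t / h) / h\<bar> * (1 + t\<^sup>2)) (\<integral>u. \<bar>?k u\<bar> * (1 + (h * u)\<^sup>2) \<partial>lborel)"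
      unfolding a by (rule scaled_has_integral[OF h(1), of "\<lambda>u. \<bar>?k u\<bar>" "\<lambda>t. 1 + t\<^sup>2"]) (use u1 in \<open>simp add: has_bochner_integral_iff\<close>)
    have m2: "has_bochner_integral lborel (\<lambda>t. \<bar>?k (t / h) / h\<bar> * (\<bar>t\<bar> powr \<beta> * (1 + t\<^sup>2)))
        (\<integral>u. \<bar>?k u\<bar> * (\<bar>h * u\<bar> powr \<beta> * (1 + (h * u)\<^sup>2)) \<partial>lborel)"
      unfolding a by (rule scaled_has_integral[OF h(1), of "\<lambda>u. \<bar>?k u\<bar>" "\<lambda>t. \<bar>t\<bar> powr \<beta> * (1 + t\<^sup>2)"]) (use u2 in \<open>simp add: has_bochner_integral_iff\<close>)
    have m3: "(\<integral>u. \<bar>?k u\<bar> * (1 + (h * u)\<^sup>2) \<partial>lborel) \<le> M"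
    proof -
      have "(\<integral>u. \<bar>?k u\<bar> * (1 + (h * u)\<^sup>2) \<partial>lborel) \<le> (\<integral>u. \<bar>?k u\<bar> * (1 + u\<^sup>2) \<partial>lborel)"
        by (rule integral_mono[OF u1 i1]) (intro mult_left_mono add_left_mono hu, auto)
      then show ?thesis by (simp add: M_def)
    qed
    show "moment_kernel (\<lambda>t. ?k (t / h) / h) m \<beta> M (A * h powr \<beta>)"
    proof
      show "(\<integral>t. ?k (t / h) / h * t ^ j \<partial>lborel) = (if j = 0 then 1 else 0)"
        "integrable lborel (\<lambda>t. ?k (t / h) / h * t ^ j)" for j
        using mom[of j] by (auto simp: has_bochner_integral_iff)
      show "integrable lborel (\<lambda>t. \<bar>?k (t / h) / h\<bar> * (1 + t\<^sup>2))" "(\<integral>t. \<bar>?k (t / h) / h\<bar> * (1 + t\<^sup>2) \<partial>lborel) \<le> M"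
        using m1 m3 unfolding has_bochner_integral_iff by auto
      show "integrable lborel (\<lambda>t. \<bar>?k (t / h) / h\<bar> * \<bar>t\<bar> powr \<beta> * (1 + t\<^sup>2))"
        "(\<integral>t. \<bar>?k (t / h) / h\<bar> * \<bar>t\<bar> powr \<beta> * (1 + t\<^sup>2) \<partial>lborel) \<le> A * h powr \<beta>"
        using m2 u3 unfolding has_bochner_integral_iff mult.assoc by auto
    qed (auto simp: M_def)
  qed
qed

lemma scaled_product_kernel:
  "scaled_kernel (product_kernel \<psi>) h (x :: real^'d) = (\<Prod>i\<in>UNIV. kernel1 \<psi> (x $ i / h) / h)"
  by (simp add: scaled_kernel_def product_kernel_def prod_dividef)

lemma smoothing_bias:
  assumes \<psi>: "cutoff_function \<psi>" and \<beta>: "0 < \<beta>"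
  obtains C where "0 \<le> C" "\<And>L h f y. 0 < L \<Longrightarrow> 0 < h \<Longrightarrow> h \<le> 1 \<Longrightarrow> f \<in> holder_class \<beta> L \<Longrightarrow> f \<in> borel_measurable borel \<Longrightarrow>
    \<bar>(\<integral>x. scaled_kernel (product_kernel \<psi>) h (x - y) * f x \<partial>lborel) - f y\<bar> \<le> C * L * h powr \<beta> * poly_weight (y :: real^'d)"
proof -
  let ?m = "strict_floor \<beta>"
  obtain M A where A: "0 \<le> A" and K: "\<And>h. 0 < h \<Longrightarrow> h \<le> 1 \<Longrightarrow>
      moment_kernel (\<lambda>t. kernel1 \<psi> (t / h) / h) ?m \<beta> M (A * h powr \<beta>)"
    using scaled_moment_kernel[OF assms, of ?m] by metis
  define C where "C = DIM(real^'d) * (2 * M) ^ DIM(real^'d) * (2 * 2 ^ DIM(real^'d) * A)"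
  have "1 \<le> M"
    using moment_kernel.mass(3)[OF K[of 1]] by simp
  then have C0: "0 \<le> C" using A by (simp add: C_def)
  show ?thesis
  proof (rule that[OF C0])
    fix L h :: real and f :: "real^'d \<Rightarrow> real" and y
    assume L: "0 < L" and h: "0 < h" "h \<le> 1" and f: "f \<in> holder_class \<beta> L" "f \<in> borel_measurable borel"
    interpret moment_kernel "\<lambda>t. kernel1 \<psi> (t / h) / h" ?m \<beta> M "A * h powr \<beta>"
      by (rule K[OF h])
    have "\<exists>D. axis_smooth \<beta> L ?m b D f" if "b \<in> Basis" for b
      using that holder_class_axis_smooth[OF f(1)] unfolding real_vec_Basis by blast
    then obtain D where D: "\<And>b. b \<in> Basis \<Longrightarrow> axis_smooth \<beta> L ?m b (D b) f"
      by metis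
    have "\<bar>(\<integral>x. (\<Prod>b\<in>Basis. kernel1 \<psi> ((x - y) \<bullet> b / h) / h) * f x \<partial>lborel) - f y\<bar>
        \<le> DIM(real^'d) * (2 * M) ^ DIM(real^'d) * (2 * 2 ^ DIM(real^'d) * L * (A * h powr \<beta>) * poly_weight y)"
      by (rule product_kernel_bias[OF D _ _ strict_floor_greatest(1)[OF \<beta>] f(2)]) (use L A in auto)
    then show "\<bar>(\<integral>x. scaled_kernel (product_kernel \<psi>) h (x - y) * f x \<partial>lborel) - f y\<bar> \<le> C * L * h powr \<beta> * poly_weight y"
      unfolding scaled_product_kernel prod_Basis_vec[where g = "\<lambda>s. kernel1 \<psi> (s / h) / h"]
      by (simp add: C_def mult_ac)
  qed
qed

section \<open>Comparison of the coreset with the full sample\<close>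

lemma Im_lattice_kernel:
  assumes "cutoff_function \<psi>"
  shows "Im (lattice_kernel \<psi> \<delta> s) = 0"
proof -
  let ?f = "\<lambda>k::int. \<psi> (of_int k * \<delta>) * sin (of_int k * (\<delta> * s))"
  have "(\<Sum>k=-K..K. ?f k) = (\<Sum>k=-K..K. - ?f k)" for K
    by (rule sum.reindex_bij_witness[of _ uminus uminus]) (auto simp: cutoff_even[OF assms])
  then have "(\<Sum>k=-K..K. ?f k) = 0" for K
    by (simp add: sum_negf)
  then show ?thesis
    by (simp add: lattice_kernel_def)
qed

lemma fourier_kernel_real:
  assumes "cutoff_function \<psi>"
  shows "fourier_kernel \<psi> s = of_real (kernel1 \<psi> s)"
proof -
  have "(\<lambda>n. Im (lattice_kernel \<psi> ((1/2) ^ n) s)) \<longlonglongrightarrow> Im (fourier_kernel \<psi> s)"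
    by (intro tendsto_Im lattice_kernel_tendsto[OF assms _ _ half_power_seq]) (auto simp: power_le_one)
  then have "Im (fourier_kernel \<psi> s) = 0"
    by (simp only: Im_lattice_kernel[OF assms] LIMSEQ_const_iff)
  then show ?thesis by (simp add: kernel1_eq complex_eq_iff)
qed

text \<open>The step h pi/2 makes this 4-periodic in t: |t| <= 2 is one full period and corresponds
  to |s| <= pi/\<delta> in the unscaled variable s = t/h.\<close>

definition periodic_kernel :: "(real \<Rightarrow> real) \<Rightarrow> real \<Rightarrow> real \<Rightarrow> complex" where
  "periodic_kernel \<psi> h t = lattice_kernel \<psi> (h * (pi / 2)) (t / h) / of_real h"

lemma periodic_kernel_eq:
  assumes "0 < h"
  shows "\<exists>K c. (\<forall>t. periodic_kernel \<psi> h t = (\<Sum>k=-K..K. c k * cis (of_int k * (pi / 2) * t)))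
    \<and> (\<forall>k. c k \<noteq> 0 \<longrightarrow> \<psi> (of_int k * (h * (pi / 2))) \<noteq> 0)"
proof (intro exI conjI allI impI)
  let ?c = "\<lambda>k. of_real (h * (pi / 2) / (2 * pi)) * of_real (\<psi> (of_int k * (h * (pi / 2)))) / complex_of_real h"
  let ?K = "\<lceil>2 / (h * (pi / 2))\<rceil>"
  show "periodic_kernel \<psi> h t = (\<Sum>k=-?K..?K. ?c k * cis (of_int k * (pi / 2) * t))" for t
  proof -
    have "h * (pi / 2) * (t / h) = pi / 2 * t" using assms by simp
    then show ?thesis
      unfolding periodic_kernel_def lattice_kernel_def
      by (simp only: sum_distrib_left sum_divide_distrib) (simp only: mult_ac times_divide_eq_left times_divide_eq_right)
  qed
  show "\<psi> (of_int k * (h * (pi / 2))) \<noteq> 0" if "?c k \<noteq> 0" for k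
    using that by (metis mult_zero_right div_0 of_real_0)
qed

text \<open>Recentring at \<open>y\<close> multiplies both averages by the same phase.\<close>

lemma coreset_frequency_exact:
  assumes "caratheodory_coreset n T X S lam" "w \<in> frequencies T"
  shows "(\<Sum>j\<in>S. of_real (lam j) * exp (\<i> * of_real ((X j - y) \<bullet> w)))
    = 1 / of_nat n * (\<Sum>j=1..n. exp (\<i> * of_real ((X j - y) \<bullet> w)))"
proof -
  have e: "exp (\<i> * of_real ((X j - y) \<bullet> w)) = exp (\<i> * of_real (X j \<bullet> w)) * exp (- (\<i> * of_real (y \<bullet> w)))" for j
    by (simp add: exp_add[symmetric] inner_diff_left right_diff_distrib)
  have "1 / of_nat n * (\<Sum>j=1..n. exp (\<i> * of_real (X j \<bullet> w))) = (\<Sum>j\<in>S. of_real (lam j) * exp (\<i> * of_real (X j \<bullet> w)))"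
    using assms unfolding caratheodory_coreset_def by blast
  then have "(\<Sum>j\<in>S. of_real (lam j) * exp (\<i> * of_real (X j \<bullet> w))) * exp (- (\<i> * of_real (y \<bullet> w)))
      = 1 / of_nat n * (\<Sum>j=1..n. exp (\<i> * of_real (X j \<bullet> w))) * exp (- (\<i> * of_real (y \<bullet> w)))"
    by (simp only:)
  then show ?thesis
    by (simp only: e sum_distrib_right mult.assoc)
qed

text \<open>Multiplying out the product over coordinates gives a sum of characters with frequencies
  in the lattice. A nonzero coefficient forces every coordinate of its frequency below 2/h in
  modulus, by the support of \<psi>, so the coreset identity applies term by term.\<close>

lemma coreset_periodic_exact:
  fixes X :: "nat \<Rightarrow> real^'d"
  assumes "cutoff_function \<psi>" "0 < h" "2 / h \<le> T" "caratheodory_coreset n T X S lam"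
  shows "(\<Sum>j\<in>S. of_real (lam j) * (\<Prod>i\<in>UNIV. periodic_kernel \<psi> h ((X j - y) $ i)))
    = 1 / of_nat n * (\<Sum>j=1..n. \<Prod>i\<in>UNIV. periodic_kernel \<psi> h ((X j - y) $ i))"
proof -
  obtain K c where kc: "\<forall>t. periodic_kernel \<psi> h t = (\<Sum>k=-K..K. c k * cis (of_int k * (pi / 2) * t))"
    and cz: "\<forall>k. c k \<noteq> 0 \<longrightarrow> \<psi> (of_int k * (h * (pi / 2))) \<noteq> 0"
    using periodic_kernel_eq[OF assms(2), of \<psi>] by (elim exE conjE)
  define P where "P = PiE (UNIV :: 'd set) (\<lambda>_. {-K..K})"
  define w where "w k = (\<chi> i. pi / 2 * of_int (k i))" for k :: "'d \<Rightarrow> int"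
  define C where "C k = (\<Prod>i\<in>UNIV. c (k i))" for k :: "'d \<Rightarrow> int"
  have expand: "(\<Prod>i\<in>UNIV. periodic_kernel \<psi> h (z $ i)) = (\<Sum>k\<in>P. C k * exp (\<i> * of_real (z \<bullet> w k)))" for z :: "real^'d"
  proof -
    have e: "exp (\<i> * of_real (z \<bullet> w k)) = (\<Prod>i\<in>UNIV. cis (of_int (k i) * (pi / 2) * z $ i))" for k
      by (simp add: inner_vec_def w_def cis_conv_exp exp_sum sum_distrib_left mult_ac)
    have "(\<Prod>i\<in>UNIV. periodic_kernel \<psi> h (z $ i)) = (\<Sum>k\<in>P. \<Prod>i\<in>UNIV. c (k i) * cis (of_int (k i) * (pi / 2) * z $ i))"
      unfolding kc[rule_format] P_def by (rule prod_sum_PiE) auto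
    then show ?thesis
      by (simp only: e C_def prod.distrib)
  qed
  have zero_or: "C k = 0 \<or> w k \<in> frequencies T" for k
  proof (cases "C k = 0")
    case False
    have "\<bar>w k $ i\<bar> \<le> T" for i
    proof -
      have "c (k i) \<noteq> 0" using False by (auto simp: C_def)
      then have "\<bar>of_int (k i) * (h * (pi / 2))\<bar> < 2"
        using cz[rule_format, of "k i"] cutoff_eq_zero[OF assms(1), of "of_int (k i) * (h * (pi / 2))"] by linarith
      then have "\<bar>w k $ i\<bar> * h < 2"
        using assms(2) by (simp add: w_def abs_mult mult_ac)
      then have "\<bar>w k $ i\<bar> < 2 / h"
        using assms(2) by (simp add: pos_less_divide_eq)
      then show ?thesis using assms(3) by linarith
    qed
    then have "infnorm (w k) \<le> T"
      unfolding infnorm_Max by (intro Max.boundedI) (auto simp: real_vec_Basis inner_axis)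
    moreover have "\<exists>m::int. w k $ i = pi / 2 * of_int m" for i
      unfolding w_def vec_lambda_beta by blast
    ultimately show ?thesis
      by (simp add: frequencies_def)
  qed simp
  have "(\<Sum>j\<in>S. of_real (lam j) * (\<Prod>i\<in>UNIV. periodic_kernel \<psi> h ((X j - y) $ i)))
      = (\<Sum>k\<in>P. C k * (\<Sum>j\<in>S. of_real (lam j) * exp (\<i> * of_real ((X j - y) \<bullet> w k))))"
    unfolding expand sum_distrib_left by (subst sum.swap) (simp only: mult_ac)
  also have "\<dots> = (\<Sum>k\<in>P. C k * (1 / of_nat n * (\<Sum>j=1..n. exp (\<i> * of_real ((X j - y) \<bullet> w k)))))"
  proof (intro sum.cong refl)
    fix k
    show "C k * (\<Sum>j\<in>S. of_real (lam j) * exp (\<i> * of_real ((X j - y) \<bullet> w k)))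
        = C k * (1 / of_nat n * (\<Sum>j=1..n. exp (\<i> * of_real ((X j - y) \<bullet> w k))))"
    proof (cases "C k = 0")
      case False
      then have "w k \<in> frequencies T" using zero_or by blast
      then show ?thesis by (simp only: coreset_frequency_exact[OF assms(4)])
    qed simp
  qed
  also have "\<dots> = 1 / of_nat n * (\<Sum>j=1..n. \<Prod>i\<in>UNIV. periodic_kernel \<psi> h ((X j - y) $ i))"
    unfolding expand sum_distrib_left by (subst sum.swap) (simp only: mult_ac)
  finally show ?thesis .
qed

text \<open>Dividing all factors by \<open>a\<close> brings them into the unit disc, where the
  difference of products is at most the sum of the differences.\<close>

lemma norm_prod_diff_le:
  fixes z w :: "'i \<Rightarrow> complex"
  assumes "finite I" "0 < a" "\<And>i. i \<in> I \<Longrightarrow> norm (z i) \<le> a" "\<And>i. i \<in> I \<Longrightarrow> norm (w i) \<le> a"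
    and "\<And>i. i \<in> I \<Longrightarrow> norm (z i - w i) \<le> e"
  shows "norm (prod z I - prod w I) \<le> a ^ card I * (card I * (e / a))"
proof -
  have "prod z I - prod w I = of_real a ^ card I * ((\<Prod>i\<in>I. z i / of_real a) - (\<Prod>i\<in>I. w i / of_real a))"
    using assms(1,2) by (simp add: prod_dividef right_diff_distrib)
  then have "norm (prod z I - prod w I) = a ^ card I * norm ((\<Prod>i\<in>I. z i / of_real a) - (\<Prod>i\<in>I. w i / of_real a))"
    using assms(2) by (simp add: norm_mult norm_power)
  also have "\<dots> \<le> a ^ card I * (\<Sum>i\<in>I. norm (z i / of_real a - w i / of_real a))"
    using assms(2-4) by (intro mult_left_mono norm_prod_diff) (auto simp: norm_divide divide_le_eq)
  also have "\<dots> \<le> a ^ card I * (\<Sum>i\<in>I. e / a)"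
    using assms(2,5) by (intro mult_left_mono sum_mono)
      (auto simp: diff_divide_distrib[symmetric] norm_divide divide_right_mono)
  finally show ?thesis by simp
qed

lemma power_le_powr_nat_ceiling:
  assumes "0 < h" "h \<le> 1" "0 < \<beta>"
  shows "h ^ nat \<lceil>\<beta>\<rceil> \<le> h powr (\<beta>::real)"
proof -
  have "h powr real (nat \<lceil>\<beta>\<rceil>) \<le> h powr \<beta>"
    using assms by (intro powr_mono') (auto simp: le_of_int_ceiling)
  then show ?thesis by (simp only: powr_realpow[OF assms(1)])
qed

text \<open>On one period each factor is approximated to arbitrarily high order in h, which
  outweighs the singular normalisation of the product.\<close>

lemma periodic_kernel_close:
  assumes \<psi>: "cutoff_function \<psi>" and \<beta>: "0 < \<beta>"
  obtains C where "0 \<le> C" "\<And>h (z :: real^'d). 0 < h \<Longrightarrow> h \<le> 1 \<Longrightarrow> \<forall>i. \<bar>z $ i\<bar> \<le> 2 \<Longrightarrow>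
    norm ((\<Prod>i\<in>UNIV. periodic_kernel \<psi> h (z $ i)) - of_real (scaled_kernel (product_kernel \<psi>) h z)) \<le> C * h powr \<beta>"
proof -
  let ?d = "CARD('d)"
  \<comment> \<open>The \<open>?d\<close> extra orders cancel the factor h^(-d) of the rescaled
    product kernel.\<close>
  define N where "N = nat \<lceil>\<beta>\<rceil> + ?d"
  have N0: "0 < N" by (simp add: N_def)
  obtain A where A: "0 < A" "\<And>\<delta> s. 0 < \<delta> \<Longrightarrow> \<delta> \<le> 2 \<Longrightarrow> \<bar>s\<bar> \<le> pi / \<delta> \<Longrightarrow> norm (lattice_kernel \<psi> \<delta> s - fourier_kernel \<psi> s) \<le> A * \<delta> ^ N"
    using lattice_kernel_approx[OF \<psi> N0] by metis
  obtain B where B: "0 < B" "\<And>\<delta> s. 0 < \<delta> \<Longrightarrow> \<delta> \<le> 2 \<Longrightarrow> \<bar>s\<bar> \<le> pi / \<delta> \<Longrightarrow> norm (lattice_kernel \<psi> \<delta> s) \<le> B / (1 + s\<^sup>2) ^ 0"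
    using lattice_kernel_rapid_decay[OF \<psi>] by metis
  obtain D where D: "0 < D" "\<And>s. norm (fourier_kernel \<psi> s) \<le> D / (1 + s\<^sup>2) ^ 0"
    using fourier_kernel_rapid_decay[OF \<psi>] by metis
  define a where "a = B + D"
  show ?thesis
  proof (rule that[of "a ^ ?d * (?d * (A * 2 ^ N / a))"])
    show "0 \<le> a ^ ?d * (?d * (A * 2 ^ N / a))"
      using A B D by (simp add: a_def)
    fix h :: real and z :: "real^'d" assume h: "0 < h" "h \<le> 1" and z: "\<forall>i. \<bar>z $ i\<bar> \<le> 2"
    let ?\<delta> = "h * (pi / 2)"
    have \<delta>: "0 < ?\<delta>" "?\<delta> \<le> 2 * h" "?\<delta> \<le> 2"
    proof -
      show "0 < ?\<delta>" using h by simp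
      show "?\<delta> \<le> 2 * h" using h pi_less_4 by simp
      then show "?\<delta> \<le> 2" using h by linarith
    qed
    have s: "\<bar>z $ i / h\<bar> \<le> pi / ?\<delta>" for i
    proof -
      have "\<bar>z $ i\<bar> / h \<le> 2 / h" using z h by (intro divide_right_mono) auto
      then show ?thesis using h by (simp add: field_simps)
    qed
    have p: "norm (periodic_kernel \<psi> h (z $ i)) \<le> a / h" for i
      using B(2)[OF \<delta>(1,3) s, of i] D(1) h unfolding periodic_kernel_def a_def
      by (simp add: norm_divide divide_right_mono)
    have q: "norm (of_real (kernel1 \<psi> (z $ i / h) / h) :: complex) \<le> a / h" for i
      using D(2)[of "z $ i / h"] B(1) h unfolding fourier_kernel_real[OF \<psi>] a_def
      by (simp add: norm_divide divide_right_mono)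
    have r: "norm (periodic_kernel \<psi> h (z $ i) - of_real (kernel1 \<psi> (z $ i / h) / h)) \<le> A * 2 ^ N * h ^ N / h" for i
    proof -
      have "periodic_kernel \<psi> h (z $ i) - of_real (kernel1 \<psi> (z $ i / h) / h)
          = (lattice_kernel \<psi> ?\<delta> (z $ i / h) - fourier_kernel \<psi> (z $ i / h)) / of_real h"
        by (simp add: periodic_kernel_def fourier_kernel_real[OF \<psi>] diff_divide_distrib)
      then have "norm (periodic_kernel \<psi> h (z $ i) - of_real (kernel1 \<psi> (z $ i / h) / h)) \<le> A * ?\<delta> ^ N / h"
        using A(2)[OF \<delta>(1,3) s, of i] h by (simp add: norm_divide divide_right_mono)
      also have "\<dots> \<le> A * (2 * h) ^ N / h"
        using A(1) h \<delta> by (intro divide_right_mono mult_left_mono power_mono) auto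
      finally show ?thesis by (simp add: power_mult_distrib)
    qed
    have "norm ((\<Prod>i\<in>UNIV. periodic_kernel \<psi> h (z $ i)) - (\<Prod>i\<in>UNIV. of_real (kernel1 \<psi> (z $ i / h) / h)))
        \<le> (a / h) ^ ?d * (?d * (A * 2 ^ N * h ^ N / h / (a / h)))"
      by (rule norm_prod_diff_le) (use p q r B(1) D(1) h in \<open>auto simp: a_def\<close>)
    also have "\<dots> = a ^ ?d * (?d * (A * 2 ^ N / a)) * h ^ nat \<lceil>\<beta>\<rceil>"
      using h by (simp add: N_def power_add power_divide)
    also have "\<dots> \<le> a ^ ?d * (?d * (A * 2 ^ N / a)) * h powr \<beta>"
      using power_le_powr_nat_ceiling[OF h \<beta>] A B D by (intro mult_left_mono) (auto simp: a_def)
    finally show "norm ((\<Prod>i\<in>UNIV. periodic_kernel \<psi> h (z $ i)) - of_real (scaled_kernel (product_kernel \<psi>) h z))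
        \<le> a ^ ?d * (?d * (A * 2 ^ N / a)) * h powr \<beta>"
      by (simp add: scaled_product_kernel)
  qed
qed

text \<open>The coordinate of \<open>y\<close> beyond 3/2 lies at distance at least 1 from the cube;
  rapid decay in that single coordinate gives any power of h. All coordinates together supply the
  weight.\<close>

lemma scaled_kernel_tail:
  assumes \<psi>: "cutoff_function \<psi>" and \<beta>: "0 < \<beta>"
  obtains C where "0 \<le> C" "\<And>h (x :: real^'d) y i. 0 < h \<Longrightarrow> h \<le> 1 \<Longrightarrow> x \<in> unit_cube \<Longrightarrow> 3/2 < \<bar>y $ i\<bar> \<Longrightarrow>
    \<bar>scaled_kernel (product_kernel \<psi>) h (x - y)\<bar> \<le> C * h powr \<beta> * poly_weight y"
proof -
  let ?d = "CARD('d)"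
  \<comment> \<open>As in the approximation above, \<open>?d\<close> of these orders compensate
    h^(-d). The additional power in \<open>Suc p\<close> is kept for the weight.\<close>
  define p where "p = nat \<lceil>\<beta>\<rceil> + ?d"
  obtain A where A: "0 < A" "\<And>s. \<bar>kernel1 \<psi> s\<bar> \<le> A / (1 + s\<^sup>2) ^ Suc p"
    using kernel1_rapid_decay[OF \<psi>] by metis
  show ?thesis
  proof (rule that[of "(3 * A) ^ ?d"])
    show "0 \<le> (3 * A) ^ ?d" using A by simp
    fix h :: real and x y :: "real^'d" and i0
    assume h: "0 < h" "h \<le> 1" and x: "x \<in> unit_cube" and i0: "3/2 < \<bar>y $ i0\<bar>"
    have xi: "\<bar>x $ i\<bar> \<le> 1/2" for i
      using x unfolding real_vec_Basis by (auto simp: inner_axis)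
    \<comment> \<open>\<open>g\<close> records the gain: for |t| >= 1 and h <= 1 each factor 1/(1 +
      (t/h)^2) is at most h, and only coordinate \<open>i0\<close> is known to satisfy |t| >=
      1.\<close>
    define g where "g i = (if i = i0 then h ^ p else 1)" for i
    have one: "\<bar>kernel1 \<psi> ((x - y) $ i / h) / h\<bar> \<le> 3 * A / h * (1 / (1 + (y $ i)\<^sup>2)) * g i" for i
    proof -
      define t where "t = (x - y) $ i"
      have pos: "0 < 1 + t\<^sup>2" "0 < 1 + (t / h)\<^sup>2" by (rule one_plus_square_pos)+
      have th: "t\<^sup>2 \<le> (t / h)\<^sup>2"
        using h by (simp add: power_divide le_divide_eq mult_left_le power_le_one)
      have g: "1 / (1 + (t / h)\<^sup>2) ^ p \<le> g i"
      proof (cases "i = i0")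
        case True
        have "1 \<le> \<bar>t\<bar>" using i0 xi[of i0] True by (simp add: t_def)
        then have t1: "1 \<le> t\<^sup>2" using abs_le_square_iff[of 1 t] by simp
        have "1 / h \<le> 1 / h\<^sup>2"
          using h by (intro divide_left_mono) (auto simp: power2_eq_square mult_left_le)
        also have "\<dots> \<le> (t / h)\<^sup>2"
          using h t1 by (simp add: power_divide divide_right_mono)
        finally have "1 / h \<le> (t / h)\<^sup>2" .
        then have "1 / h \<le> 1 + (t / h)\<^sup>2" by linarith
        then have "1 / (1 + (t / h)\<^sup>2) \<le> h"
          using h pos by (simp add: field_simps)
        then have "(1 / (1 + (t / h)\<^sup>2)) ^ p \<le> h ^ p"
          using pos by (intro power_mono) auto
        then show ?thesis using True by (simp add: g_def power_divide)
      next
        case False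
        then show ?thesis using pos by (simp add: g_def one_le_power)
      qed
      have "1 / (1 + t\<^sup>2) \<le> 2 * (1 + (x $ i)\<^sup>2) * (1 / (1 + (y $ i)\<^sup>2))"
        using inverse_one_plus_square_shift[of "y $ i" "- (x $ i)"] by (simp add: t_def power2_commute)
      also have "\<dots> \<le> 3 * (1 / (1 + (y $ i)\<^sup>2))"
      proof (rule mult_right_mono)
        have "(x $ i)\<^sup>2 \<le> (1/2)\<^sup>2"
          using xi[of i] by (simp add: abs_le_square_iff[symmetric])
        then show "2 * (1 + (x $ i)\<^sup>2) \<le> 3" by (simp add: power2_eq_square)
      qed simp
      finally have y: "1 / (1 + t\<^sup>2) \<le> 3 * (1 / (1 + (y $ i)\<^sup>2))" .
      have "\<bar>kernel1 \<psi> (t / h)\<bar> \<le> A * (1 / (1 + (t / h)\<^sup>2) * (1 / (1 + (t / h)\<^sup>2) ^ p))"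
        using A(2)[of "t / h"] by simp
      also have "\<dots> \<le> A * (3 * (1 / (1 + (y $ i)\<^sup>2)) * g i)"
      proof (intro mult_left_mono mult_mono g)
        have "1 / (1 + (t / h)\<^sup>2) \<le> 1 / (1 + t\<^sup>2)"
          using th pos by (intro divide_left_mono) auto
        then show "1 / (1 + (t / h)\<^sup>2) \<le> 3 * (1 / (1 + (y $ i)\<^sup>2))" using y by linarith
      qed (use A in auto)
      finally have "\<bar>kernel1 \<psi> (t / h)\<bar> / h \<le> A * (3 * (1 / (1 + (y $ i)\<^sup>2)) * g i) / h"
        using h by (intro divide_right_mono) auto
      then show ?thesis using h by (simp add: t_def mult_ac)
    qed
    have "\<bar>scaled_kernel (product_kernel \<psi>) h (x - y)\<bar> \<le> (\<Prod>i\<in>UNIV. 3 * A / h * (1 / (1 + (y $ i)\<^sup>2)) * g i)"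
      unfolding scaled_product_kernel abs_prod using one by (intro prod_mono) auto
    also have "\<dots> = (3 * A / h) ^ ?d * poly_weight y * h ^ p"
      by (simp only: prod.distrib prod_constant poly_weight_def prod_Basis_vec[where g = "\<lambda>s. 1 / (1 + s\<^sup>2)"])
         (simp add: g_def prod.delta)
    also have "\<dots> = (3 * A) ^ ?d * h ^ nat \<lceil>\<beta>\<rceil> * poly_weight y"
      using h by (simp add: p_def power_add power_divide)
    also have "\<dots> \<le> (3 * A) ^ ?d * h powr \<beta> * poly_weight y"
      using power_le_powr_nat_ceiling[OF h \<beta>] A poly_weight_pos[of y] by (intro mult_right_mono mult_left_mono) auto
    finally show "\<bar>scaled_kernel (product_kernel \<psi>) h (x - y)\<bar> \<le> (3 * A) ^ ?d * h powr \<beta> * poly_weight y" .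
  qed
qed

lemma norm_convex_combination_le:
  fixes v :: "'i \<Rightarrow> 'b::real_normed_vector"
  assumes "\<And>j. j \<in> S \<Longrightarrow> 0 \<le> lam j" "sum lam S = (1::real)" "\<And>j. j \<in> S \<Longrightarrow> norm (v j) \<le> B"
  shows "norm (\<Sum>j\<in>S. lam j *\<^sub>R v j) \<le> B"
proof -
  have "norm (\<Sum>j\<in>S. lam j *\<^sub>R v j) \<le> (\<Sum>j\<in>S. lam j * B)"
    using assms by (intro sum_norm_le) (auto intro: mult_left_mono)
  then show ?thesis using assms(2) by (simp add: sum_distrib_right[symmetric])
qed

text \<open>If all coordinates of \<open>y\<close> are within 3/2, the kernel is replaced by the
  periodic one, on which both averages agree. Otherwise both averages are small separately, by the
  tail bound.\<close>

lemma coreset_close: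
  assumes \<psi>: "cutoff_function \<psi>" and \<beta>: "0 < \<beta>"
  obtains C where "0 \<le> C" "\<And>h T n (X :: nat \<Rightarrow> real^'d) S lam y. 0 < h \<Longrightarrow> h \<le> 1 \<Longrightarrow> 2 / h \<le> T \<Longrightarrow> 1 \<le> n \<Longrightarrow>
    caratheodory_coreset n T X S lam \<Longrightarrow> (\<And>j. j \<in> {1..n} \<Longrightarrow> X j \<in> unit_cube) \<Longrightarrow>
    \<bar>(\<Sum>j\<in>S. lam j * scaled_kernel (product_kernel \<psi>) h (X j - y))
      - (\<Sum>j=1..n. scaled_kernel (product_kernel \<psi>) h (X j - y)) / n\<bar> \<le> C * h powr \<beta> * poly_weight y"
proof (rule periodic_kernel_close[OF assms, where 'd = 'd], rule scaled_kernel_tail[OF assms, where 'd = 'd])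
  let ?d = "CARD('d)"
  fix A B :: real
  assume A: "0 \<le> A" "\<And>h (z :: real^'d). 0 < h \<Longrightarrow> h \<le> 1 \<Longrightarrow> \<forall>i. \<bar>z $ i\<bar> \<le> 2 \<Longrightarrow>
    norm ((\<Prod>i\<in>UNIV. periodic_kernel \<psi> h (z $ i)) - of_real (scaled_kernel (product_kernel \<psi>) h z)) \<le> A * h powr \<beta>"
  assume B: "0 \<le> B" "\<And>h (x :: real^'d) y i. 0 < h \<Longrightarrow> h \<le> 1 \<Longrightarrow> x \<in> unit_cube \<Longrightarrow> 3/2 < \<bar>y $ i\<bar> \<Longrightarrow>
    \<bar>scaled_kernel (product_kernel \<psi>) h (x - y)\<bar> \<le> B * h powr \<beta> * poly_weight y"
  show ?thesis
  proof (rule that[of "2 * (A * 4 ^ ?d + B)"])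
    show "0 \<le> 2 * (A * 4 ^ ?d + B)" using A B by simp
    fix h T :: real and n and X :: "nat \<Rightarrow> real^'d" and S lam y
    assume h: "0 < h" "h \<le> 1" and T: "2 / h \<le> T" and n: "1 \<le> n"
      and core: "caratheodory_coreset n T X S lam" and X: "\<And>j. j \<in> {1..n} \<Longrightarrow> X j \<in> unit_cube"
    let ?k = "\<lambda>j. scaled_kernel (product_kernel \<psi>) h (X j - y)"
    have S: "S \<subseteq> {1..n}" "\<And>j. j \<in> S \<Longrightarrow> 0 \<le> lam j" "sum lam S = 1"
      using core by (auto simp: caratheodory_coreset_def)
    \<comment> \<open>Both weight systems are convex, so a uniform bound on the terms passes to each
      average. Applied below to real kernel values and to complex deviations.\<close>
    have avg: "norm ((\<Sum>j\<in>S. lam j *\<^sub>R v j) - (\<Sum>j=1..n. (1 / n) *\<^sub>R v j)) \<le> 2 * E"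
      if v: "\<And>j. j \<in> {1..n} \<Longrightarrow> norm (v j) \<le> E" for v :: "nat \<Rightarrow> 'z::real_normed_vector" and E
    proof -
      have "norm (\<Sum>j\<in>S. lam j *\<^sub>R v j) \<le> E"
        by (rule norm_convex_combination_le[OF S(2,3)]) (use v S(1) in auto)
      moreover have "norm (\<Sum>j\<in>{1..n}. (1 / n) *\<^sub>R v j) \<le> E"
        by (rule norm_convex_combination_le) (use v n in auto)
      ultimately show ?thesis
        using norm_triangle_ineq4[of "\<Sum>j\<in>S. lam j *\<^sub>R v j" "\<Sum>j=1..n. (1 / n) *\<^sub>R v j"] by linarith
    qed
    have goal_eq: "(\<Sum>j\<in>S. lam j * ?k j) - (\<Sum>j=1..n. ?k j) / n = (\<Sum>j\<in>S. lam j *\<^sub>R ?k j) - (\<Sum>j=1..n. (1 / n) *\<^sub>R ?k j)"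
      by (simp add: sum_divide_distrib)
    have le: "2 * (A * h powr \<beta> * (4 ^ ?d * poly_weight y)) \<le> 2 * (A * 4 ^ ?d + B) * h powr \<beta> * poly_weight y"
      "2 * (B * h powr \<beta> * poly_weight y) \<le> 2 * (A * 4 ^ ?d + B) * h powr \<beta> * poly_weight y"
      using A(1) B(1) poly_weight_pos[of y] by (simp_all add: algebra_simps)
    show "\<bar>(\<Sum>j\<in>S. lam j * ?k j) - (\<Sum>j=1..n. ?k j) / n\<bar> \<le> 2 * (A * 4 ^ ?d + B) * h powr \<beta> * poly_weight y"
    proof (cases "\<exists>i. 3/2 < \<bar>y $ i\<bar>")
      case True
      then obtain i where i: "3/2 < \<bar>y $ i\<bar>" by blast
      have "norm (?k j) \<le> B * h powr \<beta> * poly_weight y" if "j \<in> {1..n}" for j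
        using B(2)[OF h X[OF that] i] by simp
      from avg[of ?k, OF this] show ?thesis
        unfolding goal_eq real_norm_def using le(2) by linarith
    next
      case False
      define Q where "Q j = (\<Prod>i\<in>UNIV. periodic_kernel \<psi> h ((X j - y) $ i))" for j
      define v where "v j = Q j - of_real (?k j)" for j
      have vb: "norm (v j) \<le> A * h powr \<beta>" if "j \<in> {1..n}" for j
        unfolding v_def Q_def
      proof (rule A(2)[OF h], rule allI)
        fix i
        have "\<bar>X j $ i\<bar> \<le> 1/2"
          using X[OF that] unfolding real_vec_Basis by (auto simp: inner_axis)
        moreover have "\<bar>y $ i\<bar> \<le> 3/2" using False by (auto simp: not_less)
        ultimately show "\<bar>(X j - y) $ i\<bar> \<le> 2" by simp
      qed
      have "(\<Sum>j\<in>S. lam j *\<^sub>R Q j) = (\<Sum>j=1..n. (1 / n) *\<^sub>R Q j)"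
        using coreset_periodic_exact[OF \<psi> h(1) T core, of y]
        by (simp add: Q_def scaleR_conv_of_real sum_distrib_left sum_divide_distrib)
      then have diff: "complex_of_real ((\<Sum>j\<in>S. lam j * ?k j) - (\<Sum>j=1..n. ?k j) / n)
          = - ((\<Sum>j\<in>S. lam j *\<^sub>R v j) - (\<Sum>j=1..n. (1 / n) *\<^sub>R v j))"
        unfolding v_def scaleR_diff_right sum_subtractf goal_eq
        by (simp add: scaleR_conv_of_real)
      have "\<bar>(\<Sum>j\<in>S. lam j * ?k j) - (\<Sum>j=1..n. ?k j) / n\<bar> = norm ((\<Sum>j\<in>S. lam j *\<^sub>R v j) - (\<Sum>j=1..n. (1 / n) *\<^sub>R v j))"
        unfolding norm_of_real[symmetric, where 'a = complex] diff norm_minus_cancel ..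
      also have "\<dots> \<le> 2 * (A * h powr \<beta>)"
        by (rule avg[OF vb])
      also have "\<dots> \<le> 2 * (A * h powr \<beta> * (4 ^ ?d * poly_weight y))"
      proof -
        \<comment> \<open>The factor 4 per coordinate comes from 1 + (3/2)^2 <= 4; the weight may be
          inserted because \<open>y\<close> is bounded here.\<close>
        have "(\<Prod>i\<in>(UNIV::'d set). 1 :: real) \<le> (\<Prod>i\<in>UNIV. 4 * (1 / (1 + (y $ i)\<^sup>2)))"
        proof (rule prod_mono, intro conjI)
          fix i
          have "\<bar>y $ i\<bar> \<le> 3/2" using False by (auto simp: not_less)
          then have "(y $ i)\<^sup>2 \<le> (3/2)\<^sup>2" by (simp add: abs_le_square_iff[symmetric])
          then show "1 \<le> 4 * (1 / (1 + (y $ i)\<^sup>2))"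
            using one_plus_square_pos[of "y $ i"] by (simp add: field_simps power2_eq_square)
        qed simp
        then have "1 \<le> 4 ^ ?d * poly_weight y"
          by (simp only: prod.distrib prod_constant power_one poly_weight_def prod_Basis_vec[where g = "\<lambda>s. 1 / (1 + s\<^sup>2)"])
        then have "A * h powr \<beta> * 1 \<le> A * h powr \<beta> * (4 ^ ?d * poly_weight y)"
          using A(1) by (intro mult_left_mono) auto
        then show ?thesis by simp
      qed
      finally show ?thesis using le(1) by linarith
    qed
  qed
qed

section \<open>Variance\<close>

text \<open>Independence in product form: the integrand is a product of one-coordinate functions,
  equal to 1 off \<open>i\<close> and \<open>j\<close>, so the integral factors.\<close>

lemma integral_PiM_pair:
  fixes Z :: "'a \<Rightarrow> real"
  assumes "prob_space N" "finite I" "i \<in> I" "j \<in> I" "integrable N Z" "integrable N (\<lambda>x. (Z x)\<^sup>2)"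
  shows "integrable (PiM I (\<lambda>_. N)) (\<lambda>X. Z (X i) * Z (X j))"
    and "(\<integral>X. Z (X i) * Z (X j) \<partial>PiM I (\<lambda>_. N)) = (if i = j then (\<integral>x. (Z x)\<^sup>2 \<partial>N) else (\<integral>x. Z x \<partial>N)\<^sup>2)"
proof -
  interpret N: prob_space N by fact
  interpret product_sigma_finite "\<lambda>_. N" by standard
  define g where "g l = (if i = j then if l = i then (\<lambda>x. (Z x)\<^sup>2) else (\<lambda>_. 1)
      else if l \<in> {i, j} then Z else (\<lambda>_. 1))" for l
  have prod: "Z (X i) * Z (X j) = (\<Prod>l\<in>I. g l (X l))" for X
  proof (cases "i = j")
    case True
    have "(\<Prod>l\<in>I. g l (X l)) = (\<Prod>l\<in>{i}. g l (X l))"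
      using assms(2,3) True by (intro prod.mono_neutral_right) (auto simp: g_def)
    then show ?thesis using True by (simp add: g_def power2_eq_square)
  next
    case False
    have "(\<Prod>l\<in>I. g l (X l)) = (\<Prod>l\<in>{i, j}. g l (X l))"
      using assms(2-4) False by (intro prod.mono_neutral_right) (auto simp: g_def)
    then show ?thesis using False by (simp add: g_def)
  qed
  have int: "integrable N (g l)" for l
    using assms(5,6) by (auto simp: g_def)
  show "integrable (PiM I (\<lambda>_. N)) (\<lambda>X. Z (X i) * Z (X j))"
    unfolding prod by (rule product_integrable_prod[OF assms(2) int])
  have "(\<integral>X. Z (X i) * Z (X j) \<partial>PiM I (\<lambda>_. N)) = (\<Prod>l\<in>I. integral\<^sup>L N (g l))"
    unfolding prod by (rule product_integral_prod[OF assms(2) int])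
  also have "\<dots> = (\<Prod>l\<in>{i, j}. integral\<^sup>L N (g l))"
    using assms(2-4) by (intro prod.mono_neutral_right) (auto simp: g_def N.prob_space)
  also have "\<dots> = (if i = j then (\<integral>x. (Z x)\<^sup>2 \<partial>N) else (\<integral>x. Z x \<partial>N)\<^sup>2)"
    by (auto simp: g_def power2_eq_square)
  finally show "(\<integral>X. Z (X i) * Z (X j) \<partial>PiM I (\<lambda>_. N)) = (if i = j then (\<integral>x. (Z x)\<^sup>2 \<partial>N) else (\<integral>x. Z x \<partial>N)\<^sup>2)" .
qed

text \<open>Centring kills the off-diagonal terms of the squared sum; the n diagonal ones are
  bounded by the second moment, by dropping the square of the mean.\<close>

lemma sample_mean_variance_le:
  fixes g :: "'a \<Rightarrow> real" and n :: nat
  assumes "prob_space N" "1 \<le> n" and [measurable]: "g \<in> borel_measurable N" and "\<And>x. \<bar>g x\<bar> \<le> B"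
  shows "(\<integral>\<^sup>+X. ennreal (((\<Sum>j=1..n. g (X j)) / n - (\<integral>x. g x \<partial>N))\<^sup>2) \<partial>PiM {1..n} (\<lambda>_. N))
    \<le> ennreal (1 / n) * (\<integral>\<^sup>+x. ennreal ((g x)\<^sup>2) \<partial>N)"
proof -
  interpret N: prob_space N by fact
  define \<mu> where "\<mu> = (\<integral>x. g x \<partial>N)"
  define Z where "Z x = g x - \<mu>" for x
  let ?P = "PiM {1..n} (\<lambda>_. N)"
  have g: "integrable N g"
    by (rule N.integrable_const_bound[where B = B]) (use assms(4) in auto)
  have B0: "0 \<le> B" using assms(4)[of undefined] by linarith
  have g2: "integrable N (\<lambda>x. (g x)\<^sup>2)"
  proof (rule N.integrable_const_bound[where B = "B\<^sup>2"])
    show "AE x in N. norm ((g x)\<^sup>2) \<le> B\<^sup>2"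
      using assms(4) B0 by (intro AE_I2) (simp add: abs_le_square_iff[symmetric])
  qed measurable
  have Z: "integrable N Z" "(\<integral>x. Z x \<partial>N) = 0"
    unfolding Z_def[abs_def] using g by (auto simp: \<mu>_def N.prob_space)
  have Z2': "(Z x)\<^sup>2 = (g x)\<^sup>2 - 2 * \<mu> * g x + \<mu>\<^sup>2" for x
    by (simp add: Z_def power2_diff algebra_simps)
  have Z2: "integrable N (\<lambda>x. (Z x)\<^sup>2)" "(\<integral>x. (Z x)\<^sup>2 \<partial>N) = (\<integral>x. (g x)\<^sup>2 \<partial>N) - \<mu>\<^sup>2"
    unfolding Z2' using g g2 by (auto simp: \<mu>_def[symmetric] N.prob_space power2_eq_square)
  have sq: "((\<Sum>j=1..n. g (X j)) / n - \<mu>)\<^sup>2 = (1 / n)\<^sup>2 * (\<Sum>i=1..n. \<Sum>j=1..n. Z (X i) * Z (X j))" for X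
  proof -
    have "(\<Sum>j=1..n. g (X j)) / n - \<mu> = 1 / n * (\<Sum>j=1..n. Z (X j))"
      using assms(2) by (simp add: Z_def sum_subtractf diff_divide_distrib)
    then show ?thesis
      by (simp only: power_mult_distrib power2_eq_square[of "\<Sum>j=1..n. Z (X j)"] sum_product)
  qed
  note pair = integral_PiM_pair[OF assms(1) finite_atLeastAtMost _ _ Z(1) Z2(1), of _ 1 n]
  have int: "integrable ?P (\<lambda>X. (1 / n)\<^sup>2 * (\<Sum>i=1..n. \<Sum>j=1..n. Z (X i) * Z (X j)))"
    by (intro integrable_mult_right Bochner_Integration.integrable_sum pair(1)) auto
  have "(\<integral>\<^sup>+X. ennreal (((\<Sum>j=1..n. g (X j)) / n - \<mu>)\<^sup>2) \<partial>?P)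
      = ennreal (\<integral>X. (1 / n)\<^sup>2 * (\<Sum>i=1..n. \<Sum>j=1..n. Z (X i) * Z (X j)) \<partial>?P)"
    unfolding sq by (rule nn_integral_eq_integral[OF int]) (metis (no_types, lifting) sq AE_I2 zero_le_power2)
  also have "(\<integral>X. (1 / n)\<^sup>2 * (\<Sum>i=1..n. \<Sum>j=1..n. Z (X i) * Z (X j)) \<partial>?P)
      = (1 / n)\<^sup>2 * (\<Sum>i=1..n. \<Sum>j=1..n. \<integral>X. Z (X i) * Z (X j) \<partial>?P)"
  proof -
    have "(\<integral>X. (\<Sum>i=1..n. \<Sum>j=1..n. Z (X i) * Z (X j)) \<partial>?P) = (\<Sum>i=1..n. \<integral>X. (\<Sum>j=1..n. Z (X i) * Z (X j)) \<partial>?P)"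
      by (intro Bochner_Integration.integral_sum Bochner_Integration.integrable_sum pair(1)) auto
    also have "\<dots> = (\<Sum>i=1..n. \<Sum>j=1..n. \<integral>X. Z (X i) * Z (X j) \<partial>?P)"
      by (intro sum.cong refl Bochner_Integration.integral_sum pair(1)) auto
    finally show ?thesis by simp
  qed
  also have "\<dots> = (1 / n)\<^sup>2 * (\<Sum>i=1..n. \<Sum>j=1..n. if i = j then (\<integral>x. (Z x)\<^sup>2 \<partial>N) else 0)"
  proof (intro arg_cong2[where f = "(*)"] refl sum.cong)
    fix i j assume "i \<in> {1..n}" "j \<in> {1..n}"
    then show "(\<integral>X. Z (X i) * Z (X j) \<partial>?P) = (if i = j then (\<integral>x. (Z x)\<^sup>2 \<partial>N) else 0)"
      using pair(2)[of i j] Z(2) by simp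
  qed
  also have "\<dots> = 1 / n * (\<integral>x. (Z x)\<^sup>2 \<partial>N)"
    using assms(2) by (simp add: sum.delta power2_eq_square)
  also have "ennreal \<dots> \<le> ennreal (1 / n * (\<integral>x. (g x)\<^sup>2 \<partial>N))"
    using Z2(2) by (intro ennreal_leI mult_left_mono) auto
  also have "\<dots> = ennreal (1 / n) * (\<integral>\<^sup>+x. ennreal ((g x)\<^sup>2) \<partial>N)"
    by (subst nn_integral_eq_integral[OF g2], simp, rule ennreal_mult) auto
  finally show ?thesis by (simp add: \<mu>_def)
qed

text \<open>Linear in the squared norm, so expectations can be taken directly; with \<open>a\<close>
  equal to the target rate nothing is lost but a constant.\<close>

lemma L2_norm_le_am_gm:
  assumes "0 < a"
  shows "L2_norm g \<le> ennreal (a / 2) + ennreal (1 / (2 * a)) * (\<integral>\<^sup>+y. ennreal ((g y)\<^sup>2) \<partial>lborel)"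
proof (cases "(\<integral>\<^sup>+y. ennreal ((g y)\<^sup>2) \<partial>lborel) = \<top>")
  case True
  then show ?thesis using assms by (simp add: ennreal_mult_top)
next
  case False
  then obtain r where r: "0 \<le> r" "(\<integral>\<^sup>+y. ennreal ((g y)\<^sup>2) \<partial>lborel) = ennreal r"
    by (metis ennreal_cases infinity_ennreal_def)
  have "sqrt r \<le> a / 2 + 1 / (2 * a) * r"
  proof -
    have "0 \<le> (sqrt r - a)\<^sup>2" by simp
    then have "2 * a * sqrt r \<le> r + a\<^sup>2"
      using r(1) by (simp add: power2_diff mult_ac)
    then show ?thesis using assms by (simp add: field_simps power2_eq_square)
  qed
  then have "ennreal (sqrt r) \<le> ennreal (a / 2 + 1 / (2 * a) * r)"
    by (rule ennreal_leI)
  also have "\<dots> = ennreal (a / 2) + ennreal (1 / (2 * a)) * ennreal r"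
    using assms r(1) by (simp add: ennreal_plus ennreal_mult[symmetric] del: times_divide_eq_left)
  finally show ?thesis using False r by (simp add: L2_norm_def Let_def)
qed

section \<open>Square integrals of the kernel and of the weight\<close>

lemma scaled_kernel_measurable [measurable]:
  assumes "cutoff_function \<psi>"
  shows "scaled_kernel (product_kernel \<psi>) h \<in> borel_measurable (borel :: (real^'d) measure)"
proof -
  note [measurable] = kernel1_measurable[OF assms]
  have "(\<lambda>x::real^'d. \<Prod>i\<in>UNIV. kernel1 \<psi> (x $ i / h) / h) \<in> borel_measurable borel"
    by measurable
  then show ?thesis by (simp add: scaled_product_kernel[abs_def])
qed

lemma scaled_kernel_bounded:
  assumes "cutoff_function \<psi>"
  shows "\<exists>B. \<forall>x::real^'d. \<bar>scaled_kernel (product_kernel \<psi>) h x\<bar> \<le> B"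
proof -
  obtain C where C: "0 < C" "\<And>s. \<bar>kernel1 \<psi> s\<bar> \<le> C / (1 + s\<^sup>2) ^ 0"
    using kernel1_rapid_decay[OF assms] by metis
  have "\<bar>scaled_kernel (product_kernel \<psi>) h x\<bar> \<le> (\<Prod>i\<in>(UNIV::'d set). C / \<bar>h\<bar>)" for x :: "real^'d"
    unfolding scaled_product_kernel abs_prod
    using C by (intro prod_mono) (auto intro: divide_right_mono)
  then show ?thesis by blast
qed

text \<open>Per coordinate, the square is at most the supremum, of order 1/h, times the absolute
  value, whose integral is bounded uniformly in h.\<close>

lemma scaled_kernel_square_integral:
  assumes \<psi>: "cutoff_function \<psi>"
  obtains V where "0 \<le> V" "\<And>h (x :: real^'d). 0 < h \<Longrightarrow> h \<le> 1 \<Longrightarrow>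
    (\<integral>\<^sup>+y. ennreal ((scaled_kernel (product_kernel \<psi>) h (x - y))\<^sup>2) \<partial>lborel) \<le> ennreal (V / h ^ CARD('d))"
proof -
  obtain C where C: "0 < C" "\<And>s. \<bar>kernel1 \<psi> s\<bar> \<le> C / (1 + s\<^sup>2) ^ 0"
    using kernel1_rapid_decay[OF \<psi>] by metis
  \<comment> \<open>An instance with m = 0 and exponent 1, taken for its mass bound
    \<open>M\<close>.\<close>
  obtain M A where K: "\<And>h. 0 < h \<Longrightarrow> h \<le> 1 \<Longrightarrow>
      moment_kernel (\<lambda>t. kernel1 \<psi> (t / h) / h) 0 1 M (A * h powr 1)"
    using scaled_moment_kernel[OF \<psi> zero_less_one, of 0] by metis
  note [measurable] = kernel1_measurable[OF \<psi>] scaled_kernel_measurable[OF \<psi>]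
  have M: "1 \<le> M" using moment_kernel.mass(3)[OF K[of 1]] by simp
  show ?thesis
  proof (rule that[of "(C * M) ^ CARD('d)"])
    show "0 \<le> (C * M) ^ CARD('d)" using C M by simp
    fix h :: real and x :: "real^'d" assume h: "0 < h" "h \<le> 1"
    let ?q = "\<lambda>t. kernel1 \<psi> (t / h) / h"
    interpret moment_kernel ?q 0 1 M "A * h powr 1" by (rule K[OF h])
    have one: "(\<integral>\<^sup>+t. ennreal ((?q t)\<^sup>2) \<partial>lborel) \<le> ennreal (C * M / h)"
    proof -
      have "(\<integral>\<^sup>+t. ennreal ((?q t)\<^sup>2) \<partial>lborel) \<le> (\<integral>\<^sup>+t. ennreal (C / h * (\<bar>?q t\<bar> * (1 + t\<^sup>2))) \<partial>lborel)"
      proof (intro nn_integral_mono ennreal_leI)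
        fix t
        have "(?q t)\<^sup>2 = \<bar>?q t\<bar> * \<bar>?q t\<bar>"
          by (simp add: power2_eq_square abs_mult[symmetric])
        also have "\<dots> \<le> C / h * (\<bar>?q t\<bar> * (1 + t\<^sup>2))"
        proof (rule mult_mono)
          show "\<bar>?q t\<bar> \<le> C / h" using C(2)[of "t / h"] h by (simp add: divide_right_mono)
          have "\<bar>?q t\<bar> * 1 \<le> \<bar>?q t\<bar> * (1 + t\<^sup>2)" by (rule mult_left_mono) auto
          then show "\<bar>?q t\<bar> \<le> \<bar>?q t\<bar> * (1 + t\<^sup>2)" by (simp only: mult_1_right)
        qed (use C h in auto)
        finally show "(?q t)\<^sup>2 \<le> C / h * (\<bar>?q t\<bar> * (1 + t\<^sup>2))" .
      qed
      also have "\<dots> = ennreal (\<integral>t. C / h * (\<bar>?q t\<bar> * (1 + t\<^sup>2)) \<partial>lborel)"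
        using C h by (intro nn_integral_eq_integral integrable_mult_right mass(1)) auto
      also have "\<dots> \<le> ennreal (C / h * M)"
        using C h mass(2) by (intro ennreal_leI) (simp add: divide_right_mono mult_left_mono del: times_divide_eq_left)
      finally show ?thesis by simp
    qed
    have "(\<integral>\<^sup>+y. ennreal ((scaled_kernel (product_kernel \<psi>) h (x - y))\<^sup>2) \<partial>lborel)
        = (\<integral>\<^sup>+z. ennreal ((scaled_kernel (product_kernel \<psi>) h z)\<^sup>2) \<partial>distr lborel borel (\<lambda>y. x - y))"
      by (subst nn_integral_distr) auto
    also have "distr lborel borel (\<lambda>y. x - y) = lborel"
      using lborel_affine[of "-1" x] by (simp add: density_1)
    also have "(\<integral>\<^sup>+z. ennreal ((scaled_kernel (product_kernel \<psi>) h (z :: real^'d))\<^sup>2) \<partial>lborel)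
        = (\<integral>\<^sup>+z. (\<Prod>b\<in>Basis. ennreal ((?q ((z :: real^'d) \<bullet> b))\<^sup>2)) \<partial>lborel)"
      by (simp only: scaled_product_kernel prod_Basis_vec[where g = "\<lambda>s. ennreal ((?q s)\<^sup>2)"] prod_power_distrib[symmetric])
         (simp add: prod_ennreal prod_power_distrib del: power_divide)
    also have "\<dots> = (\<Prod>b\<in>(Basis :: (real^'d) set). \<integral>\<^sup>+t. ennreal ((?q t)\<^sup>2) \<partial>lborel)"
      by (rule nn_integral_lborel_prod) auto
    also have "\<dots> \<le> (\<Prod>b\<in>(Basis :: (real^'d) set). ennreal (C * M / h))"
      by (intro prod_mono_ennreal one)
    also have "\<dots> = ennreal ((C * M) ^ CARD('d) / h ^ CARD('d))"
      using C M h by (simp add: ennreal_power power_divide)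
    finally show "(\<integral>\<^sup>+y. ennreal ((scaled_kernel (product_kernel \<psi>) h (x - y))\<^sup>2) \<partial>lborel) \<le> ennreal ((C * M) ^ CARD('d) / h ^ CARD('d))" .
  qed
qed

lemma poly_weight_square_integral:
  obtains w where "0 \<le> w" "(\<integral>\<^sup>+y. ennreal ((poly_weight (y :: 'a::euclidean_space))\<^sup>2) \<partial>lborel) \<le> ennreal w"
proof
  let ?e = "\<lambda>t::real. 1 / (1 + t\<^sup>2)"
  show "0 \<le> integral\<^sup>L lborel ?e ^ DIM('a)"
    by (intro zero_le_power integral_nonneg_AE AE_I2) auto
  have "(\<integral>\<^sup>+y. ennreal ((poly_weight (y :: 'a))\<^sup>2) \<partial>lborel) \<le> (\<integral>\<^sup>+y. (\<Prod>b\<in>(Basis :: 'a set). ennreal (?e (y \<bullet> b))) \<partial>lborel)"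
  proof (rule nn_integral_mono)
    fix y :: 'a
    have "poly_weight y \<le> 1"
      unfolding poly_weight_def by (rule prod_le_1) (use one_plus_square_pos in \<open>auto simp: divide_le_eq\<close>)
    then have "(poly_weight y)\<^sup>2 \<le> poly_weight y"
      using poly_weight_pos[of y] by (simp add: power2_eq_square mult_left_le)
    then have "ennreal ((poly_weight y)\<^sup>2) \<le> ennreal (poly_weight y)"
      by (rule ennreal_leI)
    then show "ennreal ((poly_weight y)\<^sup>2) \<le> (\<Prod>b\<in>Basis. ennreal (?e (y \<bullet> b)))"
      by (simp add: poly_weight_def prod_ennreal)
  qed
  also have "\<dots> = (\<Prod>b\<in>(Basis :: 'a set). \<integral>\<^sup>+t. ennreal (?e t) \<partial>lborel)"
    by (rule nn_integral_lborel_prod) auto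
  also have "(\<integral>\<^sup>+t. ennreal (?e t) \<partial>lborel) = ennreal (integral\<^sup>L lborel ?e)"
    by (intro nn_integral_eq_integral integrable_inverse_1_plus_square) auto
  also have "(\<Prod>b\<in>(Basis :: 'a set). ennreal (integral\<^sup>L lborel ?e)) = ennreal (integral\<^sup>L lborel ?e ^ DIM('a))"
    by (simp add: ennreal_power integral_nonneg_AE)
  finally show "(\<integral>\<^sup>+y. ennreal ((poly_weight (y :: 'a))\<^sup>2) \<partial>lborel) \<le> ennreal (integral\<^sup>L lborel ?e ^ DIM('a))" .
qed

lemma holder_densities_prob_space:
  fixes f :: "real^'d \<Rightarrow> real"
  assumes "f \<in> holder_densities \<beta> L"
  shows "prob_space (density lborel (\<lambda>x. ennreal (f x)))"
    and "AE x in density lborel (\<lambda>x. ennreal (f x)). x \<in> unit_cube"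
proof -
  have [measurable]: "f \<in> borel_measurable borel" and f1: "(\<integral>\<^sup>+x. ennreal (f x) \<partial>lborel) = 1"
    using assms by (auto simp: holder_densities_def)
  have f0: "\<forall>x. x \<notin> unit_cube \<longrightarrow> f x = 0"
    using assms unfolding holder_densities_def holder_class_def cube_eq_unit_cube by blast
  show "prob_space (density lborel (\<lambda>x. ennreal (f x)))"
    by (rule prob_spaceI) (simp add: emeasure_density f1)
  show "AE x in density lborel (\<lambda>x. ennreal (f x)). x \<in> unit_cube"
    by (subst AE_density) (use f0 in force)+
qed

text \<open>Tonelli twice: first to use the variance bound at fixed \<open>y\<close>, then to
  integrate the squared kernel over \<open>y\<close> first, where the bound \<open>V\<close> is
  uniform in \<open>x\<close>. The density is then only integrated to 1.\<close>

lemma integrated_variance_le: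
  fixes f :: "real^'d \<Rightarrow> real" and k :: "real^'d \<Rightarrow> real"
  assumes N: "prob_space (density lborel (\<lambda>x. ennreal (f x)))" and f [measurable]: "f \<in> borel_measurable borel" "\<And>x. 0 \<le> f x"
    and k [measurable]: "k \<in> borel_measurable borel" and B: "\<And>x. \<bar>k x\<bar> \<le> B"
    and V: "\<And>x. (\<integral>\<^sup>+y. ennreal ((k (x - y))\<^sup>2) \<partial>lborel) \<le> V" and n: "1 \<le> (n::nat)"
  shows "(\<integral>\<^sup>+X. (\<integral>\<^sup>+y. ennreal (((\<Sum>j=1..n. k (X j - y)) / n - (\<integral>x. k (x - y) * f x \<partial>lborel))\<^sup>2) \<partial>lborel)
      \<partial>PiM {1..n} (\<lambda>_. density lborel (\<lambda>x. ennreal (f x)))) \<le> ennreal (1 / n) * V"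
    and "(\<lambda>X. \<integral>\<^sup>+y. ennreal (((\<Sum>j=1..n. k (X j - y)) / n - (\<integral>x. k (x - y) * f x \<partial>lborel))\<^sup>2) \<partial>lborel)
      \<in> borel_measurable (PiM {1..n} (\<lambda>_. density lborel (\<lambda>x. ennreal (f x))))"
proof -
  let ?N = "density lborel (\<lambda>x. ennreal (f x))"
  let ?P = "PiM {1..n} (\<lambda>_. ?N)"
  interpret N: prob_space ?N by (rule N)
  interpret P: prob_space ?P by (rule prob_space_PiM) (rule N)
  interpret pair_sigma_finite ?P "lborel :: (real^'d) measure" by standard
  interpret NL: pair_sigma_finite ?N "lborel :: (real^'d) measure" by standard
  define \<mu> where "\<mu> y = (\<integral>x. k (x - y) * f x \<partial>lborel)" for y
  have [measurable]: "\<mu> \<in> borel_measurable borel"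
    unfolding \<mu>_def[abs_def] by measurable
  have \<mu>N: "\<mu> y = (\<integral>x. k (x - y) \<partial>?N)" for y
    by (subst integral_density) (use f(2) in \<open>auto simp: \<mu>_def mult.commute\<close>)
  have comp [measurable]: "(\<lambda>z. fst z j) \<in> borel_measurable (?P \<Otimes>\<^sub>M lborel)" if "j \<in> {1..n}" for j
  proof -
    have "(\<lambda>z. fst z j) \<in> measurable (?P \<Otimes>\<^sub>M lborel) ?N"
      by (rule measurable_compose[OF measurable_fst measurable_component_singleton[OF that]])
    also have "measurable (?P \<Otimes>\<^sub>M lborel) ?N = borel_measurable (?P \<Otimes>\<^sub>M lborel)"
      by (rule measurable_cong_sets) auto
    finally show ?thesis .
  qed
  have meas: "(\<lambda>(X, y). ennreal (((\<Sum>j=1..n. k (X j - y)) / n - \<mu> y)\<^sup>2)) \<in> borel_measurable (?P \<Otimes>\<^sub>M lborel)"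
    unfolding case_prod_beta by measurable
  have "(\<integral>\<^sup>+X. (\<integral>\<^sup>+y. ennreal (((\<Sum>j=1..n. k (X j - y)) / n - \<mu> y)\<^sup>2) \<partial>lborel) \<partial>?P)
      = (\<integral>\<^sup>+y. (\<integral>\<^sup>+X. ennreal (((\<Sum>j=1..n. k (X j - y)) / n - \<mu> y)\<^sup>2) \<partial>?P) \<partial>lborel)"
    using Fubini'[OF meas] by simp
  also have "\<dots> \<le> (\<integral>\<^sup>+y. ennreal (1 / n) * (\<integral>\<^sup>+x. ennreal ((k (x - y))\<^sup>2) \<partial>?N) \<partial>lborel)"
    unfolding \<mu>N by (intro nn_integral_mono sample_mean_variance_le[OF N n _ B]) measurable
  also have "\<dots> = ennreal (1 / n) * (\<integral>\<^sup>+y. (\<integral>\<^sup>+x. ennreal ((k (x - y))\<^sup>2) \<partial>?N) \<partial>lborel)"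
    by (rule nn_integral_cmult) measurable
  also have "(\<integral>\<^sup>+y. (\<integral>\<^sup>+x. ennreal ((k (x - y))\<^sup>2) \<partial>?N) \<partial>lborel) = (\<integral>\<^sup>+x. (\<integral>\<^sup>+y. ennreal ((k (x - y))\<^sup>2) \<partial>lborel) \<partial>?N)"
    by (rule NL.Fubini') measurable
  also have "\<dots> \<le> (\<integral>\<^sup>+x. V \<partial>?N)"
    by (intro nn_integral_mono V)
  also have "\<dots> = V"
    using N.emeasure_space_1 by simp
  finally show "(\<integral>\<^sup>+X. (\<integral>\<^sup>+y. ennreal (((\<Sum>j=1..n. k (X j - y)) / n - \<mu> y)\<^sup>2) \<partial>lborel) \<partial>?P) \<le> ennreal (1 / n) * V"
    by (simp add: mult_left_mono)
  show "(\<lambda>X. \<integral>\<^sup>+y. ennreal (((\<Sum>j=1..n. k (X j - y)) / n - \<mu> y)\<^sup>2) \<partial>lborel) \<in> borel_measurable ?P"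
    using lborel.borel_measurable_nn_integral_fst[OF meas] by simp
qed

lemma square_sum_le: "(x + y)\<^sup>2 \<le> 2 * x\<^sup>2 + 2 * (y::real)\<^sup>2"
  using zero_le_power2[of "x - y"] by (simp add: power2_eq_square algebra_simps)

text \<open>\<open>\<Phi>\<close> is the centred stochastic part, small only on average; all other
  errors are below c a times the weight for almost every sample. With rate \<open>a\<close> the
  bound is a/2 + (2 V a^2 + 2 c^2 a^2 w)/(2a), a multiple of \<open>a\<close>.\<close>

lemma risk_le_variance_bias:
  fixes f :: "real^'d \<Rightarrow> real" and n :: nat and \<Phi> :: "(nat \<Rightarrow> real^'d) \<Rightarrow> real^'d \<Rightarrow> real"
  defines "P \<equiv> PiM {1..n} (\<lambda>_. density lborel (\<lambda>x. ennreal (f x)))"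
  assumes P: "prob_space P" and a: "0 < a" and V: "0 \<le> V" and w: "0 \<le> w"
    and \<Phi>: "\<And>X. (\<lambda>y. \<Phi> X y) \<in> borel_measurable borel"
    and \<Phi>2 [measurable]: "(\<lambda>X. \<integral>\<^sup>+y. ennreal ((\<Phi> X y)\<^sup>2) \<partial>lborel) \<in> borel_measurable P"
    and var: "(\<integral>\<^sup>+X. (\<integral>\<^sup>+y. ennreal ((\<Phi> X y)\<^sup>2) \<partial>lborel) \<partial>P) \<le> ennreal (V * a\<^sup>2)"
    and err: "AE X in P. \<forall>y. \<bar>g X y - f y - \<Phi> X y\<bar> \<le> c * a * poly_weight y"
    and wint: "(\<integral>\<^sup>+y. ennreal ((poly_weight (y :: real^'d))\<^sup>2) \<partial>lborel) \<le> ennreal w"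
  shows "risk n g f \<le> ennreal ((1 / 2 + V + c\<^sup>2 * w) * a)"
proof -
  interpret P: prob_space P by (rule P)
  note [measurable] = \<Phi>
  let ?V = "\<lambda>X. \<integral>\<^sup>+y. ennreal ((\<Phi> X y)\<^sup>2) \<partial>lborel"
  have point: "L2_norm (\<lambda>y. g X y - f y) \<le> ennreal (a / 2) + ennreal (1 / (2 * a)) * (2 * ?V X + ennreal (2 * c\<^sup>2 * a\<^sup>2 * w))"
    if "\<forall>y. \<bar>g X y - f y - \<Phi> X y\<bar> \<le> c * a * poly_weight y" for X
  proof -
    have "(\<integral>\<^sup>+y. ennreal ((g X y - f y)\<^sup>2) \<partial>lborel)
        \<le> (\<integral>\<^sup>+y. 2 * ennreal ((\<Phi> X y)\<^sup>2) + ennreal (2 * c\<^sup>2 * a\<^sup>2) * ennreal ((poly_weight y)\<^sup>2) \<partial>lborel)"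
    proof (rule nn_integral_mono)
      fix y
      have "(g X y - f y)\<^sup>2 \<le> 2 * (\<Phi> X y)\<^sup>2 + 2 * (g X y - f y - \<Phi> X y)\<^sup>2"
        using square_sum_le[of "\<Phi> X y" "g X y - f y - \<Phi> X y"] by simp
      also have "(g X y - f y - \<Phi> X y)\<^sup>2 \<le> (c * a * poly_weight y)\<^sup>2"
        using that power_mono[of "\<bar>g X y - f y - \<Phi> X y\<bar>" "c * a * poly_weight y" 2] by simp
      finally have "(g X y - f y)\<^sup>2 \<le> 2 * (\<Phi> X y)\<^sup>2 + 2 * c\<^sup>2 * a\<^sup>2 * (poly_weight y)\<^sup>2"
        by (simp add: power_mult_distrib)
      then have "ennreal ((g X y - f y)\<^sup>2) \<le> ennreal (2 * (\<Phi> X y)\<^sup>2 + 2 * c\<^sup>2 * a\<^sup>2 * (poly_weight y)\<^sup>2)"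
        by (rule ennreal_leI)
      then show "ennreal ((g X y - f y)\<^sup>2) \<le> 2 * ennreal ((\<Phi> X y)\<^sup>2) + ennreal (2 * c\<^sup>2 * a\<^sup>2) * ennreal ((poly_weight y)\<^sup>2)"
        by (simp add: ennreal_plus ennreal_mult)
    qed
    also have "\<dots> = 2 * ?V X + ennreal (2 * c\<^sup>2 * a\<^sup>2) * (\<integral>\<^sup>+y. ennreal ((poly_weight (y :: real^'d))\<^sup>2) \<partial>lborel)"
      by (subst nn_integral_add) (auto simp: nn_integral_cmult)
    also have "\<dots> \<le> 2 * ?V X + ennreal (2 * c\<^sup>2 * a\<^sup>2) * ennreal w"
      by (intro add_left_mono mult_left_mono wint) auto
    also have "ennreal (2 * c\<^sup>2 * a\<^sup>2) * ennreal w = ennreal (2 * c\<^sup>2 * a\<^sup>2 * w)"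
      using w by (simp add: ennreal_mult)
    finally show ?thesis
      using L2_norm_le_am_gm[OF a, of "\<lambda>y. g X y - f y"]
      by (meson add_left_mono mult_left_mono order_trans zero_le)
  qed
  have "risk n g f = (\<integral>\<^sup>+X. L2_norm (\<lambda>y. g X y - f y) \<partial>P)"
    by (simp add: risk_def P_def)
  also have "\<dots> \<le> (\<integral>\<^sup>+X. ennreal (a / 2) + ennreal (1 / (2 * a)) * (2 * ?V X + ennreal (2 * c\<^sup>2 * a\<^sup>2 * w)) \<partial>P)"
    by (rule nn_integral_mono_AE) (use err point in \<open>auto elim: eventually_mono\<close>)
  also have "\<dots> = ennreal (a / 2) + ennreal (1 / (2 * a)) * (2 * (\<integral>\<^sup>+X. ?V X \<partial>P) + ennreal (2 * c\<^sup>2 * a\<^sup>2 * w))"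
    by (simp add: nn_integral_add nn_integral_cmult P.emeasure_space_1)
  also have "\<dots> \<le> ennreal (a / 2) + ennreal (1 / (2 * a)) * (2 * ennreal (V * a\<^sup>2) + ennreal (2 * c\<^sup>2 * a\<^sup>2 * w))"
    by (intro add_mono mult_left_mono var order_refl) auto
  also have "\<dots> = ennreal (a / 2 + 1 / (2 * a) * (2 * (V * a\<^sup>2) + 2 * c\<^sup>2 * a\<^sup>2 * w))"
    using a V w by (simp add: ennreal_plus[symmetric] ennreal_mult[symmetric] ennreal_numeral[symmetric] del: ennreal_plus ennreal_numeral)
  also have "a / 2 + 1 / (2 * a) * (2 * (V * a\<^sup>2) + 2 * c\<^sup>2 * a\<^sup>2 * w) = (1 / 2 + V + c\<^sup>2 * w) * a"
    using a by (simp add: field_simps power2_eq_square)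
  finally show ?thesis .
qed

section \<open>Rates\<close>

text \<open>The bandwidth balances the bias h^\<beta> = a against the variance 1/(n h^d) =
  a^2.\<close>

lemma rate_identities:
  fixes \<beta> d :: real
  assumes "0 < \<beta>" "0 \<le> d" "1 \<le> (n::nat)"
  defines "h \<equiv> real n powr (- 1 / (2 * \<beta> + d))" and "a \<equiv> real n powr (- \<beta> / (2 * \<beta> + d))"
  shows "0 < h" "h \<le> 1" "0 < a" "h powr \<beta> = a" "1 / n / h powr d = a\<^sup>2"
    and "1 / h = real n powr (1 / (2 * \<beta> + d))"
proof -
  have n: "0 < real n" "1 \<le> real n" and s: "0 < 2 * \<beta> + d" using assms by auto
  show "0 < h" "0 < a" using n by (auto simp: h_def a_def)
  show "h \<le> 1"
    unfolding h_def using powr_mono[of "- 1 / (2 * \<beta> + d)" 0 "real n"] n s by simp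
  show "h powr \<beta> = a"
    by (simp add: h_def a_def powr_powr)
  show "1 / h = real n powr (1 / (2 * \<beta> + d))"
    by (simp add: h_def powr_minus_divide)
  have "h powr d = real n powr (- d / (2 * \<beta> + d))"
    by (simp add: h_def powr_powr)
  then have "1 / n / h powr d = real n powr (- 1) / real n powr (- d / (2 * \<beta> + d))"
    using n by (simp add: powr_minus_divide)
  also have "\<dots> = real n powr (- 1 - - d / (2 * \<beta> + d))"
    by (rule powr_diff[symmetric])
  also have "- 1 - - d / (2 * \<beta> + d) = - (2 * \<beta>) / (2 * \<beta> + d)"
    using s by (simp add: field_simps)
  also have "\<dots> = - \<beta> / (2 * \<beta> + d) + - \<beta> / (2 * \<beta> + d)"
    by (simp add: add_divide_distrib[symmetric])
  also have "real n powr \<dots> = a\<^sup>2"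
    unfolding a_def power2_eq_square by (rule powr_add)
  finally show "1 / n / h powr d = a\<^sup>2" .
qed

text \<open>The error splits into coreset estimator minus kernel density estimator
  (\<open>C1\<close>), the centred kernel density estimator \<open>\<Phi>\<close>, and smoothing
  bias (\<open>C2\<close>). Only the bias involves \<open>L\<close>, linearly, which gives
  \<open>cR\<close> its form.\<close>

lemma coreset_risk_bound:
  fixes \<psi> :: "real \<Rightarrow> real" and \<beta> :: real
  assumes \<psi>: "cutoff_function \<psi>" and \<beta>: "0 < \<beta>"
  shows "\<exists>cR :: real \<Rightarrow> real. (\<forall>L>0. 0 < cR L) \<and>
    (\<forall>L>0. \<forall>n\<ge>1. \<forall>T S lam. \<forall>f \<in> holder_densities \<beta> L.
      2 * real n powr (1 / (2 * \<beta> + CARD('d))) \<le> T \<longrightarrow> caratheodory_selection n T S lam \<longrightarrow>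
      risk n (coreset_estimator (product_kernel \<psi>) (real n powr (- 1 / (2 * \<beta> + CARD('d)))) S lam) (f :: real^'d \<Rightarrow> real)
        \<le> ennreal (cR L * real n powr (- \<beta> / (2 * \<beta> + CARD('d)))))"
proof (rule coreset_close[OF assms, where 'd = 'd], rule smoothing_bias[OF assms, where 'd = 'd],
    rule scaled_kernel_square_integral[OF \<psi>, where 'd = 'd], rule poly_weight_square_integral[where 'a = "real^'d"])
  fix C1 C2 V w :: real
  assume C1: "0 \<le> C1" "\<And>h T n (X :: nat \<Rightarrow> real^'d) S lam y. 0 < h \<Longrightarrow> h \<le> 1 \<Longrightarrow> 2 / h \<le> T \<Longrightarrow> 1 \<le> n \<Longrightarrow>
    caratheodory_coreset n T X S lam \<Longrightarrow> (\<And>j. j \<in> {1..n} \<Longrightarrow> X j \<in> unit_cube) \<Longrightarrow>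
    \<bar>(\<Sum>j\<in>S. lam j * scaled_kernel (product_kernel \<psi>) h (X j - y))
      - (\<Sum>j=1..n. scaled_kernel (product_kernel \<psi>) h (X j - y)) / n\<bar> \<le> C1 * h powr \<beta> * poly_weight y"
  assume C2: "0 \<le> C2" "\<And>L h f y. 0 < L \<Longrightarrow> 0 < h \<Longrightarrow> h \<le> 1 \<Longrightarrow> f \<in> holder_class \<beta> L \<Longrightarrow> f \<in> borel_measurable borel \<Longrightarrow>
    \<bar>(\<integral>x. scaled_kernel (product_kernel \<psi>) h (x - y) * f x \<partial>lborel) - f y\<bar> \<le> C2 * L * h powr \<beta> * poly_weight (y :: real^'d)"
  assume V: "0 \<le> V" "\<And>h (x :: real^'d). 0 < h \<Longrightarrow> h \<le> 1 \<Longrightarrow>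
    (\<integral>\<^sup>+y. ennreal ((scaled_kernel (product_kernel \<psi>) h (x - y))\<^sup>2) \<partial>lborel) \<le> ennreal (V / h ^ CARD('d))"
  assume w: "0 \<le> w" "(\<integral>\<^sup>+y. ennreal ((poly_weight (y :: real^'d))\<^sup>2) \<partial>lborel) \<le> ennreal w"
  define cR where "cR L = 1 / 2 + V + (C1 + C2 * L)\<^sup>2 * w" for L
  have "0 < cR L" for L
    using V(1) w(1) unfolding cR_def by (intro add_pos_nonneg) auto
  moreover have "risk n (coreset_estimator (product_kernel \<psi>) (real n powr (- 1 / (2 * \<beta> + CARD('d)))) S lam) f
        \<le> ennreal (cR L * real n powr (- \<beta> / (2 * \<beta> + CARD('d))))"
    if L: "0 < L" and n: "1 \<le> n" and f: "f \<in> holder_densities \<beta> L"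
      and T: "2 * real n powr (1 / (2 * \<beta> + CARD('d))) \<le> T" and sel: "caratheodory_selection n T S lam"
    for L T :: real and n S lam and f :: "real^'d \<Rightarrow> real"
  proof -
    define h where "h = real n powr (- 1 / (2 * \<beta> + CARD('d)))"
    define a where "a = real n powr (- \<beta> / (2 * \<beta> + CARD('d)))"
    note r = rate_identities[OF \<beta>, of "CARD('d)" n, folded h_def a_def]
    have h: "0 < h" "h \<le> 1" and a: "0 < a" and ha: "h powr \<beta> = a" and na: "1 / n / h powr CARD('d) = a\<^sup>2"
      and Th: "2 / h \<le> T"
      using r n T by auto
    define k where "k = (scaled_kernel (product_kernel \<psi>) h :: real^'d \<Rightarrow> real)"
    have k [measurable]: "k \<in> borel_measurable borel"
      unfolding k_def by (rule scaled_kernel_measurable[OF \<psi>])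
    obtain B where B: "\<And>x. \<bar>k x\<bar> \<le> B"
      using scaled_kernel_bounded[OF \<psi>, where 'd = 'd] unfolding k_def by blast
    have fm [measurable]: "f \<in> borel_measurable borel" and f0: "\<And>x. 0 \<le> f x" and fh: "f \<in> holder_class \<beta> L"
      using f by (auto simp: holder_densities_def)
    let ?N = "density lborel (\<lambda>x. ennreal (f x))"
    let ?P = "PiM {1..n} (\<lambda>_. ?N)"
    have N: "prob_space ?N" by (rule holder_densities_prob_space(1)[OF f])
    define \<mu> where "\<mu> y = (\<integral>x. k (x - y) * f x \<partial>lborel)" for y
    have [measurable]: "\<mu> \<in> borel_measurable borel"
      unfolding \<mu>_def[abs_def] by measurable
    define \<Phi> where "\<Phi> X y = (\<Sum>j=1..n. k (X j - y)) / n - \<mu> y" for X y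
    have V': "(\<integral>\<^sup>+y. ennreal ((k (x - y))\<^sup>2) \<partial>lborel) \<le> ennreal (V / h ^ CARD('d))" for x
      unfolding k_def by (rule V(2)[OF h])
    note iv = integrated_variance_le[OF N fm f0 k B V' n]
    have "ennreal (1 / n) * ennreal (V / h ^ CARD('d)) = ennreal (V * (1 / n / h powr CARD('d)))"
      using V(1) h by (subst ennreal_mult[symmetric]) (auto simp: powr_realpow)
    also have "\<dots> = ennreal (V * a\<^sup>2)"
      by (simp only: na)
    finally have var: "(\<integral>\<^sup>+X. (\<integral>\<^sup>+y. ennreal ((\<Phi> X y)\<^sup>2) \<partial>lborel) \<partial>?P) \<le> ennreal (V * a\<^sup>2)"
      using iv(1) by (simp only: \<Phi>_def \<mu>_def)
    \<comment> \<open>Samples lie in the cube only almost surely, which is why the error bound is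
      stated almost everywhere.\<close>
    have "AE X in ?P. \<forall>j\<in>{1..n}. X j \<in> unit_cube"
      by (intro AE_finite_allI AE_PiM_component N holder_densities_prob_space(2)[OF f]) auto
    then have err: "AE X in ?P. \<forall>y. \<bar>coreset_estimator (product_kernel \<psi>) h S lam X y - f y - \<Phi> X y\<bar>
        \<le> (C1 + C2 * L) * a * poly_weight y"
      using AE_space
    proof eventually_elim
      case (elim X)
      have "X \<in> space (data_space n)"
        using elim(2) by (simp add: space_PiM)
      then have core: "caratheodory_coreset n T X (S X) (lam X)"
        using sel by (auto simp: caratheodory_selection_def)
      show ?case
      proof
        fix y
        have "\<bar>coreset_estimator (product_kernel \<psi>) h S lam X y - (\<Sum>j=1..n. k (X j - y)) / n\<bar> \<le> C1 * a * poly_weight y"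
          unfolding coreset_estimator_def k_def ha[symmetric]
          by (rule C1(2)[OF h Th n core]) (use elim(1) in auto)
        moreover have "\<bar>\<mu> y - f y\<bar> \<le> C2 * L * a * poly_weight y"
          unfolding \<mu>_def k_def ha[symmetric] by (rule C2(2)[OF L h fh fm])
        ultimately show "\<bar>coreset_estimator (product_kernel \<psi>) h S lam X y - f y - \<Phi> X y\<bar> \<le> (C1 + C2 * L) * a * poly_weight y"
          unfolding \<Phi>_def by (simp add: distrib_right)
      qed
    qed
    have "risk n (coreset_estimator (product_kernel \<psi>) h S lam) f \<le> ennreal ((1 / 2 + V + (C1 + C2 * L)\<^sup>2 * w) * a)"
    proof (rule risk_le_variance_bias[OF prob_space_PiM a V(1) w(1) _ _ var err w(2)])
      show "(\<lambda>X. \<integral>\<^sup>+y. ennreal ((\<Phi> X y)\<^sup>2) \<partial>lborel) \<in> borel_measurable ?P"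
        unfolding \<Phi>_def \<mu>_def by (rule iv(2))
      show "(\<lambda>y. \<Phi> X y) \<in> borel_measurable borel" for X
        unfolding \<Phi>_def by measurable
    qed (rule N)
    then show ?thesis
      by (simp only: cR_def h_def a_def)
  qed
  ultimately show ?thesis by blast
qed

text \<open>Dividing \<epsilon> by d in the exponent of \<open>T\<close> turns it into \<epsilon>
  after the d-th power. The 8 is 4 times the constant 2 in \<open>T\<close>, and n >= 1 lets the
  additive constants be absorbed into the power.\<close>

lemma caratheodory_card_le:
  fixes d s \<epsilon> :: real
  assumes "0 < \<epsilon>" "0 < s" "1 \<le> (n::nat)" "real (card S) \<le> 2 * (1 + 4 * T / pi) ^ CARD('d) + 1"
    and "d = real CARD('d::finite)" "T = 2 * real n powr (\<epsilon> / d + 1 / s)"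
  shows "real (card S) \<le> (2 * (1 + 8 / pi) ^ CARD('d) + 1) * real n powr (d / s + \<epsilon>)"
proof -
  define p where "p = real n powr (\<epsilon> / d + 1 / s)"
  have d: "0 < d" using assms(5) by simp
  have p1: "1 \<le> p"
    unfolding p_def using assms(1-3) d by (intro ge_one_powr_ge_zero) auto
  have pd: "p ^ CARD('d) = real n powr (d / s + \<epsilon>)"
  proof -
    have "p ^ CARD('d) = p powr d"
      using p1 assms(5) by (simp add: powr_realpow)
    also have "\<dots> = real n powr (d / s + \<epsilon>)"
      unfolding p_def powr_powr using d by (simp add: distrib_right add.commute)
    finally show ?thesis .
  qed
  have "1 + 4 * T / pi \<le> (1 + 8 / pi) * p"
    using p1 by (simp add: assms(6) p_def[symmetric] distrib_right)
  then have "(1 + 4 * T / pi) ^ CARD('d) \<le> ((1 + 8 / pi) * p) ^ CARD('d)"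
    using p1 by (intro power_mono) (auto simp: assms(6) p_def[symmetric])
  moreover have "1 \<le> p ^ CARD('d)"
    using p1 by (rule one_le_power)
  ultimately have "real (card S) \<le> 2 * ((1 + 8 / pi) * p) ^ CARD('d) + p ^ CARD('d)"
    using assms(4) by linarith
  then show ?thesis
    unfolding pd[symmetric] power_mult_distrib by (simp add: algebra_simps)
qed

text \<open>The constants are chosen after \<psi>, \<beta> and the dimension, and are functions of
  \<epsilon> or of \<open>L\<close> alone; this encodes which parameters they may depend on.\<close>

theorem theorem2:
  fixes \<psi> :: "real \<Rightarrow> real" and \<beta> :: real
  assumes "cutoff_function \<psi>" and "0 < \<beta>"
  shows "\<exists>cT cM cR :: real \<Rightarrow> real.
    (\<forall>\<epsilon>>0. 0 < cT \<epsilon> \<and> 0 < cM \<epsilon>) \<and> (\<forall>L>0. 0 < cR L) \<and>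
    (\<forall>L>0. \<forall>\<epsilon>>0. \<forall>n\<ge>1.
      let d = real CARD('d);
          h = real n powr (- 1 / (2 * \<beta> + d));
          T = cT \<epsilon> * real n powr (\<epsilon> / d + 1 / (2 * \<beta> + d))
      in \<forall>(S :: (nat \<Rightarrow> real^'d) \<Rightarrow> nat set) (lam :: (nat \<Rightarrow> real^'d) \<Rightarrow> nat \<Rightarrow> real).
        caratheodory_selection n T S lam \<longrightarrow>
          (SUP f\<in>holder_densities \<beta> L. risk n (coreset_estimator (product_kernel \<psi>) h S lam) f)
            \<le> ennreal (cR L * real n powr (- \<beta> / (2 * \<beta> + d))) \<and>
          (\<forall>X\<in>space (data_space n).
            real (card (S X)) \<le> cM \<epsilon> * real n powr (d / (2 * \<beta> + d) + \<epsilon>)))"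
proof -
  obtain cR where cR: "\<forall>L>0. 0 < cR L" and risk:
    "\<forall>L>0. \<forall>n\<ge>1. \<forall>T S lam. \<forall>f \<in> holder_densities \<beta> L.
      2 * real n powr (1 / (2 * \<beta> + CARD('d))) \<le> T \<longrightarrow> caratheodory_selection n T S lam \<longrightarrow>
      risk n (coreset_estimator (product_kernel \<psi>) (real n powr (- 1 / (2 * \<beta> + CARD('d)))) S lam) (f :: real^'d \<Rightarrow> real)
        \<le> ennreal (cR L * real n powr (- \<beta> / (2 * \<beta> + CARD('d))))"
    using coreset_risk_bound[OF assms, where 'd = 'd] by (elim exE conjE)
  define cM :: "real \<Rightarrow> real" where "cM = (\<lambda>_. 2 * (1 + 8 / pi) ^ CARD('d) + 1)"
  show ?thesis
    unfolding Let_def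
  proof (rule exI[of _ "\<lambda>_. 2"], rule exI[of _ cM], rule exI[of _ cR], intro conjI allI impI)
    show "0 < cM \<epsilon>" for \<epsilon>
      by (auto simp: cM_def intro!: add_nonneg_pos)
    show "0 < cR L" if "0 < L" for L
      using cR that by blast
    fix L \<epsilon> :: real and n and S :: "(nat \<Rightarrow> real^'d) \<Rightarrow> nat set" and lam
    let ?d = "real CARD('d)"
    let ?T = "2 * real n powr (\<epsilon> / ?d + 1 / (2 * \<beta> + ?d))"
    assume L: "0 < L" and \<epsilon>: "0 < \<epsilon>" and n: "1 \<le> n" and sel: "caratheodory_selection n ?T S lam"
    \<comment> \<open>Since n >= 1, the extra exponent \<epsilon>/d can only enlarge the cutoff, so
      \<open>?T\<close> is at least 2/h.\<close>
    have "real n powr (1 / (2 * \<beta> + ?d)) \<le> real n powr (\<epsilon> / ?d + 1 / (2 * \<beta> + ?d))"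
      using n \<epsilon> by (intro powr_mono) auto
    then have T: "2 * real n powr (1 / (2 * \<beta> + CARD('d))) \<le> ?T" by simp
    show "(SUP f\<in>holder_densities \<beta> L. risk n (coreset_estimator (product_kernel \<psi>) (real n powr (- 1 / (2 * \<beta> + ?d))) S lam) f)
        \<le> ennreal (cR L * real n powr (- \<beta> / (2 * \<beta> + ?d)))"
      by (rule SUP_least) (use risk L n T sel in blast)
    show "\<forall>X\<in>space (data_space n). real (card (S X)) \<le> cM \<epsilon> * real n powr (?d / (2 * \<beta> + ?d) + \<epsilon>)"
    proof
      fix X :: "nat \<Rightarrow> real^'d" assume "X \<in> space (data_space n)"
      then have "real (card (S X)) \<le> 2 * (1 + 4 * ?T / pi) ^ CARD('d) + 1"
        using sel unfolding caratheodory_selection_def caratheodory_coreset_def by blast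
      then show "real (card (S X)) \<le> cM \<epsilon> * real n powr (?d / (2 * \<beta> + ?d) + \<epsilon>)"
        unfolding cM_def using assms(2) by (intro caratheodory_card_le[OF \<epsilon> _ n _ refl refl]) auto
    qed
  qed simp
qed

end
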